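(* Let $d\ge 2$ and let $(\Omega_\varepsilon)_{\varepsilon>0}$ be a family of thin convex domains in $\mathbb{R}^d$ over a base $A\subset\mathbb{R}^{d-1}$ with local thickness $h$. Then the limit of $F_{1/2}(\Omega_\varepsilon)$ as $\varepsilon\to0^+$ satisfies $$\lim_{\varepsilon\to0^+}F_{1/2}(\Omega_\varepsilon)\le d\left(\frac{2}{(d+1)(d+2)}\right)^{1/2}.$$ In addition, the inequality becomes an equality when $A$ is the unit ball of $\mathbb{R}^{d-1}$ and the local thickness is $h(s)=1-|s|$.
   Context: Thin convex domains: let $A\subset\mathbb{R}^{d-1}$ be a nonempty bounded open convex set, and let $h_-,h_+:A\to\mathbb{R}$ be Lipschitz functions with $h_-$ convex, $h_+$ concave, $h_-\le h_+$ and $h_+-h_-$ not identically zero. For $\varepsilon>0$ set $$\Omega_\varepsilon=\{(s,t)\in\mathbb{R}^{d-1}\times\mathbb{R}\ :\ s\in A,\ \varepsilon h_-(s)<t<\varepsilon h_+(s)\},$$ which is an open convex subset of $\mathbb{R}^d$. The local thickness is the (nonnegative concave) function $h(s)=h_+(s)-h_-(s)$. (For instance $h_-=0$, $h_+(s)=1-|s|$ on the unit ball.) For a nonempty open set $\Omega\subset\mathbb{R}^d$ with finite Lebesgue measure $|\Omega|$: - $P(\Omega)=\sup\{\int_\Omega \mathrm{div}\,\phi\,dx : \phi\in C^1_c(\mathbb{R}^d;\mathbb{R}^d),\ \|\phi\|_{L^\infty(\mathbb{R}^d)}\le 1\}$ is the (De Giorgi) perimeter. - $T(\Omega)=\int_\Omega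 u\,dx$ is the torsional rigidity, where $u\in H^1_0(\Omega)$ is the unique (weak) solution of $-\Delta u=1$ in $\Omega$. Equivalently, $T(\Omega)=\max\{(\int_\Omega u\,dx)^2(\int_\Omega|\nabla u|^2dx)^{-1} : u\in H^1_0(\Omega)\setminus\{0\}\}$. - $F_{1/2}(\Omega)=\dfrac{P(\Omega)\,T(\Omega)^{1/2}}{|\Omega|^{3/2}}$. *)

theory Defs
  imports "HOL-Analysis.Analysis"
begin

text \<open>
  Ambient space: \<open>\<real>\<^sup>d\<close> is the product type \<open>'a \<times> real\<close>, where the Euclidean space \<open>'a\<close> has dimension
  \<open>d - 1\<close>; its norm is the Euclidean one and \<open>lborel\<close> is Lebesgue measure on it.  The general
  notions below are stated over an arbitrary Euclidean space.
\<close>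

text \<open>In finite dimension, \<open>f\<close> is of class \<open>C\<^sup>k\<^sup>+\<^sup>1\<close> iff it is differentiable and each of its
  directional derivatives is of class \<open>C\<^sup>k\<close>.\<close>

primrec C_k :: "nat \<Rightarrow> ('a::euclidean_space \<Rightarrow> 'b::real_normed_vector) \<Rightarrow> bool" where
  "C_k 0 f \<longleftrightarrow> continuous_on UNIV f"
| "C_k (Suc k) f \<longleftrightarrow>
     (\<forall>x. f differentiable (at x)) \<and> (\<forall>v. C_k k (\<lambda>x. frechet_derivative f (at x) v))"

definition supp :: "('a::euclidean_space \<Rightarrow> 'b::real_normed_vector) \<Rightarrow> 'a set" where
  "supp f = closure {x. f x \<noteq> 0}"

definition grad :: "('a::euclidean_space \<Rightarrow> real) \<Rightarrow> 'a \<Rightarrow> 'a" where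
  "grad f x = (\<Sum>b\<in>Basis. frechet_derivative f (at x) b *\<^sub>R b)"

definition divergence :: "('a::euclidean_space \<Rightarrow> 'a) \<Rightarrow> 'a \<Rightarrow> real" where
  "divergence \<phi> x = (\<Sum>b\<in>Basis. frechet_derivative \<phi> (at x) b \<bullet> b)"

text \<open>The De Giorgi perimeter may be infinite, hence its type.  The competitors are continuous,
  so their \<open>L\<^sup>\<infinity>\<close> norm is the pointwise supremum of the Euclidean norm.\<close>

definition perimeter :: "'a::euclidean_space set \<Rightarrow> ereal" where
  "perimeter \<Omega> =
     (SUP \<phi>\<in>{\<phi> :: 'a \<Rightarrow> 'a. C_k 1 \<phi> \<and> compact (supp \<phi>) \<and> (\<forall>x. norm (\<phi> x) \<le> 1)}.
        ereal (LINT x:\<Omega>|lborel. divergence \<phi> x))"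

definition test_function :: "'a::euclidean_space set \<Rightarrow> ('a \<Rightarrow> real) \<Rightarrow> bool" where
  "test_function \<Omega> \<phi> \<longleftrightarrow> (\<forall>k. C_k k \<phi>) \<and> compact (supp \<phi>) \<and> supp \<phi> \<subseteq> \<Omega>"

text \<open>Elements of \<open>L\<^sup>2(\<Omega>)\<close> are represented by Borel functions; values outside \<open>\<Omega>\<close> are irrelevant.\<close>

definition L2_on ::
  "'a::euclidean_space set \<Rightarrow> ('a \<Rightarrow> 'b::euclidean_space) \<Rightarrow> bool" where
  "L2_on \<Omega> f \<longleftrightarrow>
     set_borel_measurable lborel \<Omega> f \<and> set_integrable lborel \<Omega> (\<lambda>x. (norm (f x))\<^sup>2)"

definition weak_gradient :: "'a::euclidean_space set \<Rightarrow> ('a \<Rightarrow> real) \<Rightarrow> ('a \<Rightarrow> 'a) \<Rightarrow> bool" where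
  "weak_gradient \<Omega> u g \<longleftrightarrow>
     (\<forall>\<phi>. test_function \<Omega> \<phi> \<longrightarrow>
        (LINT x:\<Omega>|lborel. u x *\<^sub>R grad \<phi> x) = - (LINT x:\<Omega>|lborel. \<phi> x *\<^sub>R g x))"

text \<open>\<open>H1 \<Omega> u g\<close>: \<open>u\<close> belongs to \<open>H\<^sup>1(\<Omega>)\<close> and \<open>g\<close> is (a representative of) its weak gradient.
  \<open>H1_0 \<Omega> u g\<close>: moreover \<open>u\<close> lies in the \<open>H\<^sup>1\<close>-closure of the test functions on \<open>\<Omega>\<close>.\<close>

definition H1 :: "'a::euclidean_space set \<Rightarrow> ('a \<Rightarrow> real) \<Rightarrow> ('a \<Rightarrow> 'a) \<Rightarrow> bool" where
  "H1 \<Omega> u g \<longleftrightarrow> L2_on \<Omega> u \<and> L2_on \<Omega> g \<and> weak_gradient \<Omega> u g"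

definition H1_0 :: "'a::euclidean_space set \<Rightarrow> ('a \<Rightarrow> real) \<Rightarrow> ('a \<Rightarrow> 'a) \<Rightarrow> bool" where
  "H1_0 \<Omega> u g \<longleftrightarrow>
     H1 \<Omega> u g \<and>
     (\<exists>\<phi> :: nat \<Rightarrow> 'a \<Rightarrow> real. (\<forall>n. test_function \<Omega> (\<phi> n)) \<and>
        (\<lambda>n. LINT x:\<Omega>|lborel. (\<phi> n x - u x)\<^sup>2) \<longlonglongrightarrow> 0 \<and>
        (\<lambda>n. LINT x:\<Omega>|lborel. (norm (grad (\<phi> n) x - g x))\<^sup>2) \<longlonglongrightarrow> 0)"

text \<open>Weak solutions in \<open>H\<^sup>1\<^sub>0(\<Omega>)\<close> of \<open>-\<Delta>u = 1\<close>.\<close>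

definition torsion_function :: "'a::euclidean_space set \<Rightarrow> ('a \<Rightarrow> real) \<Rightarrow> bool" where
  "torsion_function \<Omega> u \<longleftrightarrow>
     (\<exists>g. H1_0 \<Omega> u g \<and>
        (\<forall>\<phi>. test_function \<Omega> \<phi> \<longrightarrow>
           (LINT x:\<Omega>|lborel. g x \<bullet> grad \<phi> x) = (LINT x:\<Omega>|lborel. \<phi> x)))"

text \<open>The weak solution is unique only almost everywhere, so the definite description ranges over
  the value of its integral.\<close>

definition torsional_rigidity :: "'a::euclidean_space set \<Rightarrow> real" where
  "torsional_rigidity \<Omega> = (THE T. \<exists>u. torsion_function \<Omega> u \<and> T = (LINT x:\<Omega>|lborel. u x))"

definition F_half :: "'a::euclidean_space set \<Rightarrow> ereal" where
  "F_half \<Omega> =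
     perimeter \<Omega> * ereal (torsional_rigidity \<Omega> powr (1/2)) / ereal (measure lborel \<Omega> powr (3/2))"

definition thin_domain ::
  "'a::euclidean_space set \<Rightarrow> ('a \<Rightarrow> real) \<Rightarrow> ('a \<Rightarrow> real) \<Rightarrow> real \<Rightarrow> ('a \<times> real) set" where
  "thin_domain A hm hp \<epsilon> = {(s, t). s \<in> A \<and> \<epsilon> * hm s < t \<and> t < \<epsilon> * hp s}"

end

theory Submission
  imports Defs
begin

text \<open>
  Let \<open>h = hp - hm\<close>, \<open>I\<^sub>p = \<integral>\<^sub>A h\<^sup>p\<close> and let \<open>\<Omega>\<^sub>\<epsilon>\<close> be the thin domain.  As \<open>\<epsilon> \<rightarrow> 0\<close> one has
  \<open>|\<Omega>\<^sub>\<epsilon>| = \<epsilon> I\<^sub>1\<close>, \<open>P(\<Omega>\<^sub>\<epsilon>) \<rightarrow> 2 |A|\<close> and \<open>T(\<Omega>\<^sub>\<epsilon>) / \<epsilon>\<^sup>3 \<rightarrow> I\<^sub>3 / 12\<close>, so that \<open>F_half\<close> tends to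
  \<open>2 |A| sqrt (I\<^sub>3 / (12 I\<^sub>1\<^sup>3))\<close>.  The perimeter of a bounded convex set is controlled by the areas of its
  shadows in the coordinate directions, all of which but the vertical one are of order \<open>\<epsilon>\<close>.  The
  torsional rigidity is the supremum of \<open>2 \<integral> \<phi> - \<integral> |\<nabla>\<phi>|\<^sup>2\<close> over test functions; slice by slice it is bounded
  by that of an interval of length \<open>\<epsilon> h\<close>, and smoothed parabolic profiles attain this bound.  The
  inequality \<open>|A|\<^sup>2 I\<^sub>3 \<le> 6 d\<^sup>2 / ((d + 1) (d + 2)) I\<^sub>1\<^sup>3\<close> follows from Brunn--Minkowski in \<open>\<real>\<^sup>d\<close> applied to the parts
  \<open>{a < t < h(s)}\<close> of the subgraph: their volume is at most that of the corresponding part of the cone with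
  the same base and the same volume.
\<close>

section \<open>Calculus of smooth functions\<close>

text \<open>No convergence of solutions is involved. The profile \<open>(t - f)(g - t)/2\<close>
  solves \<open>-w'' = 1\<close> on each vertical segment but is as rough in \<open>s\<close> as
  \<open>f\<close> and \<open>g\<close>; it is smoothed to a test function fixed before
  \<open>\<epsilon> \<rightarrow> 0\<close>, so its horizontal derivatives, however large, enter
  only at order \<open>\<epsilon>^5\<close> against the leading \<open>\<epsilon>^3\<close>. For the
  perimeter no boundary measure appears: a smoothed sign of \<open>t - (f + g)/2\<close>, taken as a
  vertical field, gives the lower bound \<open>2 |A|\<close> at every \<open>\<epsilon> > 0\<close>.

  In the geometric inequality let \<open>v(a)\<close> be the volume of the subgraph above level
  \<open>a\<close>. Its d-th root is concave by Brunn-Minkowski and \<open>v'(0) = -|A|\<close>, so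
  the tangent at 0 gives \<open>v(a) \<le> v(0) (1 - c a)^d\<close> as long as
  \<open>c a \<le> 1\<close>, with \<open>c = |A| / (d v(0))\<close>. As \<open>h^3\<close> is the
  integral of \<open>6 a (h - a)\<close> over \<open>0 \<le> a \<le> h\<close>, the integral of
  \<open>h^3\<close> is that of \<open>6 a v(a)\<close>, and the Beta integral of
  \<open>a (1 - c a)^d\<close> produces \<open>(d + 1) (d + 2)\<close>. For the cone the tangent
  bound is an equality at every level.\<close>

lemma C_k_cont: "C_k k f \<Longrightarrow> continuous_on UNIV f"
  by (cases k) (auto intro!: continuous_at_imp_continuous_on differentiable_imp_continuous_within)

lemma C_k_Suc_D: "C_k (Suc k) f \<Longrightarrow> C_k k f"
proof (induction k arbitrary: f)
  case 0 then show ?case using C_k_cont by (metis C_k.simps(1))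
next
  case (Suc k)
  then show ?case by (metis C_k.simps(2))
qed

lemma C_k_SucI:
  assumes "\<And>x. (f has_derivative f' x) (at x)" "\<And>v. C_k k (\<lambda>x. f' x v)"
  shows "C_k (Suc k) f"
proof -
  have "frechet_derivative f (at x) = f' x" for x
    using assms(1) frechet_derivative_at by metis
  then show ?thesis using assms by (auto simp: differentiable_def)
qed

lemma C_k_has_derivative:
  "C_k (Suc k) f \<Longrightarrow> (f has_derivative frechet_derivative f (at x)) (at x)"
  by (simp add: frechet_derivative_works[symmetric])

lemma C_k_frechet: "C_k (Suc k) f \<Longrightarrow> C_k k (\<lambda>x. frechet_derivative f (at x) v)"
  by simp

lemma C_k_const: "C_k k (\<lambda>x. c)"
  by (induction k arbitrary: c) (auto intro!: C_k_SucI[where f'="\<lambda>x v. 0"] simp del: C_k.simps(2))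

lemma C_k_add: "C_k k f \<Longrightarrow> C_k k g \<Longrightarrow> C_k k (\<lambda>x. f x + g x)"
proof (induction k arbitrary: f g)
  case 0 then show ?case by (auto intro: continuous_intros)
next
  case (Suc k)
  show ?case
    by (rule C_k_SucI[OF has_derivative_add[OF C_k_has_derivative[OF Suc.prems(1)] C_k_has_derivative[OF Suc.prems(2)]]])
      (intro Suc.IH C_k_frechet Suc.prems)
qed

lemma C_k_linear_left:
  assumes "bounded_linear L"
  shows "C_k k f \<Longrightarrow> C_k k (\<lambda>x. L (f x))"
proof (induction k arbitrary: f)
  case 0 then show ?case using assms
    by (auto intro: continuous_on_compose2[OF linear_continuous_on])
next
  case (Suc k)
  show ?case
    by (rule C_k_SucI[OF bounded_linear.has_derivative[OF assms C_k_has_derivative[OF Suc.prems]]])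
      (intro Suc.IH C_k_frechet Suc.prems)
qed

lemma C_k_linear_right:
  fixes L :: "'a::euclidean_space \<Rightarrow> 'b::euclidean_space"
  assumes "bounded_linear L"
  shows "C_k k f \<Longrightarrow> C_k k (\<lambda>x. f (L x))"
proof (induction k arbitrary: f)
  case 0 then show ?case using assms
    by (auto intro: continuous_on_compose2[of UNIV f] linear_continuous_on)
next
  case (Suc k)
  show ?case
    by (rule C_k_SucI[OF has_derivative_compose[OF bounded_linear_imp_has_derivative[OF assms] C_k_has_derivative[OF Suc.prems]]])
      (intro Suc.IH C_k_frechet Suc.prems)
qed

lemma C_k_linear: "bounded_linear L \<Longrightarrow> C_k k L" for L :: "'a::euclidean_space \<Rightarrow> 'b::real_normed_vector"
proof (cases k)
  case 0 then show "bounded_linear L \<Longrightarrow> C_k k L" by (auto intro: linear_continuous_on)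
next
  case (Suc j)
  then show "bounded_linear L \<Longrightarrow> C_k k L"
    by (auto intro!: C_k_SucI[where f'="\<lambda>x. L"] C_k_const intro: bounded_linear_imp_has_derivative simp del: C_k.simps)
qed

lemma C_k_mult:
  fixes f g :: "'a::euclidean_space \<Rightarrow> real"
  shows "C_k k f \<Longrightarrow> C_k k g \<Longrightarrow> C_k k (\<lambda>x. f x * g x)"
proof (induction k arbitrary: f g)
  case 0 then show ?case by (auto intro: continuous_intros)
next
  case (Suc k)
  show ?case
    by (rule C_k_SucI[OF has_derivative_mult[OF C_k_has_derivative[OF Suc.prems(1)] C_k_has_derivative[OF Suc.prems(2)]]])
      (intro C_k_add Suc.IH C_k_frechet Suc.prems C_k_Suc_D[OF Suc.prems(1)] C_k_Suc_D[OF Suc.prems(2)])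
qed

lemma C_k_minus: "C_k k f \<Longrightarrow> C_k k (\<lambda>x. - f x)"
  by (rule C_k_linear_left[OF bounded_linear_minus[OF bounded_linear_ident]])

lemma C_k_diff: "C_k k f \<Longrightarrow> C_k k g \<Longrightarrow> C_k k (\<lambda>x. f x - g x)"
  using C_k_add[OF _ C_k_minus, of k f g] by simp

lemma C_k_sum: "(\<And>i. i \<in> I \<Longrightarrow> C_k k (f i)) \<Longrightarrow> C_k k (\<lambda>x. \<Sum>i\<in>I. f i x)"
  by (induction I rule: infinite_finite_induct) (auto intro!: C_k_const C_k_add simp del: C_k.simps)

text \<open>\<open>F\<close> lists a function together with all its derivatives, so the chain rule
  lets the induction on \<open>k\<close> pass from \<open>F n\<close> to \<open>F (Suc n)\<close>.
  Smoothness in one variable is thus supplied as data, and \<open>n\<close> stays arbitrary.\<close>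

lemma C_k_compose:
  fixes F :: "nat \<Rightarrow> real \<Rightarrow> real" and g :: "'a::euclidean_space \<Rightarrow> real"
  assumes F: "\<And>n x. (F n has_real_derivative F (Suc n) x) (at x)"
  shows "C_k k g \<Longrightarrow> C_k k (\<lambda>x. F n (g x))"
proof (induction k arbitrary: g n)
  case 0
  have "continuous_on UNIV (F n)"
    using F by (meson DERIV_continuous_on DERIV_subset subset_UNIV)
  then show ?case using 0 by (auto intro!: continuous_on_compose2[of UNIV "F n"])
next
  case (Suc k)
  have "((\<lambda>x. F n (g x)) has_derivative (\<lambda>v. F (Suc n) (g x) * frechet_derivative g (at x) v)) (at x)" for x
    by (rule has_derivative_compose[OF C_k_has_derivative[OF Suc.prems]
      F[of n, THEN has_field_derivative_imp_has_derivative]])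
  then show ?case
    by (rule C_k_SucI) (intro C_k_mult Suc.IH C_k_frechet Suc.prems C_k_Suc_D[OF Suc.prems])
qed

lemma C_k_real_polynomial:
  assumes "real_polynomial_function p" shows "C_k k p"
  using assms
  by induction (auto intro: C_k_linear C_k_const C_k_add C_k_mult simp del: C_k.simps)

section \<open>Flat functions of the form P(1/x) exp(-1/x)\<close>

definition exp_recip :: "real poly \<Rightarrow> real \<Rightarrow> real" where
  "exp_recip p x = (if x > 0 then poly p (1/x) * exp (- (1/x)) else 0)"

text \<open>With \<open>y = 1/x\<close> and \<open>y' = -y^2\<close>, the derivative of
  \<open>p(y) exp(-y)\<close> is \<open>y^2 (p(y) - p'(y)) exp(-y)\<close>. The class is therefore
  closed under differentiation, and iterating this map on \<open>1\<close> gives all derivatives of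
  \<open>exp(-1/x)\<close>.\<close>

definition exp_recip_step :: "real poly \<Rightarrow> real poly" where
  "exp_recip_step p = [:0,0,1:] * (p - pderiv p)"

lemma poly_exp_decay: "((\<lambda>y. poly p y * exp (- y)) \<longlongrightarrow> 0) at_top" for p :: "real poly"
proof -
  have "((\<lambda>y. \<Sum>i\<le>degree p. coeff p i * (y ^ i / exp y)) \<longlongrightarrow> (\<Sum>i\<le>degree p. coeff p i * 0)) at_top"
    by (intro tendsto_sum tendsto_mult tendsto_const tendsto_power_div_exp_0)
  then show ?thesis
    by (simp add: poly_altdef exp_minus sum_distrib_right divide_inverse mult.assoc)
qed

lemma exp_recip_deriv:
  "(exp_recip p has_real_derivative exp_recip (exp_recip_step p) x) (at x)"
proof -
  consider "x > 0" | "x < 0" | "x = 0" by linarith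
  then show ?thesis
  proof cases
    case 1
    have "((\<lambda>x. poly p (1/x) * exp (- (1/x))) has_real_derivative exp_recip (exp_recip_step p) x) (at x)"
      using 1 by (auto intro!: derivative_eq_intros DERIV_chain'[where g="poly p"] poly_DERIV
          simp: exp_recip_def exp_recip_step_def field_simps power2_eq_square)
    then show ?thesis
      by (rule has_field_derivative_transform_within_open[where S="{0<..}"])
        (use 1 in \<open>auto simp: exp_recip_def\<close>)
  next
    case 2
    have "((\<lambda>x. 0) has_real_derivative exp_recip (exp_recip_step p) x) (at x)"
      using 2 by (simp add: exp_recip_def)
    then show ?thesis
      by (rule has_field_derivative_transform_within_open[where S="{..<0}"])
        (use 2 in \<open>auto simp: exp_recip_def\<close>)
  next
    case 3
    \<comment> \<open>The difference quotient at \<open>0\<close> from the right is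
      \<open>exp_recip p h / h\<close>; dividing by \<open>h\<close> multiplies the polynomial in
      \<open>1/h\<close> by its variable, which is \<open>pCons 0 p\<close>.\<close>
    have "((\<lambda>h. poly (pCons 0 p) (inverse h) * exp (- (inverse h))) \<longlongrightarrow> 0) (at_right 0)"
      using filterlim_compose[OF poly_exp_decay[of "pCons 0 p"] filterlim_inverse_at_top_right] by simp
    then have "((\<lambda>h. exp_recip p h / h) \<longlongrightarrow> 0) (at_right 0)"
      by (rule Lim_transform_eventually)
        (auto simp: exp_recip_def eventually_at_right_less field_simps intro!: eventually_at_rightI[of 0 1])
    moreover have "((\<lambda>h. exp_recip p h / h) \<longlongrightarrow> 0) (at_left 0)"
      by (rule Lim_transform_eventually[OF tendsto_const])
        (auto simp: exp_recip_def intro!: eventually_at_leftI[of "-1" 0])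
    ultimately have "((\<lambda>h. exp_recip p h / h) \<longlongrightarrow> 0) (at 0)"
      by (simp add: filterlim_split_at_real)
    then show ?thesis using 3 by (simp add: DERIV_def exp_recip_def)
  qed
qed

definition smooth_step :: "real \<Rightarrow> real" where
  "smooth_step x = (if x > 0 then exp (- (1/x)) else 0)"

definition smooth_step' :: "real \<Rightarrow> real" where
  "smooth_step' x = (if x > 0 then exp (- (1/x)) / x\<^sup>2 else 0)"

lemma smooth_step_exp_recip: "smooth_step = exp_recip 1"
  by (auto simp: smooth_step_def exp_recip_def)

lemma smooth_step_deriv: "(smooth_step has_real_derivative smooth_step' x) (at x)"
proof -
  have "exp_recip (exp_recip_step 1) x = smooth_step' x"
    by (simp add: exp_recip_def exp_recip_step_def smooth_step'_def power2_eq_square)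
  then show ?thesis using exp_recip_deriv[of 1 x] by (simp add: smooth_step_exp_recip)
qed

lemma C_k_smooth_step: "C_k k g \<Longrightarrow> C_k k (\<lambda>x. smooth_step (g x))"
  for g :: "'a::euclidean_space \<Rightarrow> real"
  using C_k_compose[of "\<lambda>n. exp_recip ((exp_recip_step ^^ n) 1)" k g 0]
  by (simp add: exp_recip_deriv smooth_step_exp_recip del: C_k.simps)

lemma smooth_step_bounds: "0 \<le> smooth_step x" "smooth_step x \<le> 1"
  by (auto simp: smooth_step_def)

lemma smooth_step_eq_0: "x \<le> 0 \<Longrightarrow> smooth_step x = 0"
  by (auto simp: smooth_step_def)

lemma smooth_step_pos: "x > 0 \<Longrightarrow> smooth_step x > 0"
  by (auto simp: smooth_step_def)

lemma smooth_step_at_top: "(smooth_step \<longlongrightarrow> 1) at_top"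
proof -
  have "((\<lambda>x::real. exp (- (1/x))) \<longlongrightarrow> exp (- 0)) at_top"
    by (intro tendsto_intros tendsto_divide_0[OF tendsto_const] filterlim_at_top_imp_at_infinity filterlim_ident)
  then have "((\<lambda>x::real. exp (- (1/x))) \<longlongrightarrow> 1) at_top" by simp
  then show ?thesis
    by (rule Lim_transform_eventually)
      (auto simp: smooth_step_def intro!: eventually_mono[OF eventually_gt_at_top[of 0]])
qed

text \<open>Differentiating \<open>Q * smooth_step (n * Q - 1)\<close> produces
  \<open>n * Q * smooth_step' (n * Q - 1)\<close>, which is this expression at
  \<open>x = n * Q - 1\<close>; a bound independent of \<open>n\<close> is what dominated
  convergence asks for later. In \<open>z = 1/x\<close> it reads \<open>(z + z^2) exp(-z)\<close>,
  and \<open>exp z \<ge> 1 + z + z^2/2\<close> bounds it.\<close>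

lemma smooth_step'_bound: "\<bar>(x + 1) * smooth_step' x\<bar> \<le> 3"
proof (cases "x > 0")
  case True
  define z where "z = 1 / x"
  have z: "z > 0" using True by (simp add: z_def)
  have e: "exp z \<ge> 1 + z + z\<^sup>2/2" using exp_lower_Taylor_quadratic[of z] z by simp
  have "(x + 1) * smooth_step' x = (z + z\<^sup>2) * exp (- z)"
    using True by (simp add: smooth_step'_def z_def field_simps power2_eq_square)
  also have "\<dots> = (z + z\<^sup>2) / exp z" by (simp add: exp_minus field_simps)
  also have "\<dots> \<le> 3" using e z zero_le_power2[of z] by (simp add: divide_le_eq, linarith)
  finally have "(x + 1) * smooth_step' x \<le> 3" .
  moreover have "(x + 1) * smooth_step' x \<ge> 0" using True by (simp add: smooth_step'_def)
  ultimately show ?thesis by linarith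
qed (simp add: smooth_step'_def)

lemma smooth_step'_at_top: "((\<lambda>x. (x + 1) * smooth_step' x) \<longlongrightarrow> 0) at_top"
proof (rule tendsto_sandwich[where f="\<lambda>_. 0" and h="\<lambda>x. 1/x + (1/x)*(1/x)"])
  show "\<forall>\<^sub>F x in at_top. 0 \<le> (x + 1) * smooth_step' x"
    using eventually_gt_at_top[of 0] by eventually_elim (auto simp: smooth_step'_def)
  show "\<forall>\<^sub>F x in at_top. (x + 1) * smooth_step' x \<le> 1/x + (1/x)*(1/x)"
    using eventually_gt_at_top[of 0]
  proof eventually_elim
    case (elim x)
    have "(x + 1) * smooth_step' x = (1/x + (1/x)*(1/x)) * exp (- (1/x))"
      using elim by (simp add: smooth_step'_def field_simps power2_eq_square)
    also have "\<dots> \<le> (1/x + (1/x)*(1/x)) * 1" using elim by (intro mult_left_mono) auto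
    finally show ?case by simp
  qed
  have "((\<lambda>x::real. 1/x) \<longlongrightarrow> 0) at_top"
    by (intro tendsto_divide_0[OF tendsto_const] filterlim_at_top_imp_at_infinity filterlim_ident)
  then show "((\<lambda>x::real. 1/x + (1/x)*(1/x)) \<longlongrightarrow> 0) at_top"
    using tendsto_add[OF _ tendsto_mult, of "\<lambda>x::real. 1/x" 0 at_top "\<lambda>x. 1/x" 0 "\<lambda>x. 1/x" 0] by simp
qed auto

section \<open>The Brunn--Minkowski inequality for open sets\<close>

lemma bounded_fmeasurable: "bounded S \<Longrightarrow> S \<in> sets borel \<Longrightarrow> S \<in> fmeasurable lborel"
  for S :: "'a::euclidean_space set"
  using emeasure_bounded_finite[of S] by (auto simp: fmeasurable_def)

lemma null_sets_hyperplane: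
  fixes k :: "'a::euclidean_space"
  assumes "k \<in> Basis"
  shows "{x. x \<bullet> k = c} \<in> null_sets lborel"
proof -
  have "{x. x \<bullet> k = c} \<in> sets lborel"
    by (auto intro!: borel_closed closed_hyperplane[of k c, simplified inner_commute])
  then show ?thesis
    using negligible_standard_hyperplane[OF assms, of c]
    by (simp add: negligible_iff_null_sets null_sets_completion_iff)
qed

lemma open_set_plus:
  fixes S T :: "'a::euclidean_space set"
  assumes "open S" shows "open (S + T)"
proof -
  have "S + T = (\<Union>x\<in>S. \<Union>y\<in>T. {x + y})" by (auto simp: set_plus_def)
  then show ?thesis using open_sums[of S T] assms by simp
qed

lemma bounded_set_plus:
  fixes S T :: "'a::euclidean_space set"
  assumes "bounded S" "bounded T" shows "bounded (S + T)"
proof -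
  have "S + T = (\<Union>x\<in>S. \<Union>y\<in>T. {x + y})" by (auto simp: set_plus_def)
  then show ?thesis using bounded_sums[OF assms] by simp
qed

lemma measure_split_hyperplane:
  fixes k :: "'a::euclidean_space"
  assumes "k \<in> Basis" "bounded U" "open U"
  shows "measure lborel U = measure lborel (U \<inter> {x. x \<bullet> k < c}) + measure lborel (U \<inter> {x. x \<bullet> k > c})"
proof -
  have o: "open {x. x \<bullet> k < c}" "open {x. x \<bullet> k > c}"
    by (auto intro!: open_Collect_less continuous_intros)
  have fm: "U \<inter> {x. x \<bullet> k < c} \<in> fmeasurable lborel" "U \<inter> {x. x \<bullet> k > c} \<in> fmeasurable lborel"
    using assms o by (auto intro!: bounded_fmeasurable borel_open bounded_Int)
  have "measure lborel U = measure lborel ((U \<inter> {x. x \<bullet> k < c}) \<union> (U \<inter> {x. x \<bullet> k > c}))"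
  proof (rule measure_eq_AE)
    show "AE x in lborel. (x \<in> U) = (x \<in> U \<inter> {x. x \<bullet> k < c} \<union> U \<inter> {x. x \<bullet> k > c})"
      by (rule AE_I'[OF null_sets_hyperplane[OF assms(1), of c]]) auto
  qed (use assms fm o in \<open>auto simp: fmeasurable_def intro: borel_open\<close>)
  also have "\<dots> = measure lborel (U \<inter> {x. x \<bullet> k < c}) + measure lborel (U \<inter> {x. x \<bullet> k > c})"
    using fm by (intro measure_Union) (auto simp: fmeasurable_def)
  finally show ?thesis .
qed

lemma measure_open_pos:
  fixes U :: "'a::euclidean_space set"
  assumes "open U" "U \<noteq> {}" "bounded U"
  shows "measure lborel U > 0"
proof -
  obtain x e where e: "e > 0" "ball x e \<subseteq> U" using assms(1,2) by (meson equals0I openE)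
  have "0 < measure lborel (ball x e)" using content_ball_pos e(1) by blast
  also have "\<dots> \<le> measure lborel U"
    using e assms by (intro measure_mono_fmeasurable bounded_fmeasurable) auto
  finally show ?thesis .
qed

text \<open>Hyperplanes orthogonal to an axis are null, so the volume below height \<open>t\<close>
  is continuous in \<open>t\<close> by dominated convergence, and the intermediate value theorem
  applies. This provides the cut of the second set in the Hadwiger-Ohmann argument.\<close>

lemma exists_proportional_cut:
  fixes k :: "'a::euclidean_space"
  assumes k: "k \<in> Basis" and V: "bounded V" "open V" and \<theta>: "0 \<le> \<theta>" "\<theta> \<le> 1"
  shows "\<exists>t. measure lborel (V \<inter> {x. x \<bullet> k < t}) = \<theta> * measure lborel V"
proof -
  define f where "f t = (LINT x|lborel. indicator (V \<inter> {x. x \<bullet> k < t}) x :: real)" for t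
  have oV: "open (V \<inter> {x. x \<bullet> k < t})" for t
    using V by (auto intro!: open_Int open_Collect_less continuous_intros)
  have meas: "measure lborel (V \<inter> {x. x \<bullet> k < t}) = f t" for t
    using oV[of t] by (simp add: f_def borel_open)
  have iV: "integrable lborel (indicator V :: 'a \<Rightarrow> real)"
    using bounded_fmeasurable[of V] V by (simp add: borel_open integrable_indicator_iff fmeasurable_def)
  have cont: "continuous_on UNIV f"
    unfolding continuous_on_sequentially
  proof (intro ballI allI impI)
    fix t and T :: "nat \<Rightarrow> real"
    assume "(\<forall>n. T n \<in> UNIV) \<and> T \<longlonglongrightarrow> t"
    then have T: "T \<longlonglongrightarrow> t" by simp
    have "(\<lambda>n. f (T n)) \<longlonglongrightarrow> f t"
      unfolding f_def
    proof (rule integral_dominated_convergence[where w="indicator V"])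
      show "AE x in lborel. (\<lambda>n. indicator (V \<inter> {x. x \<bullet> k < T n}) x :: real) \<longlonglongrightarrow> indicator (V \<inter> {x. x \<bullet> k < t}) x"
      proof (rule AE_I'[OF null_sets_hyperplane[OF k, of t]], clarsimp, rule ccontr)
        fix x assume nl: "\<not> (\<lambda>n. indicator (V \<inter> {x. x \<bullet> k < T n}) x :: real) \<longlonglongrightarrow> indicator (V \<inter> {x. x \<bullet> k < t}) x"
          and "x \<bullet> k \<noteq> t"
        then consider "x \<bullet> k < t" | "x \<bullet> k > t" by linarith
        then have "\<forall>\<^sub>F n in sequentially. (indicator (V \<inter> {x. x \<bullet> k < T n}) x :: real) = indicator (V \<inter> {x. x \<bullet> k < t}) x"
        proof cases
          case 1
          show ?thesis using order_tendstoD(1)[OF T 1] by eventually_elim (use 1 in \<open>auto simp: indicator_def\<close>)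
        next
          case 2
          show ?thesis using order_tendstoD(2)[OF T 2] by eventually_elim (use 2 in \<open>auto simp: indicator_def\<close>)
        qed
        then show False using nl by (simp add: tendsto_eventually)
      qed
      show "(\<lambda>x. indicator (V \<inter> {x. x \<bullet> k < s}) x :: real) \<in> borel_measurable lborel" for s
        by (rule borel_measurable_indicator) (simp add: oV borel_open)
      then show "(\<lambda>x. indicator (V \<inter> {x. x \<bullet> k < T n}) x :: real) \<in> borel_measurable lborel" for n .
      show "AE x in lborel. norm (indicator (V \<inter> {x. x \<bullet> k < T n}) x :: real) \<le> indicator V x" for n
        by (simp add: indicator_def)
    qed (rule iV)
    then show "(f \<circ> T) \<longlonglongrightarrow> f t" by (simp add: o_def)
  qed
  obtain R where R: "\<And>x. x \<in> V \<Longrightarrow> norm x < R" using V(1) by (metis bounded_pos_less)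
  have nk: "\<bar>x \<bullet> k\<bar> < R" if "x \<in> V" for x
    using R[OF that] Basis_le_norm[OF k, of x] by linarith
  have "V \<inter> {x. x \<bullet> k < -\<bar>R\<bar>} = {}" using nk by force
  then have f0: "f (-\<bar>R\<bar>) = 0" using meas[of "-\<bar>R\<bar>"] by simp
  have "V \<inter> {x. x \<bullet> k < \<bar>R\<bar>} = V" using nk by force
  then have f1: "f \<bar>R\<bar> = measure lborel V" using meas[of "\<bar>R\<bar>"] by simp
  have "\<exists>t\<ge>-\<bar>R\<bar>. t \<le> \<bar>R\<bar> \<and> f t = \<theta> * measure lborel V"
    by (rule IVT') (use f0 f1 \<theta> cont in \<open>auto intro: continuous_on_subset mult_left_le_one_le\<close>)
  then show ?thesis using meas by auto
qed

section \<open>Hadwiger-Ohmann induction over finite families of boxes\<close>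

definition open_boxes :: "'a::euclidean_space set set \<Rightarrow> bool" where
  "open_boxes \<A> \<longleftrightarrow> finite \<A> \<and> disjoint \<A> \<and> (\<forall>B\<in>\<A>. B \<noteq> {} \<and> (\<exists>a b. B = box a b))"

lemma open_boxes_open: "open_boxes \<A> \<Longrightarrow> open (\<Union>\<A>)"
  unfolding open_boxes_def using open_box by (metis open_Union)

lemma open_boxes_bounded: "open_boxes \<A> \<Longrightarrow> bounded (\<Union>\<A>)"
  unfolding open_boxes_def using bounded_box by (metis bounded_Union)

lemma box_Int_halfspace:
  fixes k :: "'a::euclidean_space"
  assumes "k \<in> Basis"
  shows "\<exists>a' b'. box a b \<inter> {x. x \<bullet> k < c} = box a' b'" "\<exists>a' b'. box a b \<inter> {x. x \<bullet> k > c} = box a' b'"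
proof -
  let ?b = "\<Sum>i\<in>Basis. (if i = k then min (b \<bullet> k) c else b \<bullet> i) *\<^sub>R i"
  let ?a = "\<Sum>i\<in>Basis. (if i = k then max (a \<bullet> k) c else a \<bullet> i) *\<^sub>R i"
  have "x \<in> box a ?b \<longleftrightarrow> x \<in> box a b \<inter> {x. x \<bullet> k < c}" for x
    using assms unfolding mem_box Int_iff by (auto split: if_splits)
  then have "box a b \<inter> {x. x \<bullet> k < c} = box a ?b" by blast
  then show "\<exists>a' b'. box a b \<inter> {x. x \<bullet> k < c} = box a' b'" by blast
  have "x \<in> box ?a b \<longleftrightarrow> x \<in> box a b \<inter> {x. x \<bullet> k > c}" for x
    using assms unfolding mem_box Int_iff by (auto split: if_splits)
  then have "box a b \<inter> {x. x \<bullet> k > c} = box ?a b" by blast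
  then show "\<exists>a' b'. box a b \<inter> {x. x \<bullet> k > c} = box a' b'" by blast
qed

text \<open>Boxes that \<open>H\<close> misses are dropped, in line with the nonemptiness demanded
  by \<open>open_boxes\<close>. The number of boxes thus never grows under a cut and drops strictly
  once some box lies outside \<open>H\<close>, which makes it a measure for induction.\<close>

lemma open_boxes_Int:
  assumes \<A>: "open_boxes \<A>" and H: "\<And>a b. \<exists>a' b'. box a b \<inter> H = box a' b'"
  obtains \<A>' where "open_boxes \<A>'" "\<Union>\<A>' = \<Union>\<A> \<inter> H" "card \<A>' \<le> card \<A>"
    "(\<exists>B\<in>\<A>. B \<inter> H = {}) \<longrightarrow> card \<A>' < card \<A>"
proof
  let ?P = "{B\<in>\<A>. B \<inter> H \<noteq> {}}"
  let ?\<A> = "(\<lambda>B. B \<inter> H) ` ?P"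
  have fin: "finite \<A>" using \<A> by (simp add: open_boxes_def)
  show "open_boxes ?\<A>"
    unfolding open_boxes_def
  proof (intro conjI ballI)
    show "finite ?\<A>" using fin by auto
    show "disjoint ?\<A>"
    proof (rule disjointI)
      fix a b assume "a \<in> ?\<A>" "b \<in> ?\<A>" "a \<noteq> b"
      then obtain B C where "B \<in> \<A>" "C \<in> \<A>" "a = B \<inter> H" "b = C \<inter> H" "B \<noteq> C" by blast
      then show "a \<inter> b = {}" using \<A> disjointD[of \<A> B C] unfolding open_boxes_def by blast
    qed
  next
    fix B assume "B \<in> ?\<A>"
    then obtain C where C: "C \<in> \<A>" "B = C \<inter> H" "B \<noteq> {}" by auto
    then show "B \<noteq> {}" by simp
    obtain a b where "C = box a b" using C \<A> unfolding open_boxes_def by blast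
    then show "\<exists>a b. B = box a b" using H C by metis
  qed
  show "\<Union>?\<A> = \<Union>\<A> \<inter> H" by auto
  have "card ?\<A> \<le> card ?P" using fin by (intro card_image_le) auto
  also have "\<dots> \<le> card \<A>" using fin by (intro card_mono) auto
  finally show "card ?\<A> \<le> card \<A>" .
  have "card ?P < card \<A>" if "\<exists>B\<in>\<A>. B \<inter> H = {}"
    using that fin by (intro psubset_card_mono) auto
  then show "(\<exists>B\<in>\<A>. B \<inter> H = {}) \<longrightarrow> card ?\<A> < card \<A>"
    using \<open>card ?\<A> \<le> card ?P\<close> by linarith
qed

text \<open>The sum contains the box with sides \<open>x i + y i\<close> and volume
  \<open>S\<close>. After division by the root of \<open>S\<close> the claim is the inequality of
  arithmetic and geometric means for the ratios \<open>x i / (x i + y i)\<close> and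
  \<open>y i / (x i + y i)\<close>, whose arithmetic means add up to 1.\<close>

lemma brunn_minkowski_box:
  fixes p q p' q' :: "'a::euclidean_space"
  assumes "box p q \<noteq> {}" "box p' q' \<noteq> {}"
  shows "(root DIM('a) (measure lborel (box p q)) + root DIM('a) (measure lborel (box p' q'))) ^ DIM('a)
    \<le> measure lborel (box p q + box p' q')"
proof -
  define n where "n = DIM('a)"
  have n: "n > 0" by (simp add: n_def)
  define x y where "x i = (q - p) \<bullet> i" and "y i = (q' - p') \<bullet> i" for i
  have pos: "x i > 0" "y i > 0" if "i \<in> Basis" for i
    using assms that by (auto simp: x_def y_def box_ne_empty inner_diff_left)
  have mx: "measure lborel (box p q) = (\<Prod>i\<in>Basis. x i)" "measure lborel (box p' q') = (\<Prod>i\<in>Basis. y i)"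
    using pos by (simp_all add: x_def y_def inner_diff_left measure_lborel_box_eq less_imp_le)
  have box_sum: "box (p + p') (q + q') \<subseteq> box p q + box p' q'"
  proof
    fix z assume z: "z \<in> box (p + p') (q + q')"
    \<comment> \<open>The relative position of \<open>z\<close> along axis \<open>i\<close> in the
      sum box; using the same proportion in both boxes splits \<open>z\<close> into a sum.\<close>
    define t where "t i = ((z - p - p') \<bullet> i) / (x i + y i)" for i
    have t: "0 < t i" "t i < 1" "t i * (x i + y i) = (z - p - p') \<bullet> i" if "i \<in> Basis" for i
    proof -
      have s: "x i + y i > 0" using pos[OF that] by simp
      show "t i * (x i + y i) = (z - p - p') \<bullet> i" using s by (simp add: t_def)
      have "p \<bullet> i + p' \<bullet> i < z \<bullet> i" "z \<bullet> i < q \<bullet> i + q' \<bullet> i"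
        using z that by (auto simp: mem_box inner_add_left)
      then show "0 < t i" "t i < 1" using s by (auto simp: t_def divide_simps inner_simps x_def y_def)
    qed
    define a b where "a = p + (\<Sum>i\<in>Basis. (t i * x i) *\<^sub>R i)" and "b = p' + (\<Sum>i\<in>Basis. (t i * y i) *\<^sub>R i)"
    have "a + b = z"
    proof (rule euclidean_eqI)
      fix i :: 'a assume i: "i \<in> Basis"
      then show "(a + b) \<bullet> i = z \<bullet> i"
        using t(3)[OF i] by (simp add: a_def b_def inner_simps algebra_simps)
    qed
    moreover have "a \<in> box p q" "b \<in> box p' q'"
    proof -
      have "t i * x i < x i" "t i * y i < y i" "0 < t i * x i" "0 < t i * y i" if "i \<in> Basis" for i
        using t(1,2)[OF that] pos[OF that] by auto
      then show "a \<in> box p q" "b \<in> box p' q'"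
        by (auto simp: mem_box a_def b_def inner_simps x_def y_def less_diff_eq add.commute)
    qed
    ultimately show "z \<in> box p q + box p' q'" by (auto simp: set_plus_def)
  qed
  have amgm: "root n (\<Prod>i\<in>Basis. w i) \<le> (\<Sum>i\<in>(Basis::'a set). w i / n)" if "\<And>i. i \<in> Basis \<Longrightarrow> w i > 0" for w
    using arith_geom_mean[of "Basis::'a set" w] that n
    by (simp add: n_def root_powr_inverse prod_pos less_imp_le)
  define S where "S = (\<Prod>i\<in>(Basis::'a set). x i + y i)"
  have Spos: "S > 0" using pos by (auto simp: S_def intro!: prod_pos add_pos_pos)
  have "root n ((\<Prod>i\<in>Basis. x i) / S) + root n ((\<Prod>i\<in>Basis. y i) / S)
      \<le> (\<Sum>i\<in>(Basis::'a set). x i / (x i + y i) / n) + (\<Sum>i\<in>(Basis::'a set). y i / (x i + y i) / n)"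
    unfolding S_def prod_dividef[symmetric] using pos by (intro add_mono amgm) (auto intro!: divide_pos_pos add_pos_pos)
  also have "\<dots> = (\<Sum>i\<in>(Basis::'a set). 1 / n)"
    unfolding sum.distrib[symmetric]
  proof (rule sum.cong)
    fix i :: 'a assume "i \<in> Basis"
    then have "x i + y i > 0" using pos[of i] by simp
    then show "x i / (x i + y i) / real n + y i / (x i + y i) / real n = 1 / real n"
      by (simp add: add_divide_distrib[symmetric])
  qed simp
  also have "\<dots> = 1" using n by (simp add: n_def)
  finally have "(root n (\<Prod>i\<in>Basis. x i) + root n (\<Prod>i\<in>Basis. y i)) / root n S \<le> 1"
    by (simp add: real_root_divide add_divide_distrib)
  then have le: "root n (\<Prod>i\<in>Basis. x i) + root n (\<Prod>i\<in>Basis. y i) \<le> root n S"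
    using Spos n by (simp add: divide_le_eq)
  have "(root n (\<Prod>i\<in>Basis. x i) + root n (\<Prod>i\<in>Basis. y i)) ^ n \<le> root n S ^ n"
    using le pos n by (intro power_mono add_nonneg_nonneg) (auto intro!: real_root_ge_zero prod_nonneg dest: less_imp_le)
  also have "\<dots> = S" using n Spos by simp
  also have "S = measure lborel (box (p + p') (q + q'))"
  proof -
    have "\<And>i. i \<in> Basis \<Longrightarrow> (p + p') \<bullet> i \<le> (q + q') \<bullet> i"
      using pos by (force simp: x_def y_def inner_simps intro: less_imp_le add_mono)
    then show ?thesis by (simp add: S_def x_def y_def inner_simps algebra_simps measure_lborel_box_eq)
  qed
  also have "\<dots> \<le> measure lborel (box p q + box p' q')"
    using box_sum by (intro measure_mono_fmeasurable bounded_fmeasurable)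
      (auto intro!: borel_open open_set_plus bounded_set_plus)
  finally show ?thesis by (simp add: mx n_def)
qed

text \<open>Disjoint boxes already have disjoint projections to some axis. A cut between these
  projections keeps one of the two boxes out of each open half-space, so that both halves of the
  family get smaller.\<close>

lemma separating_coordinate:
  fixes B C :: "'a::euclidean_space set"
  assumes "open_boxes \<A>" "B \<in> \<A>" "C \<in> \<A>" "B \<noteq> C"
  shows "\<exists>k\<in>Basis. \<exists>c. (B \<inter> {x. x \<bullet> k > c} = {} \<and> C \<inter> {x. x \<bullet> k < c} = {})
      \<or> (C \<inter> {x. x \<bullet> k > c} = {} \<and> B \<inter> {x. x \<bullet> k < c} = {})"
proof -
  obtain p q p' q' where B: "B = box p q" "box p q \<noteq> {}" and C: "C = box p' q'" "box p' q' \<noteq> {}"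
    using assms unfolding open_boxes_def by metis
  have "box p q \<inter> box p' q' = {}" using assms B C disjointD unfolding open_boxes_def by metis
  then obtain k where k: "k \<in> Basis" "q \<bullet> k \<le> p \<bullet> k \<or> q' \<bullet> k \<le> p' \<bullet> k \<or> q \<bullet> k \<le> p' \<bullet> k \<or> q' \<bullet> k \<le> p \<bullet> k"
    using disjoint_interval(4) by blast
  then have "q \<bullet> k \<le> p' \<bullet> k \<or> q' \<bullet> k \<le> p \<bullet> k"
    using B C by (auto simp: box_ne_empty linorder_not_less[symmetric])
  then show ?thesis
  proof
    assume "q \<bullet> k \<le> p' \<bullet> k"
    then have "B \<inter> {x. x \<bullet> k > q \<bullet> k} = {}" "C \<inter> {x. x \<bullet> k < q \<bullet> k} = {}"
      using k B C by (fastforce simp: mem_box)+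
    then show ?thesis using k(1) by blast
  next
    assume "q' \<bullet> k \<le> p \<bullet> k"
    then have "C \<inter> {x. x \<bullet> k > q' \<bullet> k} = {}" "B \<inter> {x. x \<bullet> k < q' \<bullet> k} = {}"
      using k B C by (fastforce simp: mem_box)+
    then show ?thesis using k(1) by blast
  qed
qed

text \<open>The first family is cut by a coordinate hyperplane that separates two of its boxes, the
  second by a parallel one in the same volume ratio \<open>\<theta>\<close>. By homogeneity the
  induction hypothesis gives the partial sums at least the fractions \<open>\<theta>\<close> and
  \<open>1 - \<theta>\<close> of \<open>r ^ n\<close>, and these sums are disjoint because they lie
  on different sides of level \<open>c + t\<close>.\<close>

lemma brunn_minkowski_step:
  fixes \<A> \<B> :: "'a::euclidean_space set set"
  defines "n \<equiv> DIM('a)"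
  assumes \<A>: "open_boxes \<A>" "card \<A> \<ge> 2" and \<B>: "open_boxes \<B>" "\<B> \<noteq> {}"
    and IH: "\<And>\<C> \<D> :: 'a set set. card \<C> + card \<D> < card \<A> + card \<B> \<Longrightarrow> open_boxes \<C> \<Longrightarrow> open_boxes \<D> \<Longrightarrow>
      \<C> \<noteq> {} \<Longrightarrow> \<D> \<noteq> {} \<Longrightarrow>
      (root n (measure lborel (\<Union>\<C>)) + root n (measure lborel (\<Union>\<D>))) ^ n \<le> measure lborel (\<Union>\<C> + \<Union>\<D>)"
  shows "(root n (measure lborel (\<Union>\<A>)) + root n (measure lborel (\<Union>\<B>))) ^ n \<le> measure lborel (\<Union>\<A> + \<Union>\<B>)"
proof -
  have n: "n > 0" by (simp add: n_def)
  obtain B C where BC: "B \<in> \<A>" "C \<in> \<A>" "B \<noteq> C"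
    using \<A>(2) by (metis One_nat_def Suc_1 card_le_Suc0_iff_eq \<A>(1) not_less_eq_eq open_boxes_def)
  obtain k c where k: "k \<in> Basis" and
    "(B \<inter> {x. x \<bullet> k > c} = {} \<and> C \<inter> {x. x \<bullet> k < c} = {}) \<or> (C \<inter> {x. x \<bullet> k > c} = {} \<and> B \<inter> {x. x \<bullet> k < c} = {})"
    using separating_coordinate[OF \<A>(1) BC] by blast
  then have ex: "\<exists>B\<in>\<A>. B \<inter> {x. x \<bullet> k > c} = {}" "\<exists>B\<in>\<A>. B \<inter> {x. x \<bullet> k < c} = {}"
    using BC by blast+
  obtain P where P: "open_boxes P" "\<Union>P = \<Union>\<A> \<inter> {x. x \<bullet> k < c}" "card P < card \<A>"
    using open_boxes_Int[OF \<A>(1) box_Int_halfspace(1)[OF k, of _ _ c]] ex by metis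
  obtain Q where Q: "open_boxes Q" "\<Union>Q = \<Union>\<A> \<inter> {x. x \<bullet> k > c}" "card Q < card \<A>"
    using open_boxes_Int[OF \<A>(1) box_Int_halfspace(2)[OF k, of _ _ c]] ex by metis
  let ?U = "\<Union>\<A>" and ?V = "\<Union>\<B>"
  let ?m = "measure lborel"
  have U: "open ?U" "bounded ?U" "?U \<noteq> {}" and V: "open ?V" "bounded ?V" "?V \<noteq> {}"
    using \<A> \<B> by (auto simp: open_boxes_open open_boxes_bounded) (auto simp: open_boxes_def)
  have mU: "?m ?U = ?m (\<Union>P) + ?m (\<Union>Q)"
    unfolding P Q by (rule measure_split_hyperplane[OF k U(2,1)])
  \<comment> \<open>A box that misses one open half-space meets the other: it has positive volume
    and cannot lie in the hyperplane. Hence both parts are nonempty, as the induction hypothesis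
    demands.\<close>
  have neP: "\<Union>P \<noteq> {}" and neQ: "\<Union>Q \<noteq> {}"
  proof -
    have aux: "box a b \<inter> {x. x \<bullet> k < c} \<noteq> {}" if "box a b \<noteq> {}" "box a b \<inter> {x. x \<bullet> k > c} = {}" for a b :: 'a
    proof
      assume "box a b \<inter> {x. x \<bullet> k < c} = {}"
      then have "?m (box a b) = 0"
        using measure_split_hyperplane[OF k bounded_box open_box, of a b c] that(2) by (simp only: measure_empty)
      then show False using measure_open_pos[OF open_box that(1) bounded_box] by simp
    qed
    have aux': "box a b \<inter> {x. x \<bullet> k > c} \<noteq> {}" if "box a b \<noteq> {}" "box a b \<inter> {x. x \<bullet> k < c} = {}" for a b :: 'a
      using aux that by blast
    obtain B a b where "B \<in> \<A>" "B \<inter> {x. x \<bullet> k > c} = {}" "B = box a b" "B \<noteq> {}"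
      using ex(1) \<A>(1) unfolding open_boxes_def by metis
    then show "\<Union>P \<noteq> {}" using aux[of a b] unfolding P(2) by auto
    obtain B a b where "B \<in> \<A>" "B \<inter> {x. x \<bullet> k < c} = {}" "B = box a b" "B \<noteq> {}"
      using ex(2) \<A>(1) unfolding open_boxes_def by metis
    then show "\<Union>Q \<noteq> {}" using aux'[of a b] unfolding Q(2) by auto
  qed
  have mP: "?m (\<Union>P) > 0"
    using measure_open_pos[OF open_boxes_open neP open_boxes_bounded] P(1) by blast
  have mQ: "?m (\<Union>Q) > 0"
    using measure_open_pos[OF open_boxes_open neQ open_boxes_bounded] Q(1) by blast
  define \<theta> where "\<theta> = ?m (\<Union>P) / ?m ?U"
  have \<theta>: "0 < \<theta>" "\<theta> < 1" "?m (\<Union>P) = \<theta> * ?m ?U" "?m (\<Union>Q) = (1 - \<theta>) * ?m ?U"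
    using mU mP mQ by (auto simp: \<theta>_def field_simps)
  obtain t where t: "?m (?V \<inter> {x. x \<bullet> k < t}) = \<theta> * ?m ?V"
    using exists_proportional_cut[OF k V(2,1), of \<theta>] \<theta> by auto
  have t': "?m (?V \<inter> {x. x \<bullet> k > t}) = (1 - \<theta>) * ?m ?V"
    using measure_split_hyperplane[OF k V(2,1), of t] t by (simp add: algebra_simps)
  have mV: "?m ?V > 0" using measure_open_pos V by blast
  obtain P' where P': "open_boxes P'" "\<Union>P' = ?V \<inter> {x. x \<bullet> k < t}" "card P' \<le> card \<B>"
    using open_boxes_Int[OF \<B>(1) box_Int_halfspace(1)[OF k, of _ _ t]] by metis
  obtain Q' where Q': "open_boxes Q'" "\<Union>Q' = ?V \<inter> {x. x \<bullet> k > t}" "card Q' \<le> card \<B>"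
    using open_boxes_Int[OF \<B>(1) box_Int_halfspace(2)[OF k, of _ _ t]] by metis
  have mP': "?m (\<Union>P') = \<theta> * ?m ?V" unfolding P'(2) by (rule t)
  have mQ': "?m (\<Union>Q') = (1 - \<theta>) * ?m ?V" unfolding Q'(2) by (rule t')
  have "\<theta> * ?m ?V > 0" "(1 - \<theta>) * ?m ?V > 0" using \<theta> mV by auto
  then have ne: "P' \<noteq> {}" "Q' \<noteq> {}" "P \<noteq> {}" "Q \<noteq> {}"
    using mP mQ mP' mQ' by (metis Union_empty measure_empty less_irrefl)+
  define r where "r = root n (?m ?U) + root n (?m ?V)"
  have scale: "(root n (s * ?m ?U) + root n (s * ?m ?V)) ^ n = s * r ^ n" if "s > 0" for s
    using that n by (simp add: real_root_mult distrib_left[symmetric] power_mult_distrib r_def)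
  have lt: "card P + card P' < card \<A> + card \<B>" "card Q + card Q' < card \<A> + card \<B>"
    using P(3) P'(3) Q(3) Q'(3) by linarith+
  have 1: "\<theta> * r ^ n \<le> ?m (\<Union>P + \<Union>P')"
    using IH[OF lt(1) P(1) P'(1) ne(3,1)] unfolding mP' \<theta>(3) scale[OF \<theta>(1)] .
  have 2: "(1 - \<theta>) * r ^ n \<le> ?m (\<Union>Q + \<Union>Q')"
    using IH[OF lt(2) Q(1) Q'(1) ne(4,2)] \<theta>(2) unfolding mQ' \<theta>(4) by (simp add: scale)
  have fm0: "\<Union>\<C> + \<Union>\<D> \<in> fmeasurable lborel" if "open_boxes \<C>" "open_boxes \<D>" for \<C> \<D> :: "'a set set"
    using that by (intro bounded_fmeasurable borel_open open_set_plus bounded_set_plus open_boxes_open open_boxes_bounded)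
  note fm = fm0[OF P(1) P'(1)] fm0[OF Q(1) Q'(1)] fm0[OF \<A>(1) \<B>(1)]
  have "r ^ n = \<theta> * r ^ n + (1 - \<theta>) * r ^ n" by (simp add: algebra_simps)
  also have "\<dots> \<le> ?m (\<Union>P + \<Union>P') + ?m (\<Union>Q + \<Union>Q')" using 1 2 by simp
  also have "\<dots> = ?m ((\<Union>P + \<Union>P') \<union> (\<Union>Q + \<Union>Q'))"
  proof (rule measure_Union[symmetric])
    have "z \<bullet> k < c + t" if z: "z \<in> \<Union>P + \<Union>P'" for z
    proof -
      obtain x y where "z = x + y" "x \<in> \<Union>P" "y \<in> \<Union>P'" using z by (rule set_plus_elim)
      then show ?thesis unfolding P(2) P'(2) by (simp add: inner_add_left)
    qed
    moreover have "z \<bullet> k > c + t" if z: "z \<in> \<Union>Q + \<Union>Q'" for z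
    proof -
      obtain x y where "z = x + y" "x \<in> \<Union>Q" "y \<in> \<Union>Q'" using z by (rule set_plus_elim)
      then show ?thesis unfolding Q(2) Q'(2) by (simp add: inner_add_left)
    qed
    ultimately show "(\<Union>P + \<Union>P') \<inter> (\<Union>Q + \<Union>Q') = {}" by (meson disjoint_iff less_asym)
  qed (use fm in \<open>simp_all add: fmeasurable_def less_top\<close>)
  also have "\<dots> \<le> ?m (?U + ?V)"
  proof (rule measure_mono_fmeasurable)
    show "(\<Union>P + \<Union>P') \<union> (\<Union>Q + \<Union>Q') \<subseteq> ?U + ?V"
      unfolding P(2) P'(2) Q(2) Q'(2) by (intro Un_least set_plus_mono2 Int_lower1)
    show "(\<Union>P + \<Union>P') \<union> (\<Union>Q + \<Union>Q') \<in> sets lborel"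
      using fm(1,2) by (intro sets.Un fmeasurableD)
  qed (rule fm(3))
  finally show ?thesis by (simp add: r_def)
qed

lemma brunn_minkowski_open_boxes:
  fixes \<A> \<B> :: "'a::euclidean_space set set"
  assumes "open_boxes \<A>" "open_boxes \<B>" "\<A> \<noteq> {}" "\<B> \<noteq> {}"
  shows "(root DIM('a) (measure lborel (\<Union>\<A>)) + root DIM('a) (measure lborel (\<Union>\<B>))) ^ DIM('a)
    \<le> measure lborel (\<Union>\<A> + \<Union>\<B>)"
  using assms
proof (induction "card \<A> + card \<B>" arbitrary: \<A> \<B> rule: less_induct)
  case less
  have fin: "finite \<A>" "finite \<B>" using less.prems by (auto simp: open_boxes_def)
  consider "card \<A> \<ge> 2" | "card \<B> \<ge> 2" | "card \<A> = 1" "card \<B> = 1"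
  proof -
    have "card \<A> \<noteq> 0" "card \<B> \<noteq> 0" using less.prems(3,4) fin by auto
    then have "card \<A> \<ge> 2 \<or> card \<B> \<ge> 2 \<or> card \<A> = 1 \<and> card \<B> = 1" by linarith
    then show ?thesis by (elim disjE conjE) (rule that; assumption)+
  qed
  then show ?case
  proof cases
    case 1
    show ?thesis by (rule brunn_minkowski_step[OF less.prems(1) 1 less.prems(2,4) less.hyps])
  next
    case 2
    have "(root DIM('a) (measure lborel (\<Union>\<B>)) + root DIM('a) (measure lborel (\<Union>\<A>))) ^ DIM('a)
      \<le> measure lborel (\<Union>\<B> + \<Union>\<A>)"
    proof (rule brunn_minkowski_step[OF less.prems(2) 2 less.prems(1,3)])
      fix \<C> \<D> :: "'a set set"
      assume "card \<C> + card \<D> < card \<B> + card \<A>" and prems: "open_boxes \<C>" "open_boxes \<D>" "\<C> \<noteq> {}" "\<D> \<noteq> {}"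
      then have "card \<C> + card \<D> < card \<A> + card \<B>" by linarith
      then show "(root DIM('a) (measure lborel (\<Union>\<C>)) + root DIM('a) (measure lborel (\<Union>\<D>))) ^ DIM('a)
          \<le> measure lborel (\<Union>\<C> + \<Union>\<D>)"
        by (rule less.hyps[OF _ prems])
    qed
    then show ?thesis by (simp only: add.commute)
  next
    case 3
    then obtain B C where BC: "\<A> = {B}" "\<B> = {C}" by (auto simp: card_1_singleton_iff)
    have "\<exists>p q. B = box p q" "\<exists>p q. C = box p q" and ne: "B \<noteq> {}" "C \<noteq> {}"
      using less.prems(1,2) unfolding BC open_boxes_def by blast+
    then obtain p q p' q' where pq: "B = box p q" "C = box p' q'" by (elim exE)
    have U: "\<Union>{X} = X" for X :: "'a set" by (rule ccpo_Sup_singleton)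
    show ?thesis
      unfolding BC U unfolding pq by (rule brunn_minkowski_box[OF ne[unfolded pq]])
  qed
qed

text \<open>Finite unions of closed boxes exhaust an open set up to small volume. A division of such
  a union has nonoverlapping pieces, and passing to the nonempty interiors costs only frontiers,
  which are null.\<close>

lemma open_boxes_approx:
  fixes U :: "'a::euclidean_space set"
  assumes U: "open U" "bounded U" "U \<noteq> {}" and e: "e > 0"
  shows "\<exists>\<A>. open_boxes \<A> \<and> \<A> \<noteq> {} \<and> \<Union>\<A> \<subseteq> U \<and> measure lborel U - e < measure lborel (\<Union>\<A>)"
proof -
  obtain \<D> where \<D>: "countable \<D>" "\<D> \<subseteq> Pow U" "\<And>X. X \<in> \<D> \<Longrightarrow> \<exists>a b. X = cbox a b" "\<Union>\<D> = U"
    using open_countable_Union_open_cbox[OF U(1)] by metis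
  have ne: "\<D> \<noteq> {}" using \<D>(4) U(3) by auto
  define D where "D = from_nat_into \<D>"
  have D: "range D = \<D>" using range_from_nat_into[OF ne \<D>(1)] by (simp add: D_def)
  define W where "W N = (\<Union>i\<le>N. D i)" for N
  have fmU: "U \<in> fmeasurable lborel" using U by (auto intro: bounded_fmeasurable borel_open)
  have Dc: "\<exists>a b. D i = cbox a b" for i using \<D>(3) D by blast
  have Dm: "D i \<in> sets lborel" for i using Dc[of i] by auto
  have "(\<lambda>N. measure lborel (W N)) \<longlonglongrightarrow> measure lborel (\<Union>N. W N)"
  proof (rule Lim_measure_incseq)
    show "range W \<subseteq> sets lborel" using Dm by (auto simp: W_def)
    show "incseq W" unfolding incseq_def W_def by (intro allI impI UN_mono) auto
    have "(\<Union>N. W N) = U" using D \<D>(4) by (auto simp: W_def)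
    then show "emeasure lborel (\<Union>N. W N) \<noteq> \<infinity>" using fmU by (auto simp: fmeasurable_def)
  qed
  moreover have "(\<Union>N. W N) = U" using D \<D>(4) by (auto simp: W_def)
  ultimately have "(\<lambda>N. measure lborel (W N)) \<longlonglongrightarrow> measure lborel U" by simp
  \<comment> \<open>Capping the error by the volume of \<open>U\<close> forces the approximating
    family to have positive volume, hence to be nonempty.\<close>
  moreover define e' where "e' = min e (measure lborel U)"
  moreover have e': "e' > 0" using e measure_open_pos U by (auto simp: e'_def)
  ultimately have "\<forall>\<^sub>F N in sequentially. measure lborel (W N) > measure lborel U - e'"
    using order_tendstoD(1) by (metis diff_gt_0_iff_gt diff_less_eq less_add_same_cancel1)
  then obtain N where N: "measure lborel (W N) > measure lborel U - e'"
    using eventually_sequentially by auto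
  obtain p where p: "p division_of W N"
    unfolding W_def using elementary_unions_intervals[of "D ` {..N}"] Dc by blast
  define \<A> where "\<A> = interior ` p - {{}}"
  have ob: "open_boxes \<A>"
    unfolding open_boxes_def
  proof (intro conjI ballI disjointI)
    show "finite \<A>" using p by (auto simp: \<A>_def)
    show "B \<noteq> {}" if "B \<in> \<A>" for B using that by (auto simp: \<A>_def)
    show "\<exists>a b. B = box a b" if B: "B \<in> \<A>" for B
    proof -
      obtain K where "K \<in> p" "B = interior K" using B unfolding \<A>_def by blast
      then show ?thesis using division_ofD(4)[OF p] by (metis interior_cbox)
    qed
    show "B \<inter> C = {}" if BC: "B \<in> \<A>" "C \<in> \<A>" "B \<noteq> C" for B C
    proof -
      obtain K L where KL: "K \<in> p" "B = interior K" "L \<in> p" "C = interior L"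
        using BC(1,2) unfolding \<A>_def by blast
      then show ?thesis using division_ofD(5)[OF p, of K L] BC(3) by blast
    qed
  qed
  have sub: "\<Union>\<A> \<subseteq> W N"
    using division_ofD(2)[OF p] interior_subset by (fastforce simp: \<A>_def)
  have WU: "W N \<subseteq> U" using D \<D>(4) by (auto simp: W_def)
  have "measure lborel (W N) \<le> measure lborel (\<Union>\<A>)"
  proof -
    have "measure lborel (W N) = measure lborel (\<Union>\<A>)"
    proof (rule measure_eq_AE)
      have fr: "negligible (\<Union>K\<in>p. frontier K)"
        using division_ofD(1)[OF p] division_ofD(4)[OF p]
        by (intro negligible_Union) (auto intro!: negligible_convex_frontier, metis convex_box(1))
      have bs: "(\<Union>K\<in>p. frontier K) \<in> sets lborel"
        using division_ofD(1)[OF p] by (intro sets.finite_UN) (auto intro!: borel_closed)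
      have null: "(\<Union>K\<in>p. frontier K) \<in> null_sets lborel"
        using fr bs by (simp add: negligible_iff_null_sets null_sets_completion_iff)
      show "AE x in lborel. (x \<in> W N) = (x \<in> \<Union>\<A>)"
      proof (rule AE_I'[OF null], clarify)
        fix x assume nx: "\<not> ((x \<in> W N) = (x \<in> \<Union>\<A>))"
        then have x: "x \<in> W N" "x \<notin> \<Union>\<A>" using sub by auto
        then obtain K where K: "K \<in> p" "x \<in> K" unfolding division_ofD(6)[OF p, symmetric] by auto
        have "x \<notin> interior K"
        proof
          assume "x \<in> interior K"
          then have "interior K \<in> \<A>" using K(1) unfolding \<A>_def by blast
          then show False using x(2) \<open>x \<in> interior K\<close> by blast
        qed
        moreover have "x \<in> closure K" using K(2) closure_subset by blast
        ultimately show "x \<in> (\<Union>K\<in>p. frontier K)" using K(1) unfolding frontier_def by blast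
      qed
      show "W N \<in> sets lborel" using Dm by (auto simp: W_def)
      show "\<Union>\<A> \<in> sets lborel" using open_boxes_open[OF ob] by (auto intro: borel_open)
    qed
    then show ?thesis by simp
  qed
  then have *: "measure lborel U - e' < measure lborel (\<Union>\<A>)" using N by linarith
  then have "\<A> \<noteq> {}" by (auto simp: e'_def)
  moreover have "measure lborel U - e < measure lborel (\<Union>\<A>)" using * by (auto simp: e'_def)
  ultimately show ?thesis using ob sub WU by blast
qed

theorem brunn_minkowski_open:
  fixes U V :: "'a::euclidean_space set"
  assumes U: "open U" "bounded U" "U \<noteq> {}" and V: "open V" "bounded V" "V \<noteq> {}"
  shows "(root DIM('a) (measure lborel U) + root DIM('a) (measure lborel V)) ^ DIM('a)
    \<le> measure lborel (U + V)"
proof -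
  define n where "n = DIM('a)"
  let ?m = "measure lborel"
  have n: "n > 0" by (simp add: n_def)
  have ex: "\<exists>f. \<forall>j::nat. open_boxes (f j) \<and> f j \<noteq> {} \<and> \<Union>(f j) \<subseteq> W \<and> ?m W - 1 / Suc j < ?m (\<Union>(f j))"
    if "open W" "bounded W" "W \<noteq> {}" for W :: "'a set"
    using open_boxes_approx[OF that] by (intro choice) auto
  have conv: "(\<lambda>j. ?m (\<Union>(f j))) \<longlonglongrightarrow> ?m W" if W: "open W" "bounded W" and f: "\<And>j. open_boxes (f j) \<and> f j \<noteq> {} \<and> \<Union>(f j) \<subseteq> W \<and> ?m W - 1 / Suc j < ?m (\<Union>(f j))"
    for W :: "'a set" and f
  proof (rule tendsto_sandwich)
    show "(\<lambda>j. ?m W - 1 / Suc j) \<longlonglongrightarrow> ?m W"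
      using tendsto_diff[OF tendsto_const LIMSEQ_inverse_real_of_nat, of "?m W"]
      by (simp only: inverse_eq_divide diff_0_right)
    show "\<forall>\<^sub>F j in sequentially. ?m W - 1 / Suc j \<le> ?m (\<Union>(f j))"
      by (intro always_eventually allI less_imp_le) (use f in blast)
    show "\<forall>\<^sub>F j in sequentially. ?m (\<Union>(f j)) \<le> ?m W"
    proof (intro always_eventually allI measure_mono_fmeasurable)
      fix j
      show "\<Union>(f j) \<subseteq> W" using f by blast
      have "open (\<Union>(f j))" using f open_boxes_open by blast
      then show "\<Union>(f j) \<in> sets lborel" by (simp add: borel_open)
      show "W \<in> fmeasurable lborel" using W by (intro bounded_fmeasurable borel_open)
    qed
  qed (rule tendsto_const)
  obtain f where f: "\<And>j. open_boxes (f j) \<and> f j \<noteq> {} \<and> \<Union>(f j) \<subseteq> U \<and> ?m U - 1 / Suc j < ?m (\<Union>(f j))"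
    using ex[OF U] by blast
  obtain g where g: "\<And>j. open_boxes (g j) \<and> g j \<noteq> {} \<and> \<Union>(g j) \<subseteq> V \<and> ?m V - 1 / Suc j < ?m (\<Union>(g j))"
    using ex[OF V] by blast
  have "(\<lambda>j. (root n (?m (\<Union>(f j))) + root n (?m (\<Union>(g j)))) ^ n) \<longlonglongrightarrow> (root n (?m U) + root n (?m V)) ^ n"
    using conv[OF U(1,2) f] conv[OF V(1,2) g] by (intro tendsto_intros)
  moreover have "(root n (?m (\<Union>(f j))) + root n (?m (\<Union>(g j)))) ^ n \<le> ?m (U + V)" for j
  proof -
    have "(root n (?m (\<Union>(f j))) + root n (?m (\<Union>(g j)))) ^ n \<le> ?m (\<Union>(f j) + \<Union>(g j))"
      unfolding n_def using f g by (intro brunn_minkowski_open_boxes) auto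
    also have "\<dots> \<le> ?m (U + V)"
      using f[of j] g[of j] U V by (intro measure_mono_fmeasurable bounded_fmeasurable set_plus_mono2)
        (auto intro!: borel_open open_set_plus bounded_set_plus open_boxes_open)
    finally show ?thesis .
  qed
  ultimately show ?thesis unfolding n_def[symmetric] by (intro LIMSEQ_le_const2) auto
qed

section \<open>A reverse Hoelder inequality for concave functions\<close>

lemma mem_thin_domain [simp]:
  "(s, t) \<in> thin_domain A f g \<epsilon> \<longleftrightarrow> s \<in> A \<and> \<epsilon> * f s < t \<and> t < \<epsilon> * g s"
  by (simp add: thin_domain_def)

lemma open_thin_domain:
  fixes A :: "'a::euclidean_space set"
  assumes "open A" "continuous_on A f" "continuous_on A g"
  shows "open (thin_domain A f g \<epsilon>)"
proof -
  have "continuous_on (A \<times> UNIV) (\<lambda>x. min (snd x - \<epsilon> * f (fst x)) (\<epsilon> * g (fst x) - snd x))"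
    by (intro continuous_intros continuous_on_compose2[OF assms(2)] continuous_on_compose2[OF assms(3)]) auto
  then have "open ((A \<times> UNIV) \<inter> (\<lambda>x. min (snd x - \<epsilon> * f (fst x)) (\<epsilon> * g (fst x) - snd x)) -` {0<..})"
    using assms(1) by (intro continuous_open_preimage open_Times) auto
  also have "(A \<times> UNIV) \<inter> (\<lambda>x. min (snd x - \<epsilon> * f (fst x)) (\<epsilon> * g (fst x) - snd x)) -` {0<..} = thin_domain A f g \<epsilon>"
    by (auto simp: thin_domain_def)
  finally show ?thesis .
qed

lemma bounded_thin_domain:
  fixes A :: "'a::euclidean_space set"
  assumes "bounded A" "\<And>s. s \<in> A \<Longrightarrow> m \<le> \<epsilon> * f s" "\<And>s. s \<in> A \<Longrightarrow> \<epsilon> * g s \<le> M"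
  shows "bounded (thin_domain A f g \<epsilon>)"
proof (rule bounded_subset)
  show "bounded (A \<times> {m..M})" using assms(1) by (intro bounded_Times) auto
  show "thin_domain A f g \<epsilon> \<subseteq> A \<times> {m..M}"
    using assms(2,3) by (fastforce simp: thin_domain_def)
qed

text \<open>Fubini over vertical slices. The coercion \<open>ennreal\<close> cuts negative lengths
  off to \<open>0\<close>, which is the right value for truncated subgraphs over points where the
  lower level exceeds \<open>h\<close>.\<close>

lemma emeasure_thin_domain:
  fixes A :: "'a::euclidean_space set"
  assumes "open A" "continuous_on A f" "continuous_on A g"
  shows "emeasure lborel (thin_domain A f g \<epsilon>) = (\<integral>\<^sup>+s\<in>A. ennreal (\<epsilon> * g s - \<epsilon> * f s) \<partial>lborel)"
proof -
  let ?K = "thin_domain A f g \<epsilon>"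
  have "?K \<in> sets (lborel \<Otimes>\<^sub>M lborel)"
    unfolding lborel_prod using open_thin_domain[OF assms] by (simp add: borel_open)
  then have "emeasure (lborel \<Otimes>\<^sub>M lborel) ?K = (\<integral>\<^sup>+s. emeasure lborel (Pair s -` ?K) \<partial>lborel)"
    by (rule lborel.emeasure_pair_measure_alt)
  also have "\<dots> = (\<integral>\<^sup>+s\<in>A. ennreal (\<epsilon> * g s - \<epsilon> * f s) \<partial>lborel)"
  proof (rule nn_integral_cong)
    fix s
    have "Pair s -` ?K = (if s \<in> A then {\<epsilon> * f s <..< \<epsilon> * g s} else {})"
      by auto
    then show "emeasure lborel (Pair s -` ?K) = ennreal (\<epsilon> * g s - \<epsilon> * f s) * indicator A s"
      by (cases "\<epsilon> * f s \<le> \<epsilon> * g s") (auto simp: ennreal_neg)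
  qed
  finally show ?thesis by (simp only: lborel_prod)
qed

text \<open>A twofold layer-cake formula: \<open>c^3\<close> is the integral of
  \<open>6 a (c - a)\<close> over \<open>0 \<le> a \<le> c\<close>. Taken to second order it
  involves volumes of truncated subgraphs instead of areas of level sets, and these volumes are what
  Brunn-Minkowski controls.\<close>

lemma nn_integral_cube_layer:
  fixes g :: "'a::euclidean_space \<Rightarrow> real"
  assumes [measurable]: "g \<in> borel_measurable borel" and g: "\<And>x. 0 \<le> g x"
  shows "(\<integral>\<^sup>+x. ennreal (g x ^ 3) \<partial>lborel) =
    (\<integral>\<^sup>+a\<in>{0..}. ennreal (6 * a) * (\<integral>\<^sup>+x. ennreal (g x - a) \<partial>lborel) \<partial>lborel)"
proof -
  have cube: "(\<integral>\<^sup>+a. ennreal (6 * a) * ennreal (c - a) * indicator {0..} a \<partial>lborel) = ennreal (c ^ 3)" if c: "0 \<le> c" for c :: real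
  proof -
    have "(\<integral>\<^sup>+a. ennreal (6 * a) * ennreal (c - a) * indicator {0..} a \<partial>lborel)
        = (\<integral>\<^sup>+a. ennreal (6 * a * (c - a)) * indicator {0..c} a \<partial>lborel)"
      by (intro nn_integral_cong) (auto simp: indicator_def ennreal_mult'[symmetric] ennreal_neg)
    also have "\<dots> = (3 * c^2 * c - 2 * c ^ 3) - (3 * 0^2 * c - 2 * 0 ^ 3)"
    proof (rule nn_integral_FTC_Icc)
      show "DERIV (\<lambda>a. 3 * a^2 * c - 2 * a ^ 3) a :> 6 * a * (c - a)" for a
        by (auto intro!: derivative_eq_intros simp: algebra_simps power2_eq_square)
    qed (use c in auto)
    also have "\<dots> = c ^ 3" by (simp add: power2_eq_square power3_eq_cube mult.assoc)
    finally show ?thesis .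
  qed
  have "(\<integral>\<^sup>+x. ennreal (g x ^ 3) \<partial>lborel) =
      (\<integral>\<^sup>+x. (\<integral>\<^sup>+a. ennreal (6 * a) * ennreal (g x - a) * indicator {0..} a \<partial>lborel) \<partial>lborel)"
    by (simp add: cube g)
  also have "\<dots> = (\<integral>\<^sup>+a. (\<integral>\<^sup>+x. ennreal (6 * a) * ennreal (g x - a) * indicator {0..} a \<partial>lborel) \<partial>lborel)"
    by (rule lborel_pair.Fubini'[symmetric]) measurable
  also have "\<dots> = (\<integral>\<^sup>+a\<in>{0..}. ennreal (6 * a) * (\<integral>\<^sup>+x. ennreal (g x - a) \<partial>lborel) \<partial>lborel)"
    by (intro nn_integral_cong) (simp add: nn_integral_cmult nn_integral_multc)
  finally show ?thesis .
qed

text \<open>A rescaled Beta integral: that of \<open>a (1 - a)^d\<close> over the unit interval is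
  \<open>1 / ((d + 1) (d + 2))\<close>. It evaluates the layer formula on the extremal volume
  function, that of a cone.\<close>

lemma nn_integral_beta:
  assumes c: "c > 0" and d: "d > 0" and v: "v \<ge> 0"
  shows "(\<integral>\<^sup>+a\<in>{0..}. ennreal (6 * a) * ennreal (v * (max 0 (1 - c * a)) ^ d) \<partial>lborel)
    = ennreal (6 * v / (c\<^sup>2 * (real d + 1) * (real d + 2)))"
proof -
  have "(\<integral>\<^sup>+a\<in>{0..}. ennreal (6 * a) * ennreal (v * (max 0 (1 - c * a)) ^ d) \<partial>lborel)
      = (\<integral>\<^sup>+a. ennreal (6 * a * (v * (1 - c * a) ^ d)) * indicator {0..1/c} a \<partial>lborel)"
  proof (rule nn_integral_cong)
    fix a
    consider "a < 0" | "0 \<le> a" "a \<le> 1/c" | "a > 1/c" "0 < a" using c by (smt (verit) divide_pos_pos)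
    then show "ennreal (6 * a) * ennreal (v * (max 0 (1 - c * a)) ^ d) * indicator {0..} a
      = ennreal (6 * a * (v * (1 - c * a) ^ d)) * indicator {0..1/c} a"
    proof cases
      case 2
      then have "c * a \<le> 1" using c by (simp add: field_simps)
      then show ?thesis using 2 v by (simp add: ennreal_mult' max_absorb2)
    next
      case 3
      then have "c * a > 1" using c by (simp add: field_simps)
      then show ?thesis using 3 d by (simp add: max_absorb1 zero_power)
    qed simp
  qed
  \<comment> \<open>Writing \<open>c a = 1 - (1 - c a)\<close> turns the integrand into a difference
    of two powers of \<open>1 - c a\<close>, whence this primitive.\<close>
  also have "\<dots> = ennreal (6 * v / c\<^sup>2 * ((1 - c * (1/c)) ^ (d+2) / (real d + 2) - (1 - c * (1/c)) ^ (d+1) / (real d + 1))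
      - 6 * v / c\<^sup>2 * ((1 - c * 0) ^ (d+2) / (real d + 2) - (1 - c * 0) ^ (d+1) / (real d + 1)))"
  proof (rule nn_integral_FTC_Icc)
    fix a assume a: "a \<in> {0..1/c}"
    have n0: "real d + 2 \<noteq> 0" "real d + 1 \<noteq> 0" by linarith+
    have "((\<lambda>a. (1 - c * a) ^ (d+2) / (real d + 2) - (1 - c * a) ^ (d+1) / (real d + 1)) has_real_derivative
        (- c * (1 - c * a) ^ (d+1)) - (- c * (1 - c * a) ^ d)) (at a)"
    proof (rule DERIV_diff)
      have P: "((\<lambda>a. (1 - c * a) ^ n) has_real_derivative real n * (1 - c * a) ^ (n-1) * (- c)) (at a)" for n
      proof -
        have "((\<lambda>a. 1 - c * a) has_real_derivative - c) (at a)" by (auto intro!: derivative_eq_intros)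
        from DERIV_power[OF this, of n] show ?thesis by (rule DERIV_cong) simp
      qed
      have "((\<lambda>a. (1 - c * a) ^ (d+2)) has_real_derivative real (d+2) * (1 - c * a) ^ (d+2-1) * (- c)) (at a)"
        by (rule P)
      from DERIV_cdivide[OF this, of "real d + 2"]
      show "((\<lambda>a. (1 - c * a) ^ (d+2) / (real d + 2)) has_real_derivative - c * (1 - c * a) ^ (d+1)) (at a)"
        by (rule DERIV_cong) (use n0 in \<open>simp add: field_simps\<close>)
      have "((\<lambda>a. (1 - c * a) ^ (d+1)) has_real_derivative real (d+1) * (1 - c * a) ^ (d+1-1) * (- c)) (at a)"
        by (rule P)
      from DERIV_cdivide[OF this, of "real d + 1"]
      show "((\<lambda>a. (1 - c * a) ^ (d+1) / (real d + 1)) has_real_derivative - c * (1 - c * a) ^ d) (at a)"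
        by (rule DERIV_cong) (use n0 in \<open>simp add: field_simps\<close>)
    qed
    from DERIV_cmult[OF this, of "6 * v / c\<^sup>2"]
    show "DERIV (\<lambda>a. 6 * v / c\<^sup>2 * ((1 - c * a) ^ (d+2) / (real d + 2) - (1 - c * a) ^ (d+1) / (real d + 1))) a
        :> 6 * a * (v * (1 - c * a) ^ d)"
      by (rule DERIV_cong) (use c in \<open>simp add: field_simps power2_eq_square\<close>)
    have "c * a \<le> 1" using a c by (simp add: field_simps)
    then show "0 \<le> 6 * a * (v * (1 - c * a) ^ d)" using a v by simp
  qed (use c in auto)
  also have "6 * v / c\<^sup>2 * ((1 - c * (1/c)) ^ (d+2) / (real d + 2) - (1 - c * (1/c)) ^ (d+1) / (real d + 1))
      - 6 * v / c\<^sup>2 * ((1 - c * 0) ^ (d+2) / (real d + 2) - (1 - c * 0) ^ (d+1) / (real d + 1))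
      = 6 * v / (c\<^sup>2 * (real d + 1) * (real d + 2))"
  proof -
    have n0: "real d + 2 \<noteq> 0" "real d + 1 \<noteq> 0" by linarith+
    have "1 / (real d + 1) - 1 / (real d + 2) = 1 / ((real d + 1) * (real d + 2))"
      using n0 by (simp add: field_simps)
    then have "6 * v / c\<^sup>2 * (1 / (real d + 1) - 1 / (real d + 2)) = 6 * v / (c\<^sup>2 * (real d + 1) * (real d + 2))"
      by simp
    then show ?thesis using c by (simp add: algebra_simps)
  qed
  finally show ?thesis .
qed

lemma measure_scaled_open:
  fixes U :: "'a::euclidean_space set"
  assumes "open U" "c > 0"
  shows "measure lborel ((\<lambda>x. c *\<^sub>R x) ` U) = c ^ DIM('a) * measure lborel U"
    and "open ((\<lambda>x. c *\<^sub>R x) ` U)"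
proof -
  show o: "open ((\<lambda>x. c *\<^sub>R x) ` U)" using assms open_scaling[of c U] by simp
  have "measure lebesgue ((\<lambda>x. c *\<^sub>R x + 0) ` U) = \<bar>c\<bar> ^ DIM('a) * measure lebesgue U"
    by (rule measure_lebesgue_affine)
  then show "measure lborel ((\<lambda>x. c *\<^sub>R x) ` U) = c ^ DIM('a) * measure lborel U"
    using assms o by (simp add: measure_completion borel_open)
qed

text \<open>Brunn--Minkowski for the truncated subgraphs, differentiated at the bottom level \<open>0\<close>, where the
  section of the subgraph is the whole base \<open>A\<close>.\<close>

lemma truncated_subgraph_measure_le:
  fixes A :: "'a::euclidean_space set" and h :: "'a \<Rightarrow> real"
  defines "d \<equiv> DIM('a \<times> real)"
  defines "v \<equiv> \<lambda>a. measure lborel (thin_domain A (\<lambda>_. a) h 1)"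
  assumes A: "open A" "bounded A" "A \<noteq> {}" and h: "concave_on A h" "\<And>s. s \<in> A \<Longrightarrow> 0 < h s" "\<And>s. s \<in> A \<Longrightarrow> h s \<le> H"
    and a: "0 \<le> a"
  shows "v a \<le> v 0 * (max 0 (1 - measure lborel A / (d * v 0) * a)) ^ d"
proof (cases "thin_domain A (\<lambda>_. a) h 1 = {}")
  case True
  then show ?thesis by (simp add: v_def)
next
  case False
  let ?K = "\<lambda>b. thin_domain A (\<lambda>_. b) h 1"
  have d: "d > 0" by (simp add: d_def)
  have cont: "continuous_on A h"
    using convex_on_continuous[OF A(1), of "\<lambda>x. - h x"] h(1) continuous_on_minus[of A "\<lambda>x. - h x"]
    by (simp add: concave_on_def)
  have oK: "open (?K b)" for b by (intro open_thin_domain A cont continuous_on_const)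
  have bK: "bounded (?K b)" for b by (rule bounded_thin_domain[where m=b and M=H]) (use A h in auto)
  have neK: "?K a \<noteq> {}" by (rule False)
  obtain s0 where "s0 \<in> A" using A by blast
  then have "(s0, h s0 / 2) \<in> ?K 0" using h(2)[of s0] by auto
  then have neK0: "?K 0 \<noteq> {}" by blast
  define r where "r b = root d (v b)" for b
  have v0: "v 0 > 0" and va: "v a > 0" unfolding v_def by (intro measure_open_pos oK bK neK neK0)+
  have r0: "r 0 > 0" "r 0 ^ d = v 0" and ra: "r a > 0" "r a ^ d = v a"
    using v0 va d by (simp_all add: r_def)
  \<comment> \<open>The d-th root of the volume ratio. In terms of \<open>q\<close> the claim
    follows from the tangent line bound \<open>q \<le> 1 - |A| a / (d v(0))\<close>.\<close>
  define q where "q = r a / r 0"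
  have q: "q > 0" "v a = v 0 * q ^ d" using r0 ra by (auto simp: q_def power_divide)
  have fm: "?K b \<in> fmeasurable lborel" for b by (intro bounded_fmeasurable bK borel_open oK)
  \<comment> \<open>Concavity puts the combination of the subgraphs above levels \<open>0\<close>
    and \<open>a\<close> inside the one above level \<open>l a\<close>. Bernoulli's inequality then
    linearises the d-th power, so that only a first-order statement in \<open>l\<close> has to be
    passed to the limit.\<close>
  have bm: "v 0 * (1 + d * (l * (q - 1))) \<le> v (l * a)" if l: "0 < l" "l < 1" for l
  proof -
    let ?X = "(\<lambda>x. (1 - l) *\<^sub>R x) ` ?K 0" and ?Y = "(\<lambda>x. l *\<^sub>R x) ` ?K a"
    have X: "measure lborel ?X = (1 - l) ^ d * v 0" "open ?X" and Y: "measure lborel ?Y = l ^ d * v a" "open ?Y"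
      unfolding d_def v_def using measure_scaled_open[OF oK, of "1 - l" 0] measure_scaled_open[OF oK, of l a] l by auto
    have "(root d (measure lborel ?X) + root d (measure lborel ?Y)) ^ d \<le> measure lborel (?X + ?Y)"
      unfolding d_def using X Y neK neK0 bK by (intro brunn_minkowski_open bounded_scaling) auto
    also have "\<dots> \<le> v (l * a)"
      unfolding v_def
    proof (rule measure_mono_fmeasurable)
      show "?X + ?Y \<subseteq> ?K (l * a)"
      proof
        fix z assume "z \<in> ?X + ?Y"
        then obtain s t s' t' where z: "z = (1 - l) *\<^sub>R (s, t) + l *\<^sub>R (s', t')" and st: "(s, t) \<in> ?K 0" "(s', t') \<in> ?K a"
          by (auto elim!: set_plus_elim)
        have "(1 - l) * h s + l * h s' \<le> h ((1 - l) *\<^sub>R s + l *\<^sub>R s')"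
          using concave_onD[OF h(1), of l s s'] l st by simp
        moreover have "(1 - l) * t + l * t' < (1 - l) * h s + l * h s'"
          using l st by (intro add_strict_mono) auto
        moreover have "0 < (1 - l) * t" "l * a < l * t'" using l st by auto
        moreover have "(1 - l) *\<^sub>R s + l *\<^sub>R s' \<in> A"
          using concave_on_imp_convex[OF h(1)] st l by (intro convexD) auto
        ultimately show "z \<in> ?K (l * a)" unfolding z by simp
      qed
      show "?X + ?Y \<in> sets lborel" using X(2) by (simp add: open_set_plus borel_open)
    qed (rule fm)
    finally have "((1 - l) * r 0 + l * r a) ^ d \<le> v (l * a)"
      using l d by (simp add: X(1) Y(1) real_root_mult r_def real_root_power_cancel)
    moreover have "(1 - l) * r 0 + l * r a = r 0 * (1 + l * (q - 1))"
      using r0 by (simp add: q_def field_simps)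
    ultimately have "v 0 * (1 + l * (q - 1)) ^ d \<le> v (l * a)"
      by (simp add: power_mult_distrib r0)
    moreover have "1 + d * (l * (q - 1)) \<le> (1 + l * (q - 1)) ^ d"
    proof (rule Bernoulli_inequality)
      have "l * (q - 1) \<ge> l * (-1)" using l q by (intro mult_left_mono) auto
      then show "-1 \<le> l * (q - 1)" using l by linarith
    qed
    ultimately show ?thesis using v0 by (meson mult_left_mono less_imp_le order_trans)
  qed
  have em: "emeasure lborel (?K b) = (\<integral>\<^sup>+s\<in>A. ennreal (h s - b) \<partial>lborel)" for b
    using emeasure_thin_domain[OF A(1) continuous_on_const[where c=b] cont, where \<epsilon>=1] by simp
  define g where "g s = indicator A s *\<^sub>R h s" for s
  have g_meas[measurable]: "g \<in> borel_measurable borel"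
    unfolding g_def using borel_measurable_continuous_on_indicator[OF _ cont] A(1) by (simp add: borel_open)
  have A_fm: "A \<in> fmeasurable lborel" using A by (intro bounded_fmeasurable borel_open)
  have A_meas[measurable]: "A \<in> sets borel" using A(1) by (rule borel_open)
  have int_ind: "integrable lborel (\<lambda>s. indicator A s :: real)"
    using A_fm by (simp add: integrable_indicator_iff fmeasurable_def)
  \<comment> \<open>For \<open>b = l a\<close>, dividing this lost volume by \<open>l\<close> gives
    the integral of \<open>min (h s / l) a\<close>, which tends to \<open>a |A|\<close> as
    \<open>l\<close> tends to \<open>0\<close> because \<open>h > 0\<close> on \<open>A\<close>.
    That is the derivative of \<open>v\<close> at level \<open>0\<close>.\<close>
  have v_diff: "v 0 - v b = (LINT s|lborel. indicator A s * min (h s) b)" if b: "b \<ge> 0" for b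
  proof -
    have Ib: "integrable lborel (\<lambda>s. indicator A s * max 0 (h s - b))" and vb: "v b = (LINT s|lborel. indicator A s * max 0 (h s - b))" if b: "b \<ge> 0" for b
    proof -
      have me: "(\<lambda>s. indicator A s * max 0 (h s - b)) \<in> borel_measurable lborel"
      proof -
        have "(\<lambda>s. indicator A s * max 0 (h s - b)) = (\<lambda>s. indicator A s * max 0 (g s - b))"
          by (auto simp: g_def indicator_def)
        then show ?thesis by simp
      qed
      show I: "integrable lborel (\<lambda>s. indicator A s * max 0 (h s - b))"
        by (rule Bochner_Integration.integrable_bound[OF integrable_mult_right[OF int_ind, of H] me])
          (use h b in \<open>auto simp: indicator_def intro!: AE_I2 order_trans[OF _ abs_ge_self]\<close>, force)
      have "ennreal (v b) = emeasure lborel (?K b)" unfolding v_def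
        using fm[of b] by (simp add: emeasure_eq_ennreal_measure fmeasurable_def less_top)
      also have "\<dots> = (\<integral>\<^sup>+s. ennreal (indicator A s * max 0 (h s - b)) \<partial>lborel)"
        unfolding em by (intro nn_integral_cong) (auto simp: indicator_def max_def ennreal_neg)
      also have "\<dots> = ennreal (LINT s|lborel. indicator A s * max 0 (h s - b))"
        by (rule nn_integral_eq_integral[OF I]) auto
      finally show "v b = (LINT s|lborel. indicator A s * max 0 (h s - b))"
        by (subst (asm) ennreal_inj) (auto simp: v_def intro!: integral_nonneg_AE)
    qed
    have "v 0 - v b = (LINT s|lborel. indicator A s * max 0 (h s - 0) - indicator A s * max 0 (h s - b))"
      unfolding vb[OF b] vb[OF order_refl] using Ib[OF b] Ib[OF order_refl]
      by (intro Bochner_Integration.integral_diff[symmetric])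
    also have "\<dots> = (LINT s|lborel. indicator A s * min (h s) b)"
      using h(2) by (intro Bochner_Integration.integral_cong) (auto simp: indicator_def max_def min_def dest!: h(2))
    finally show ?thesis .
  qed
  \<comment> \<open>Any sequence in the open unit interval tending to \<open>0\<close> would do; the
    shift by 2 keeps \<open>l 0\<close> below 1.\<close>
  define l where "l k = 1 / real (k + 2)" for k
  have l: "0 < l k" "l k < 1" for k by (auto simp: l_def)
  have "(\<lambda>k. LINT s|lborel. indicator A s * min (h s / l k) a) \<longlonglongrightarrow> (LINT s|lborel. indicator A s * a)"
  proof (rule integral_dominated_convergence[where w="\<lambda>s. indicator A s * a"])
    show "(\<lambda>s. indicator A s * min (h s / l k) a) \<in> borel_measurable lborel" for k
    proof -
      have "(\<lambda>s. indicator A s * min (h s / l k) a) = (\<lambda>s. indicator A s * min (g s / l k) a)"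
        by (auto simp: g_def indicator_def)
      then show ?thesis by simp
    qed
    show "integrable lborel (\<lambda>s. indicator A s * a)" using int_ind by simp
    show "AE s in lborel. (\<lambda>k. indicator A s * min (h s / l k) a) \<longlonglongrightarrow> indicator A s * a"
    proof (rule AE_I2)
      fix s
      show "(\<lambda>k. indicator A s * min (h s / l k) a) \<longlonglongrightarrow> indicator A s * a"
      proof (cases "s \<in> A")
        case True
        obtain N where N: "a / h s < real N" using reals_Archimedean2 by blast
        have "\<forall>\<^sub>F k in sequentially. indicator A s * a = indicator A s * min (h s / l k) a"
          using eventually_ge_at_top[of N]
        proof eventually_elim
          case (elim k)
          have "a < real N * h s" using N h(2)[OF True] by (simp add: pos_divide_less_eq)
          also have "\<dots> \<le> real (k + 2) * h s" using elim h(2)[OF True] by (intro mult_right_mono) auto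
          finally show ?case by (simp add: l_def min_def mult.commute)
        qed
        then show ?thesis by (rule Lim_transform_eventually[OF tendsto_const])
      qed simp
    qed
    show "AE s in lborel. norm (indicator A s * min (h s / l k) a) \<le> indicator A s * a" for k
    proof (rule AE_I2)
      fix s
      show "norm (indicator A s * min (h s / l k) a) \<le> indicator A s * a"
      proof (cases "s \<in> A")
        case True
        have "0 \<le> h s / l k" using h(2)[OF True] l[of k] by simp
        then show ?thesis using a True by (simp add: min_def)
      qed simp
    qed
  qed simp
  moreover have "(LINT s|lborel. indicator A s * min (h s / l k) a) \<le> v 0 * d * (1 - q)" for k
  proof -
    have "l k * (LINT s|lborel. indicator A s * min (h s / l k) a) = (LINT s|lborel. l k * (indicator A s * min (h s / l k) a))"
      by simp
    also have "\<dots> = (LINT s|lborel. indicator A s * min (h s) (l k * a))"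
      using l[of k] by (intro Bochner_Integration.integral_cong) (auto simp: min_def field_simps)
    also have "\<dots> = v 0 - v (l k * a)" using l[of k] a by (simp add: v_diff)
    also have "\<dots> \<le> l k * (v 0 * d * (1 - q))" using bm[OF l] by (simp add: algebra_simps)
    finally show ?thesis using l[of k] by simp
  qed
  ultimately have "(LINT s|lborel. indicator A s * a) \<le> v 0 * d * (1 - q)"
    by (intro LIMSEQ_le_const2) auto
  moreover have "(LINT s|lborel. indicator A s * a) = measure lborel A * a" by simp
  ultimately have "q \<le> 1 - measure lborel A / (d * v 0) * a"
    using v0 d by (simp add: field_simps)
  then have "q ^ d \<le> (max 0 (1 - measure lborel A / (d * v 0) * a)) ^ d"
    using q by (intro power_mono) auto
  then show ?thesis using q v0 by simp
qed


text \<open>By the layer formula the cubic integral is that of \<open>6 a v(a)\<close>, and the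
  tangent bound replaces \<open>v(a)\<close> by \<open>v(0) (1 - c a)^d\<close>. Since
  \<open>c\<close> contains \<open>|A|\<close>, multiplying by \<open>|A|^2\<close> clears it and
  leaves the cube of \<open>v(0)\<close>, the integral of \<open>h\<close>. For the cone the tangent
  bound is sharp at all levels, which gives equality.\<close>

lemma concave_reverse_Hoelder:
  fixes A :: "'a::euclidean_space set" and h :: "'a \<Rightarrow> real"
  defines "d \<equiv> DIM('a) + 1"
  assumes A: "open A" "bounded A" "A \<noteq> {}" and h: "concave_on A h" "\<And>s. s \<in> A \<Longrightarrow> 0 < h s" "\<And>s. s \<in> A \<Longrightarrow> h s \<le> H"
  shows "(measure lborel A)\<^sup>2 * (LINT s:A|lborel. h s ^ 3)
    \<le> 6 * (real d)\<^sup>2 / ((real d + 1) * (real d + 2)) * (LINT s:A|lborel. h s) ^ 3"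
    and "0 < (LINT s:A|lborel. h s)" "0 < (LINT s:A|lborel. h s ^ 3)"
    and "A = ball 0 1 \<Longrightarrow> (\<And>s. s \<in> A \<Longrightarrow> h s = 1 - norm s) \<Longrightarrow>
      (measure lborel A)\<^sup>2 * (LINT s:A|lborel. h s ^ 3)
      = 6 * (real d)\<^sup>2 / ((real d + 1) * (real d + 2)) * (LINT s:A|lborel. h s) ^ 3"
proof -
  define v where "v a = measure lborel (thin_domain A (\<lambda>_. a) h 1)" for a
  have cont: "continuous_on A h"
    using convex_on_continuous[OF A(1), of "\<lambda>x. - h x"] h(1) continuous_on_minus[of A "\<lambda>x. - h x"]
    by (simp add: concave_on_def)
  have A_fm: "A \<in> fmeasurable lborel" using A by (intro bounded_fmeasurable borel_open)
  have A_meas[measurable]: "A \<in> sets borel" using A(1) by (rule borel_open)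
  define g where "g s = indicator A s *\<^sub>R h s" for s
  have g_meas[measurable]: "g \<in> borel_measurable borel"
    unfolding g_def using borel_measurable_continuous_on_indicator[OF _ cont] A(1) by (simp add: borel_open)
  have g0: "0 \<le> g s" for s using h(2)[of s] by (auto simp: g_def indicator_def)
  have int_ind: "integrable lborel (\<lambda>s. indicator A s :: real)"
    using A_fm by (simp add: integrable_indicator_iff fmeasurable_def)
  have gH: "g s \<le> indicator A s * H" for s using h(3)[of s] by (auto simp: g_def indicator_def)
  have Hpos: "H \<ge> 0" using A(3) h(2,3) by (meson ex_in_conv less_imp_le order_trans)
  have Ig: "integrable lborel g"
    by (rule Bochner_Integration.integrable_bound[OF integrable_mult_left[OF int_ind, of H]])
      (use gH g0 Hpos in auto)
  have Ig3: "integrable lborel (\<lambda>s. g s ^ 3)"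
  proof (rule Bochner_Integration.integrable_bound[OF integrable_mult_left[OF int_ind, of "H ^ 3"]])
    have "g s ^ 3 \<le> indicator A s * H ^ 3" for s
      using power_mono[OF gH[of s] g0, of 3] by (auto simp: indicator_def split: if_splits)
    then show "AE s in lborel. norm (g s ^ 3) \<le> norm (indicator A s * H ^ 3)"
      using g0 Hpos by auto
  qed simp
  have LI1: "(LINT s:A|lborel. h s) = integral\<^sup>L lborel g" 
    unfolding set_lebesgue_integral_def by (intro Bochner_Integration.integral_cong) (auto simp: g_def)
  have LI3: "(LINT s:A|lborel. h s ^ 3) = (LINT s|lborel. g s ^ 3)"
    unfolding set_lebesgue_integral_def g_def by (intro Bochner_Integration.integral_cong) (auto simp: indicator_def)
  have oK: "open (thin_domain A (\<lambda>_. b) h 1)" for b by (intro open_thin_domain A cont continuous_on_const)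
  have bK: "bounded (thin_domain A (\<lambda>_. b) h 1)" for b by (rule bounded_thin_domain[where m=b and M=H]) (use A h in auto)
  have fm: "thin_domain A (\<lambda>_. b) h 1 \<in> fmeasurable lborel" for b by (intro bounded_fmeasurable bK borel_open oK)
  have em: "(\<integral>\<^sup>+s. ennreal (g s - a) \<partial>lborel) = ennreal (v a)" if "a \<ge> 0" for a
  proof -
    have "(\<integral>\<^sup>+s. ennreal (g s - a) \<partial>lborel) = (\<integral>\<^sup>+s\<in>A. ennreal (h s - a) \<partial>lborel)"
      using that by (intro nn_integral_cong) (auto simp: g_def indicator_def ennreal_neg)
    also have "\<dots> = emeasure lborel (thin_domain A (\<lambda>_. a) h 1)"
      using emeasure_thin_domain[OF A(1) continuous_on_const[where c=a] cont, where \<epsilon>=1] by simp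
    also have "\<dots> = ennreal (v a)"
      unfolding v_def using fm[of a] by (simp add: emeasure_eq_ennreal_measure fmeasurable_def less_top)
    finally show ?thesis .
  qed
  have "ennreal (integral\<^sup>L lborel g) = ennreal (v 0)"
    using em[of 0] nn_integral_eq_integral[OF Ig] g0 by simp
  then have v0: "integral\<^sup>L lborel g = v 0"
    by (subst (asm) ennreal_inj) (auto simp: v_def g0 intro!: integral_nonneg_AE)
  have mA: "measure lborel A > 0" by (intro measure_open_pos A)
  obtain s0 where "s0 \<in> A" using A by blast
  then have "(s0, h s0 / 2) \<in> thin_domain A (\<lambda>_. 0) h 1" using h(2)[of s0] by auto
  then have v0pos: "v 0 > 0" unfolding v_def by (intro measure_open_pos oK bK) blast
  then show pos1: "0 < (LINT s:A|lborel. h s)" by (simp add: LI1 v0)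
  define c where "c = measure lborel A / (d * v 0)"
  have c: "c > 0" using mA v0pos by (simp add: c_def d_def)
  have dpos: "d > 0" by (simp add: d_def)
  have layer: "ennreal (LINT s|lborel. g s ^ 3) = (\<integral>\<^sup>+a\<in>{0..}. ennreal (6 * a) * ennreal (v a) \<partial>lborel)"
  proof -
    have "ennreal (LINT s|lborel. g s ^ 3) = (\<integral>\<^sup>+s. ennreal (g s ^ 3) \<partial>lborel)"
      using nn_integral_eq_integral[OF Ig3] g0 by simp
    also have "\<dots> = (\<integral>\<^sup>+a\<in>{0..}. ennreal (6 * a) * (\<integral>\<^sup>+x. ennreal (g x - a) \<partial>lborel) \<partial>lborel)"
      by (rule nn_integral_cube_layer) (auto simp: g0)
    also have "\<dots> = (\<integral>\<^sup>+a\<in>{0..}. ennreal (6 * a) * ennreal (v a) \<partial>lborel)"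
      by (intro nn_integral_cong) (auto simp: em indicator_def)
    finally show ?thesis .
  qed
  have beta: "(\<integral>\<^sup>+a\<in>{0..}. ennreal (6 * a) * ennreal (v 0 * (max 0 (1 - c * a)) ^ d) \<partial>lborel)
      = ennreal (6 * v 0 / (c\<^sup>2 * (real d + 1) * (real d + 2)))"
    using nn_integral_beta[OF c dpos, of "v 0"] v0pos by simp
  have rhs: "(measure lborel A)\<^sup>2 * (6 * v 0 / (c\<^sup>2 * (real d + 1) * (real d + 2)))
      = 6 * (real d)\<^sup>2 / ((real d + 1) * (real d + 2)) * v 0 ^ 3"
  proof -
    have alg: "m\<^sup>2 * (6 * w / ((m / (D * w))\<^sup>2 * k * l)) = 6 * D\<^sup>2 / (k * l) * w ^ 3"
      if "m \<noteq> 0" "D \<noteq> 0" "w \<noteq> 0" "k \<noteq> 0" "l \<noteq> 0" for m w D k l :: real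
      using that by (simp add: field_simps power2_eq_square power3_eq_cube)
    show ?thesis unfolding c_def using mA v0pos dpos by (intro alg) auto
  qed
  have pos: "6 * v 0 / (c\<^sup>2 * (real d + 1) * (real d + 2)) > 0" using v0pos c by simp
  have "ennreal (LINT s|lborel. g s ^ 3) \<le> (\<integral>\<^sup>+a\<in>{0..}. ennreal (6 * a) * ennreal (v 0 * (max 0 (1 - c * a)) ^ d) \<partial>lborel)"
    unfolding layer
  proof (rule nn_integral_mono)
    fix a
    have "v a \<le> v 0 * (max 0 (1 - c * a)) ^ d" if "a \<ge> 0"
      using truncated_subgraph_measure_le[OF A h that] by (simp add: v_def c_def d_def)
    then show "ennreal (6 * a) * ennreal (v a) * indicator {0..} a
        \<le> ennreal (6 * a) * ennreal (v 0 * (max 0 (1 - c * a)) ^ d) * indicator {0..} a"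
      by (auto simp: indicator_def intro!: mult_left_mono ennreal_leI)
  qed
  then have "(LINT s|lborel. g s ^ 3) \<le> 6 * v 0 / (c\<^sup>2 * (real d + 1) * (real d + 2))"
    unfolding beta using pos by (subst (asm) ennreal_le_iff) auto
  then show "(measure lborel A)\<^sup>2 * (LINT s:A|lborel. h s ^ 3)
    \<le> 6 * (real d)\<^sup>2 / ((real d + 1) * (real d + 2)) * (LINT s:A|lborel. h s) ^ 3"
    unfolding LI1 LI3 v0 rhs[symmetric] by (intro mult_left_mono) auto
  show "0 < (LINT s:A|lborel. h s ^ 3)"
  proof -
    have "(LINT s|lborel. g s ^ 3) \<noteq> 0"
    proof
      assume "(LINT s|lborel. g s ^ 3) = 0"
      then have "AE s in lborel. g s ^ 3 = 0"
        using integral_nonneg_eq_0_iff_AE[OF Ig3] g0 by simp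
      then have "AE s in lborel. g s = 0" by simp
      then have "integral\<^sup>L lborel g = 0" by (rule integral_eq_zero_AE)
      then show False using v0 v0pos by simp
    qed
    moreover have "(LINT s|lborel. g s ^ 3) \<ge> 0" using g0 by (intro integral_nonneg_AE) auto
    ultimately show ?thesis unfolding LI3 by linarith
  qed
  assume cone: "A = ball 0 1" "\<And>s. s \<in> A \<Longrightarrow> h s = 1 - norm s"
  have gcone: "g s = max 0 (1 - norm s)" for s
    using cone by (auto simp: g_def indicator_def)
  \<comment> \<open>The section of the cone at height \<open>t\<close> is a ball of radius
    \<open>1 - t\<close>, so the volume above level \<open>a\<close> is an integral of
    \<open>(1 - t) ^ DIM('a)\<close>. The factor \<open>1 * a\<close> shows the slope
    \<open>c = 1\<close>.\<close>
  have v_cone: "v a = measure lborel A / d * (max 0 (1 - 1 * a)) ^ d" if a: "a \<ge> 0" for a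
  proof -
    define \<omega> where "\<omega> = measure lborel A"
    have "ennreal (v a) = (\<integral>\<^sup>+s. ennreal (g s - a) \<partial>lborel)" using em[OF a] by simp
    also have "\<dots> = (\<integral>\<^sup>+s. \<integral>\<^sup>+t. indicator {t. a \<le> t \<and> t < g s} t \<partial>lborel \<partial>lborel)"
    proof (rule nn_integral_cong)
      fix s
      have "{t. a \<le> t \<and> t < g s} = {a..<g s}" by auto
      then show "ennreal (g s - a) = (\<integral>\<^sup>+t. indicator {t. a \<le> t \<and> t < g s} t \<partial>lborel)"
        by (cases "a \<le> g s") (auto simp: ennreal_neg)
    qed
    also have "\<dots> = (\<integral>\<^sup>+s. \<integral>\<^sup>+t. indicator {x. a \<le> snd x \<and> snd x < g (fst x)} (s, t) \<partial>lborel \<partial>lborel)"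
      by (simp add: indicator_def)
    also have "\<dots> = (\<integral>\<^sup>+t. \<integral>\<^sup>+s. indicator {x. a \<le> snd x \<and> snd x < g (fst x)} (s, t) \<partial>lborel \<partial>lborel)"
      by (rule lborel_pair.Fubini[symmetric]) measurable
    \<comment> \<open>The right end \<open>max 1 a\<close> keeps one formula for all levels: for
      \<open>a > 1\<close> the interval shrinks to a point at which the integrand is
      \<open>0\<close>.\<close>
    also have "\<dots> = (\<integral>\<^sup>+t. ennreal (\<omega> * (max 0 (1 - t)) ^ DIM('a)) * indicator {a..max 1 a} t \<partial>lborel)"
    proof (rule nn_integral_cong)
      fix t
      show "(\<integral>\<^sup>+s. indicator {x. a \<le> snd x \<and> snd x < g (fst x)} (s::'a, t) \<partial>lborel)
        = ennreal (\<omega> * (max 0 (1 - t)) ^ DIM('a)) * indicator {a..max 1 a} t"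
      proof (cases "a \<le> t")
        case True
        have "(\<integral>\<^sup>+s. indicator {x. a \<le> snd x \<and> snd x < g (fst x)} (s::'a, t) \<partial>lborel) = (\<integral>\<^sup>+s. indicator (ball (0::'a) (1 - t)) s \<partial>lborel)"
          using True a by (intro nn_integral_cong) (auto simp: indicator_def gcone)
        also have "\<dots> = emeasure lborel (ball (0::'a) (1 - t))" by simp
        also have "\<dots> = ennreal (measure lborel (ball (0::'a) (1 - t)))"
          using emeasure_lborel_ball_finite[of "0::'a" "1 - t"] by (simp add: emeasure_eq_ennreal_measure less_top)
        also have "measure lborel (ball (0::'a) (1 - t)) = \<omega> * (max 0 (1 - t)) ^ DIM('a)"
        proof (cases "t \<le> 1")
          case True
          then show ?thesis using content_ball_conv_unit_ball[of "1 - t" "0::'a"] cone(1)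
            by (simp add: \<omega>_def mult.commute)
        next
          case False
          then show ?thesis by (simp add: max_def zero_power)
        qed
        finally show ?thesis using True a by (auto simp: indicator_def max_def zero_power)
      qed (simp add: indicator_def)
    qed
    also have "\<dots> = ennreal (- \<omega> / d * (max 0 (1 - max 1 a)) ^ d - (- \<omega> / d * (max 0 (1 - a)) ^ d))"
    proof (cases "a \<le> 1")
      case True
      have "(\<integral>\<^sup>+t. ennreal (\<omega> * (max 0 (1 - t)) ^ DIM('a)) * indicator {a..max 1 a} t \<partial>lborel)
        = (\<integral>\<^sup>+t. ennreal (\<omega> * (1 - t) ^ DIM('a)) * indicator {a..1} t \<partial>lborel)"
        using True by (intro nn_integral_cong) (auto simp: indicator_def max_def)
      also have "\<dots> = ennreal (- \<omega> / d * (1 - 1) ^ d - (- \<omega> / d * (1 - a) ^ d))"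
      proof (rule nn_integral_FTC_Icc)
        fix t :: real assume t: "t \<in> {a..1}"
        have "((\<lambda>t. (1 - t) ^ d) has_real_derivative real d * (1 - t) ^ (d - 1) * (- 1)) (at t)"
          by (auto intro!: derivative_eq_intros)
        from DERIV_cmult[OF this, of "- \<omega> / d"]
        show "((\<lambda>t. - \<omega> / d * (1 - t) ^ d) has_real_derivative \<omega> * (1 - t) ^ DIM('a)) (at t)"
          by (rule DERIV_cong) (simp add: d_def)
        show "0 \<le> \<omega> * (1 - t) ^ DIM('a)" using t by (simp add: \<omega>_def)
      qed (use True in auto)
      finally show ?thesis using True by (simp add: max_def)
    next
      case False
      then have "(\<integral>\<^sup>+t. ennreal (\<omega> * (max 0 (1 - t)) ^ DIM('a)) * indicator {a..max 1 a} t \<partial>lborel) = (\<integral>\<^sup>+t. 0 \<partial>(lborel::real measure))"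
        by (intro nn_integral_cong) (auto simp: indicator_def max_def zero_power)
      then show ?thesis using False by (simp add: max_def)
    qed
    also have "\<dots> = ennreal (\<omega> / d * (max 0 (1 - a)) ^ d)"
      using dpos by (simp add: max_def zero_power)
    finally show ?thesis
      by (subst (asm) ennreal_inj) (auto simp: v_def \<omega>_def)
  qed
  have v0c: "v 0 = measure lborel A / d" using v_cone[of 0] by simp
  then have c1: "c = 1" using mA dpos by (simp add: c_def)
  have "ennreal (LINT s|lborel. g s ^ 3) = (\<integral>\<^sup>+a\<in>{0..}. ennreal (6 * a) * ennreal (v 0 * (max 0 (1 - c * a)) ^ d) \<partial>lborel)"
    unfolding layer by (intro nn_integral_cong) (simp add: indicator_def v_cone v0c c1)
  then have "(LINT s|lborel. g s ^ 3) = 6 * v 0 / (c\<^sup>2 * (real d + 1) * (real d + 2))"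
    unfolding beta using pos by (subst (asm) ennreal_inj) (auto intro!: integral_nonneg_AE simp: g0)
  then show "(measure lborel A)\<^sup>2 * (LINT s:A|lborel. h s ^ 3)
    = 6 * (real d)\<^sup>2 / ((real d + 1) * (real d + 2)) * (LINT s:A|lborel. h s) ^ 3"
    unfolding LI1 LI3 v0 rhs[symmetric] by simp
qed

section \<open>Integration over lines and the perimeter\<close>

lemma integrable_bounded_support:
  fixes f :: "'a::euclidean_space \<Rightarrow> 'b::{banach, second_countable_topology}"
  assumes "f \<in> borel_measurable borel" "\<And>x. norm (f x) \<le> B" "\<And>x. norm x > R \<Longrightarrow> f x = 0"
  shows "integrable lborel f"
proof (rule Bochner_Integration.integrable_bound[where f="\<lambda>x. indicator (cball 0 R) x * B"])
  show "integrable lborel (\<lambda>x. indicator (cball (0::'a) R) x * B)"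
    using emeasure_lborel_cball_finite[of "0::'a" R] by (simp add: integrable_indicator_iff)
  show "AE x in lborel. norm (f x) \<le> norm (indicator (cball 0 R) x * B)"
  proof (rule AE_I2)
    fix x
    have "0 \<le> B" using assms(2)[of 0] norm_ge_zero order_trans by blast
    then show "norm (f x) \<le> norm (indicator (cball 0 R) x * B)"
      using assms(2,3)[of x] by (cases "norm x > R") auto
  qed
qed (use assms(1) in simp)

lemma integral_translate:
  fixes f :: "'a::euclidean_space \<Rightarrow> 'b::euclidean_space"
  assumes [measurable]: "f \<in> borel_measurable borel"
  shows "(LINT x|lborel. f (c + x)) = (LINT x|lborel. f x)"
proof -
  have "(LINT x|lborel. f x) = (LINT x|distr lborel borel ((+) c). f x)" by (simp only: lborel_distr_plus)
  also have "\<dots> = (LINT x|lborel. f (c + x))" by (rule integral_distr) auto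
  finally show ?thesis by simp
qed

text \<open>Integration over the lines parallel to \<open>b\<close>, each of them parametrised from its points in the slab
  \<open>0 \<le> y \<bullet> b \<le> 1\<close>: the average over these base points replaces a choice of a complement of \<open>b\<close>.\<close>

lemma integral_over_lines:
  fixes F :: "'a::euclidean_space \<Rightarrow> real"
  assumes [measurable]: "F \<in> borel_measurable borel" and B: "\<And>x. \<bar>F x\<bar> \<le> B" and R: "\<And>x. norm x > R \<Longrightarrow> F x = 0"
    and b: "norm b = 1"
  shows "(LINT x|lborel. F x) = (LINT y|lborel. indicator {y. 0 \<le> y \<bullet> b \<and> y \<bullet> b \<le> 1} y * (LINT \<tau>|lborel. F (y + \<tau> *\<^sub>R b)))"
    and "integrable lborel (\<lambda>y. indicator {y. 0 \<le> y \<bullet> b \<and> y \<bullet> b \<le> 1} y * (LINT \<tau>|lborel. F (y + \<tau> *\<^sub>R b)))"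
proof -
  \<comment> \<open>The weight of the slab. Every line parallel to \<open>b\<close> meets the slab
    in a segment of length 1, so \<open>W (x - \<tau> *\<^sub>R b)\<close> integrates to 1 over
    \<open>\<tau>\<close> and inserting it changes nothing; Fubini and a translation then move the
    weight to the base point.\<close>
  define W :: "'a \<Rightarrow> real" where "W y = indicator {y. 0 \<le> y \<bullet> b \<and> y \<bullet> b \<le> 1} y" for y
  have [measurable]: "W \<in> borel_measurable borel"
    unfolding W_def by measurable
  have bb: "b \<bullet> b = 1" using b by (simp add: dot_square_norm)
  have W01: "\<bar>W y\<bar> \<le> 1" for y by (auto simp: W_def indicator_def)
  have B0: "B \<ge> 0" using B[of 0] by linarith
  have bnd: "\<bar>W x * F y\<bar> \<le> B" for x y
    using mult_mono[OF W01[of x] B[of y]] by (simp add: abs_mult)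
  have nb: "\<bar>y \<bullet> b\<bar> \<le> norm y" for y using Cauchy_Schwarz_ineq2[of y b] b by simp
  let ?H = "\<lambda>z::'a \<times> real. W (fst z - snd z *\<^sub>R b) * F (fst z)"
  let ?G = "\<lambda>z::'a \<times> real. W (fst z) * F (fst z + snd z *\<^sub>R b)"
  have meas: "?H \<in> borel_measurable borel" "?G \<in> borel_measurable borel"
    unfolding borel_prod[symmetric] by measurable
  have "integrable lborel ?H"
  proof (rule integrable_bounded_support[where B=B and R="\<bar>R\<bar> + (\<bar>R\<bar> + 1)"])
    fix z :: "'a \<times> real"
    obtain x \<tau> where z: "z = (x, \<tau>)" by (cases z)
    show "?H z = 0" if "norm z > \<bar>R\<bar> + (\<bar>R\<bar> + 1)"
    proof (rule ccontr)
      assume "?H z \<noteq> 0"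
      then have "norm x \<le> R" "0 \<le> (x - \<tau> *\<^sub>R b) \<bullet> b" "(x - \<tau> *\<^sub>R b) \<bullet> b \<le> 1"
        using R[of x] by (auto simp: z W_def indicator_def not_less split: if_splits intro: leI)
      then have "norm x \<le> \<bar>R\<bar>" "\<bar>\<tau>\<bar> \<le> \<bar>R\<bar> + 1" using nb[of x] by (auto simp: inner_diff_left bb)
      then show False using that norm_Pair_le[of x \<tau>] by (simp add: z)
    qed
  qed (use bnd meas in auto)
  then have iH: "integrable (lborel \<Otimes>\<^sub>M lborel) (\<lambda>(x, \<tau>). W (x - \<tau> *\<^sub>R b) * F x)"
    unfolding lborel_prod by (simp add: case_prod_unfold)
  have "integrable lborel ?G"
  proof (rule integrable_bounded_support[where B=B and R="(2 * \<bar>R\<bar> + 1) + (\<bar>R\<bar> + 1)"])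
    fix z :: "'a \<times> real"
    obtain x \<tau> where z: "z = (x, \<tau>)" by (cases z)
    show "?G z = 0" if "norm z > (2 * \<bar>R\<bar> + 1) + (\<bar>R\<bar> + 1)"
    proof (rule ccontr)
      assume "?G z \<noteq> 0"
      then have *: "norm (x + \<tau> *\<^sub>R b) \<le> R" "0 \<le> x \<bullet> b" "x \<bullet> b \<le> 1"
        using R[of "x + \<tau> *\<^sub>R b"] by (auto simp: z W_def indicator_def not_less split: if_splits intro: leI)
      then have \<tau>: "\<bar>\<tau>\<bar> \<le> \<bar>R\<bar> + 1" using nb[of "x + \<tau> *\<^sub>R b"] by (auto simp: inner_add_left bb)
      have "norm x \<le> norm (x + \<tau> *\<^sub>R b) + norm (\<tau> *\<^sub>R b)"
        using norm_triangle_ineq4[of "x + \<tau> *\<^sub>R b" "\<tau> *\<^sub>R b"] by simp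
      then have "norm x \<le> 2 * \<bar>R\<bar> + 1" using * \<tau> b by simp
      then show False using that \<tau> norm_Pair_le[of x \<tau>] by (simp add: z)
    qed
  qed (use bnd meas in auto)
  then have iG: "integrable (lborel \<Otimes>\<^sub>M lborel) (\<lambda>(x, \<tau>). W x * F (x + \<tau> *\<^sub>R b))"
    unfolding lborel_prod by (simp add: case_prod_unfold)
  have "(LINT \<tau>|lborel. W (x - \<tau> *\<^sub>R b)) = 1" for x
  proof -
    have "(LINT \<tau>|lborel. W (x - \<tau> *\<^sub>R b)) = (LINT \<tau>|lborel. indicator {x \<bullet> b - 1..x \<bullet> b} \<tau>)"
      by (intro Bochner_Integration.integral_cong) (auto simp: W_def indicator_def inner_diff_left bb)
    then show ?thesis by simp
  qed
  then have "(LINT x|lborel. F x) = (LINT x|lborel. LINT \<tau>|lborel. W (x - \<tau> *\<^sub>R b) * F x)"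
    by simp
  also have "\<dots> = (LINT \<tau>|lborel. LINT x|lborel. W (x - \<tau> *\<^sub>R b) * F x)"
    by (rule lborel_pair.Fubini_integral[OF iH, symmetric])
  also have "\<dots> = (LINT \<tau>|lborel. LINT x|lborel. W x * F (x + \<tau> *\<^sub>R b))"
  proof (rule Bochner_Integration.integral_cong)
    fix \<tau> :: real
    have "(LINT x|lborel. W (x - \<tau> *\<^sub>R b) * F x) = (LINT x|lborel. W (\<tau> *\<^sub>R b + x - \<tau> *\<^sub>R b) * F (\<tau> *\<^sub>R b + x))"
      by (rule integral_translate[symmetric, of "\<lambda>x. W (x - \<tau> *\<^sub>R b) * F x"]) measurable
    then show "(LINT x|lborel. W (x - \<tau> *\<^sub>R b) * F x) = (LINT x|lborel. W x * F (x + \<tau> *\<^sub>R b))"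
      by (simp add: add.commute)
  qed simp
  also have "\<dots> = (LINT x|lborel. LINT \<tau>|lborel. W x * F (x + \<tau> *\<^sub>R b))"
    by (rule lborel_pair.Fubini_integral[OF iG])
  finally show "(LINT x|lborel. F x) = (LINT y|lborel. indicator {y. 0 \<le> y \<bullet> b \<and> y \<bullet> b \<le> 1} y * (LINT \<tau>|lborel. F (y + \<tau> *\<^sub>R b)))"
    by (simp add: W_def)
  show "integrable lborel (\<lambda>y. indicator {y. 0 \<le> y \<bullet> b \<and> y \<bullet> b \<le> 1} y * (LINT \<tau>|lborel. F (y + \<tau> *\<^sub>R b)))"
    using lborel_pair.integrable_fst[OF iG] by (simp add: W_def)
qed

section \<open>Compact supports and derivatives along lines\<close>

lemma supp_eq_0: "x \<notin> supp f \<Longrightarrow> f x = 0"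
  using closure_subset[of "{x. f x \<noteq> 0}"] by (auto simp: supp_def)

lemma supp_subset_closed: "closed K \<Longrightarrow> (\<And>x. x \<notin> K \<Longrightarrow> f x = 0) \<Longrightarrow> supp f \<subseteq> K"
  unfolding supp_def by (rule closure_minimal) auto

lemma frechet_derivative_outside_supp:
  assumes "x \<notin> supp f"
  shows "frechet_derivative f (at x) v = 0"
proof -
  have o: "open (- supp f)" by (simp add: supp_def open_Compl)
  have "((\<lambda>_. 0) has_derivative (\<lambda>_. 0)) (at x)" by simp
  then have "(f has_derivative (\<lambda>_. 0)) (at x)"
    by (rule has_derivative_transform_within_open[OF _ o]) (use assms supp_eq_0 in force)+
  then show ?thesis using frechet_derivative_at by metis
qed

lemma bounded_continuous_compact_support:
  fixes f :: "'a::euclidean_space \<Rightarrow> 'b::real_normed_vector"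
  assumes "continuous_on UNIV f" "compact K" "\<And>x. x \<notin> K \<Longrightarrow> f x = 0"
  obtains B where "\<And>x. norm (f x) \<le> B" "B \<ge> 0"
proof -
  have "compact (f ` K)" using assms by (intro compact_continuous_image) (auto intro: continuous_on_subset)
  then obtain B where B: "\<And>y. y \<in> f ` K \<Longrightarrow> norm y \<le> B" by (meson bounded_iff compact_imp_bounded)
  show thesis
  proof
    show "norm (f x) \<le> max 0 B" for x using B[of "f x"] assms(3)[of x] by (cases "x \<in> K") auto
  qed simp
qed

lemma integrable_continuous_compact_support:
  fixes f :: "'a::euclidean_space \<Rightarrow> 'b::{banach, second_countable_topology}"
  assumes "continuous_on UNIV f" "compact K" "\<And>x. x \<notin> K \<Longrightarrow> f x = 0"
  shows "integrable lborel f"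
proof -
  obtain B where B: "\<And>x. norm (f x) \<le> B" using bounded_continuous_compact_support[OF assms] by blast
  obtain R where R: "\<And>x. x \<in> K \<Longrightarrow> norm x \<le> R" using assms(2) by (meson bounded_iff compact_imp_bounded)
  show ?thesis
    by (rule integrable_bounded_support[where B=B and R=R])
      (use assms B R in \<open>auto intro!: borel_measurable_continuous_onI simp: not_le[symmetric]\<close>)
qed

lemma C_k_along_line:
  fixes f :: "'a::euclidean_space \<Rightarrow> real"
  assumes "C_k 1 f"
  shows "((\<lambda>\<tau>. f (y + \<tau> *\<^sub>R b)) has_vector_derivative frechet_derivative f (at (y + \<tau> *\<^sub>R b)) b) (at \<tau> within S)"
proof -
  have 1: "((\<lambda>\<tau>. y + \<tau> *\<^sub>R b) has_derivative (\<lambda>h. h *\<^sub>R b)) (at \<tau> within S)"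
    by (auto intro!: derivative_eq_intros)
  have 2: "(f has_derivative frechet_derivative f (at (y + \<tau> *\<^sub>R b))) (at (y + \<tau> *\<^sub>R b))"
    using assms C_k_has_derivative[of 0] by simp
  have "((\<lambda>\<tau>. f (y + \<tau> *\<^sub>R b)) has_derivative (\<lambda>h. frechet_derivative f (at (y + \<tau> *\<^sub>R b)) (h *\<^sub>R b))) (at \<tau> within S)"
    by (rule has_derivative_compose[OF 1 2])
  moreover have "frechet_derivative f (at (y + \<tau> *\<^sub>R b)) (h *\<^sub>R b) = h *\<^sub>R frechet_derivative f (at (y + \<tau> *\<^sub>R b)) b" for h
    using has_derivative_bounded_linear[OF 2] by (simp add: bounded_linear.linear linear_cmul)
  ultimately show ?thesis by (simp add: has_vector_derivative_def)
qed

lemma C_k_1_frechet_continuous: "C_k 1 f \<Longrightarrow> continuous_on S (\<lambda>x. frechet_derivative f (at x) v)"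
  by (auto intro: continuous_on_subset)

lemma open_bounded_interval_real:
  fixes I :: "real set"
  assumes "open I" "bounded I" "convex I" "I \<noteq> {}"
  obtains \<alpha> \<beta> where "\<alpha> < \<beta>" "I = {\<alpha><..<\<beta>}"
proof
  have bb: "bdd_above I" "bdd_below I" using assms(2) by (auto intro: bounded_imp_bdd_above bounded_imp_bdd_below)
  show eq: "I = {Inf I<..<Sup I}"
  proof (intro equalityI subsetI)
    fix x assume x: "x \<in> I"
    obtain e where e: "e > 0" "cball x e \<subseteq> I" using assms(1) x open_contains_cball by blast
    then have "x + e \<in> I" "x - e \<in> I" by (auto simp: dist_real_def subset_iff)
    then have "x + e \<le> Sup I" "Inf I \<le> x - e" using bb by (auto intro: cSup_upper cInf_lower)
    then show "x \<in> {Inf I<..<Sup I}" using e by auto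
  next
    fix x assume "x \<in> {Inf I<..<Sup I}"
    then obtain y z where "y \<in> I" "z \<in> I" "y < x" "x < z"
      using bb assms(4) by (auto simp: less_cSup_iff cInf_less_iff)
    then show "x \<in> I" using assms(3)
      by (meson convex_contains_segment closed_segment_eq_real_ivl atLeastAtMost_iff less_imp_le is_interval_convex_1 mem_is_interval_1_I)
  qed
  then show "Inf I < Sup I" using assms(4) by (metis greaterThanLessThan_empty_iff not_le)
qed

text \<open>By convexity a line meets \<open>\<Omega>\<close> in an open interval, so the
  fundamental theorem of calculus leaves only the values of \<open>f\<close> at its two ends, which
  differ by at most 2.\<close>

lemma integral_line_derivative_convex_le:
  fixes f :: "'a::euclidean_space \<Rightarrow> real"
  assumes f: "C_k 1 f" "\<And>x. \<bar>f x\<bar> \<le> 1" and \<Omega>: "open \<Omega>" "convex \<Omega>" "bounded \<Omega>" and b: "norm b = 1"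
  shows "(LINT \<tau>|lborel. indicator \<Omega> (y + \<tau> *\<^sub>R b) * frechet_derivative f (at (y + \<tau> *\<^sub>R b)) b)
    \<le> 2 * (if \<exists>\<tau>. y + \<tau> *\<^sub>R b \<in> \<Omega> then 1 else 0)"
proof -
  define I where "I = {\<tau>. y + \<tau> *\<^sub>R b \<in> \<Omega>}"
  let ?u' = "\<lambda>\<tau>. frechet_derivative f (at (y + \<tau> *\<^sub>R b)) b"
  show ?thesis
  proof (cases "I = {}")
    case True
    then have "indicator \<Omega> (y + \<tau> *\<^sub>R b) = (0::real)" "y + \<tau> *\<^sub>R b \<notin> \<Omega>" for \<tau> by (auto simp: I_def)
    then show ?thesis by simp
  next
    case False
    have lin: "continuous_on UNIV (\<lambda>\<tau>. y + \<tau> *\<^sub>R b)" by (intro continuous_intros)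
    have I_eq: "I = (\<lambda>\<tau>. y + \<tau> *\<^sub>R b) -` \<Omega>" by (auto simp: I_def)
    have "open I" unfolding I_eq using \<Omega>(1) lin by (rule open_vimage)
    moreover have "convex I"
      unfolding convex_alt
    proof (intro ballI allI impI)
      fix s t u :: real assume st: "s \<in> I" "t \<in> I" and u: "0 \<le> u \<and> u \<le> 1"
      have "y + ((1 - u) *\<^sub>R s + u *\<^sub>R t) *\<^sub>R b = (1 - u) *\<^sub>R (y + s *\<^sub>R b) + u *\<^sub>R (y + t *\<^sub>R b)"
        by (simp add: algebra_simps)
      also have "\<dots> \<in> \<Omega>" using \<Omega>(2) st u by (auto simp: I_def convex_alt)
      finally show "(1 - u) *\<^sub>R s + u *\<^sub>R t \<in> I" by (simp add: I_def)
    qed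
    moreover have "bounded I"
    proof -
      obtain R where R: "\<And>x. x \<in> \<Omega> \<Longrightarrow> norm x \<le> R" using \<Omega>(3) by (meson bounded_iff)
      have "norm \<tau> \<le> R + norm y" if "\<tau> \<in> I" for \<tau>
      proof -
        have "norm (\<tau> *\<^sub>R b) \<le> norm (y + \<tau> *\<^sub>R b) + norm y"
          using norm_triangle_ineq4[of "y + \<tau> *\<^sub>R b" y] by simp
        then show ?thesis using R[of "y + \<tau> *\<^sub>R b"] that b by (simp add: I_def)
      qed
      then show ?thesis by (meson boundedI)
    qed
    ultimately obtain \<alpha> \<beta> where ab: "\<alpha> < \<beta>" "I = {\<alpha><..<\<beta>}"
      using open_bounded_interval_real False by metis
    have contu: "continuous_on {\<alpha>..\<beta>} ?u'"
      by (rule continuous_on_compose2[OF C_k_1_frechet_continuous[OF f(1), of UNIV b]])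
        (auto intro!: continuous_intros)
    have "(LINT \<tau>|lborel. indicator \<Omega> (y + \<tau> *\<^sub>R b) * ?u' \<tau>) = (LINT \<tau>|lborel. indicator {\<alpha>..\<beta>} \<tau> *\<^sub>R ?u' \<tau>)"
    proof (rule integral_cong_AE)
      have cU: "continuous_on UNIV ?u'"
        by (rule continuous_on_compose2[OF C_k_1_frechet_continuous[OF f(1), of UNIV b] lin]) auto
      have [measurable]: "?u' \<in> borel_measurable borel" by (rule borel_measurable_continuous_onI[OF cU])
      have "(\<lambda>\<tau>. indicator \<Omega> (y + \<tau> *\<^sub>R b) * ?u' \<tau>) = (\<lambda>\<tau>. indicator I \<tau> * ?u' \<tau>)"
        by (auto simp: I_def indicator_def)
      then show "(\<lambda>\<tau>. indicator \<Omega> (y + \<tau> *\<^sub>R b) * ?u' \<tau>) \<in> borel_measurable lborel"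
        using \<open>open I\<close> by (simp add: borel_open)
      show "(\<lambda>\<tau>. indicator {\<alpha>..\<beta>} \<tau> *\<^sub>R ?u' \<tau>) \<in> borel_measurable lborel" by measurable
      have "AE \<tau> in lborel. \<tau> \<noteq> \<alpha>" "AE \<tau> in lborel. \<tau> \<noteq> \<beta>" by (auto intro: AE_lborel_singleton)
      then show "AE \<tau> in lborel. indicator \<Omega> (y + \<tau> *\<^sub>R b) * ?u' \<tau> = indicator {\<alpha>..\<beta>} \<tau> *\<^sub>R ?u' \<tau>"
      proof eventually_elim
        case (elim \<tau>)
        have "y + \<tau> *\<^sub>R b \<in> \<Omega> \<longleftrightarrow> \<tau> \<in> {\<alpha><..<\<beta>}" using ab(2) by (auto simp: I_def)
        then show ?case using elim by (auto simp: indicator_def)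
      qed
    qed
    also have "\<dots> = f (y + \<beta> *\<^sub>R b) - f (y + \<alpha> *\<^sub>R b)"
      by (rule integral_FTC_Icc[OF _ _ contu]) (use ab C_k_along_line[OF f(1)] in auto)
    also have "\<dots> \<le> 2" using f(2)[of "y + \<beta> *\<^sub>R b"] f(2)[of "y + \<alpha> *\<^sub>R b"] by linarith
    finally show ?thesis using False by (auto simp: I_def)
  qed
qed

lemma integral_line_derivative_eq_0:
  fixes f :: "'a::euclidean_space \<Rightarrow> real"
  assumes f: "C_k 1 f" "compact (supp f)" and b: "norm b = 1"
  shows "(LINT \<tau>|lborel. frechet_derivative f (at (y + \<tau> *\<^sub>R b)) b) = 0"
proof -
  obtain R where R: "\<And>x. x \<in> supp f \<Longrightarrow> norm x \<le> R" using f(2) by (meson bounded_iff compact_imp_bounded)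
  define r where "r = \<bar>R\<bar> + norm y + 1"
  have out: "y + \<tau> *\<^sub>R b \<notin> supp f" if "\<bar>\<tau>\<bar> \<ge> r" for \<tau>
  proof
    assume "y + \<tau> *\<^sub>R b \<in> supp f"
    then have "norm (y + \<tau> *\<^sub>R b) \<le> R" by (rule R)
    moreover have "norm (\<tau> *\<^sub>R b) \<le> norm (y + \<tau> *\<^sub>R b) + norm y"
      using norm_triangle_ineq4[of "y + \<tau> *\<^sub>R b" y] by simp
    ultimately show False using that b by (simp add: r_def)
  qed
  let ?u' = "\<lambda>\<tau>. frechet_derivative f (at (y + \<tau> *\<^sub>R b)) b"
  have r: "r > 0" by (simp add: r_def add_nonneg_pos)
  have contu: "continuous_on {-r..r} ?u'"
    by (rule continuous_on_compose2[OF C_k_1_frechet_continuous[OF f(1), of UNIV b]])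
      (auto intro!: continuous_intros)
  have "(LINT \<tau>|lborel. ?u' \<tau>) = (LINT \<tau>|lborel. indicator {-r..r} \<tau> *\<^sub>R ?u' \<tau>)"
  proof (rule Bochner_Integration.integral_cong)
    fix \<tau>
    show "?u' \<tau> = indicator {-r..r} \<tau> *\<^sub>R ?u' \<tau>"
      using frechet_derivative_outside_supp[OF out[of \<tau>], of b] by (cases "\<bar>\<tau>\<bar> \<ge> r") (auto simp: indicator_def)
  qed simp
  also have "\<dots> = f (y + r *\<^sub>R b) - f (y + (-r) *\<^sub>R b)"
    by (rule integral_FTC_Icc[OF _ _ contu]) (use r C_k_along_line[OF f(1)] in auto)
  also have "\<dots> = 0" using out[of r] out[of "-r"] r by (simp add: supp_eq_0)
  finally show ?thesis .
qed

lemma integral_directional_derivative_eq_0: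
  fixes f :: "'a::euclidean_space \<Rightarrow> real"
  assumes f: "C_k 1 f" "compact (supp f)" and b: "norm b = 1"
  shows "(LINT x|lborel. frechet_derivative f (at x) b) = 0"
proof -
  have cont: "continuous_on UNIV (\<lambda>x. frechet_derivative f (at x) b)" using C_k_1_frechet_continuous[OF f(1)] .
  obtain B where B: "\<And>x. norm (frechet_derivative f (at x) b) \<le> B"
    using bounded_continuous_compact_support[OF cont f(2) frechet_derivative_outside_supp] by blast
  obtain R where R: "\<And>x. x \<in> supp f \<Longrightarrow> norm x \<le> R" using f(2) by (meson bounded_iff compact_imp_bounded)
  show ?thesis
    by (subst integral_over_lines(1)[OF borel_measurable_continuous_onI[OF cont], of B R b])
      (use B R b integral_line_derivative_eq_0[OF f b] frechet_derivative_outside_supp in \<open>force simp: not_le[symmetric]\<close>)+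
qed

text \<open>\<open>S\<close> stands for the shadow of \<open>\<Omega>\<close> along
  \<open>b\<close>: it contains the base points, within the unit slab, of all lines that meet
  \<open>\<Omega>\<close>. As the slab has thickness 1, the volume of an exact shadow equals its
  area, and each line contributes at most 2.\<close>

lemma integral_derivative_convex_le:
  fixes f :: "'a::euclidean_space \<Rightarrow> real"
  assumes f: "C_k 1 f" "\<And>x. \<bar>f x\<bar> \<le> 1" "compact (supp f)"
    and \<Omega>: "open \<Omega>" "convex \<Omega>" "bounded \<Omega>" and b: "norm b = 1"
    and S: "S \<in> fmeasurable lborel" "\<And>y \<tau>. 0 \<le> y \<bullet> b \<Longrightarrow> y \<bullet> b \<le> 1 \<Longrightarrow> y + \<tau> *\<^sub>R b \<in> \<Omega> \<Longrightarrow> y \<in> S"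
  shows "(LINT x:\<Omega>|lborel. frechet_derivative f (at x) b) \<le> 2 * measure lborel S"
proof -
  let ?f' = "\<lambda>x. frechet_derivative f (at x) b"
  let ?F = "\<lambda>x. indicator \<Omega> x * ?f' x"
  have cont: "continuous_on UNIV ?f'" using C_k_1_frechet_continuous[OF f(1)] .
  have [measurable]: "\<Omega> \<in> sets borel" using \<Omega>(1) by (rule borel_open)
  have [measurable]: "?f' \<in> borel_measurable borel" by (rule borel_measurable_continuous_onI[OF cont])
  obtain B where B: "\<And>x. norm (?f' x) \<le> B" "B \<ge> 0"
    using bounded_continuous_compact_support[OF cont f(3) frechet_derivative_outside_supp] by blast
  obtain R where R: "\<And>x. x \<in> \<Omega> \<Longrightarrow> norm x \<le> R" using \<Omega>(3) by (meson bounded_iff)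
  have meas: "?F \<in> borel_measurable borel" by measurable
  have bnd: "\<bar>?F x\<bar> \<le> B" for x using B by (auto simp: indicator_def)
  have R': "norm x > R \<Longrightarrow> ?F x = 0" for x using R[of x] by (auto simp: indicator_def)
  note lines = integral_over_lines[OF meas bnd R' b]
  have "(LINT x:\<Omega>|lborel. ?f' x) = (LINT x|lborel. ?F x)" by (simp add: set_lebesgue_integral_def)
  also have "\<dots> = (LINT y|lborel. indicator {y. 0 \<le> y \<bullet> b \<and> y \<bullet> b \<le> 1} y * (LINT \<tau>|lborel. ?F (y + \<tau> *\<^sub>R b)))"
    by (rule lines(1))
  also have "\<dots> \<le> (LINT y|lborel. 2 * indicator S y)"
  proof (rule integral_mono[OF lines(2)])
    show "integrable lborel (\<lambda>y. 2 * indicator S y :: real)"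
      using S(1) by (simp add: integrable_indicator_iff fmeasurable_def)
    fix y
    show "indicator {y. 0 \<le> y \<bullet> b \<and> y \<bullet> b \<le> 1} y * (LINT \<tau>|lborel. ?F (y + \<tau> *\<^sub>R b)) \<le> 2 * indicator S y"
    proof (cases "0 \<le> y \<bullet> b \<and> y \<bullet> b \<le> 1")
      case True
      have "(LINT \<tau>|lborel. ?F (y + \<tau> *\<^sub>R b)) \<le> 2 * (if \<exists>\<tau>. y + \<tau> *\<^sub>R b \<in> \<Omega> then 1 else 0)"
        by (rule integral_line_derivative_convex_le[OF f(1,2) \<Omega> b])
      also have "\<dots> \<le> 2 * indicator S y" using S(2) True by (auto simp: indicator_def)
      finally show ?thesis using True by simp
    qed simp
  qed
  also have "\<dots> = 2 * measure lborel S" using S(1) by (simp add: fmeasurable_def)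
  finally show ?thesis .
qed


section \<open>Upper bound for the perimeter of a thin domain\<close>

lemma convex_thin_domain:
  assumes "convex_on A f" "concave_on A g" "0 \<le> \<epsilon>"
  shows "convex (thin_domain A f g \<epsilon>)"
  unfolding convex_alt
proof (intro ballI allI impI)
  fix x y u assume xy: "x \<in> thin_domain A f g \<epsilon>" "y \<in> thin_domain A f g \<epsilon>" and u: "0 \<le> u \<and> u \<le> (1::real)"
  obtain s t s' t' where x: "x = (s, t)" and y: "y = (s', t')" by (cases x, cases y)
  have A: "s \<in> A" "s' \<in> A" using xy by (auto simp: x y)
  have f: "\<epsilon> * f ((1 - u) *\<^sub>R s + u *\<^sub>R s') \<le> (1 - u) * (\<epsilon> * f s) + u * (\<epsilon> * f s')"
    using mult_left_mono[OF convex_onD[OF assms(1), of u s s'] assms(3)] u A by (simp add: algebra_simps)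
  have g: "(1 - u) * (\<epsilon> * g s) + u * (\<epsilon> * g s') \<le> \<epsilon> * g ((1 - u) *\<^sub>R s + u *\<^sub>R s')"
    using mult_left_mono[OF concave_onD[OF assms(2), of u s s'] assms(3)] u A by (simp add: algebra_simps)
  \<comment> \<open>Strictness must survive at \<open>u = 0\<close> and \<open>u = 1\<close>, where
    one of the two inequalities gets weight zero.\<close>
  have comb: "(1 - u) * a + u * b < (1 - u) * a' + u * b'" if "a < a'" "b < b'" for a b a' b' :: real
  proof (cases "u = 0")
    case False
    then have "(1 - u) * a \<le> (1 - u) * a'" "u * b < u * b'"
      using that u by (auto intro: mult_left_mono)
    then show ?thesis by linarith
  qed (use that in simp)
  have "(1 - u) *\<^sub>R s + u *\<^sub>R s' \<in> A"
    using convex_on_imp_convex[OF assms(1)] A u by (simp add: convex_alt)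
  moreover have "(1 - u) * (\<epsilon> * f s) + u * (\<epsilon> * f s') < (1 - u) * t + u * t'"
    "(1 - u) * t + u * t' < (1 - u) * (\<epsilon> * g s) + u * (\<epsilon> * g s')"
    using xy by (auto simp: x y intro!: comb)
  ultimately show "(1 - u) *\<^sub>R x + u *\<^sub>R y \<in> thin_domain A f g \<epsilon>"
    using f g by (simp add: x y)
qed

lemma frechet_derivative_inner:
  assumes "C_k 1 \<phi>"
  shows "frechet_derivative (\<lambda>x. \<phi> x \<bullet> c) (at x) v = frechet_derivative \<phi> (at x) v \<bullet> c"
proof -
  have "(\<phi> has_derivative frechet_derivative \<phi> (at x)) (at x)"
    using assms C_k_has_derivative[of 0] by simp
  then have "((\<lambda>x. \<phi> x \<bullet> c) has_derivative (\<lambda>v. frechet_derivative \<phi> (at x) v \<bullet> c)) (at x)"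
    by (rule has_derivative_inner_left)
  then show ?thesis using frechet_derivative_at by metis
qed

lemma compact_supp_mono:
  assumes "compact (supp f)" "\<And>x. f x = 0 \<Longrightarrow> g x = 0"
  shows "compact (supp g)" "supp g \<subseteq> supp f"
proof -
  show sub: "supp g \<subseteq> supp f" unfolding supp_def by (rule closure_mono) (use assms(2) in auto)
  show "compact (supp g)"
  proof -
    have "supp g = supp f \<inter> supp g" using sub by blast
    then show ?thesis using compact_Int_closed[OF assms(1), of "supp g"] by (simp add: supp_def)
  qed
qed

text \<open>Each component of a field of norm at most 1 is bounded by 1, so the divergence can be
  treated one axis at a time. Twice the sum of all coordinate shadows is a crude bound in general,
  but it is sharp to leading order for thin domains, where only the vertical shadow stays
  large.\<close>

lemma integral_divergence_convex_le:
  fixes \<phi> :: "'a::euclidean_space \<Rightarrow> 'a"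
  assumes \<phi>: "C_k 1 \<phi>" "compact (supp \<phi>)" "\<And>x. norm (\<phi> x) \<le> 1"
    and \<Omega>: "open \<Omega>" "convex \<Omega>" "bounded \<Omega>"
    and S: "\<And>b. b \<in> Basis \<Longrightarrow> S b \<in> fmeasurable lborel"
      "\<And>b y \<tau>. b \<in> Basis \<Longrightarrow> 0 \<le> y \<bullet> b \<Longrightarrow> y \<bullet> b \<le> 1 \<Longrightarrow> y + \<tau> *\<^sub>R b \<in> \<Omega> \<Longrightarrow> y \<in> S b"
  shows "(LINT x:\<Omega>|lborel. divergence \<phi> x) \<le> (\<Sum>b\<in>Basis. 2 * measure lborel (S b))"
proof -
  have C1: "C_k 1 (\<lambda>x. \<phi> x \<bullet> b)" for b
    by (rule C_k_linear_left[OF bounded_linear_inner_left \<phi>(1)])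
  have cs: "compact (supp (\<lambda>x. \<phi> x \<bullet> b))" for b
    by (rule compact_supp_mono(1)[OF \<phi>(2)]) simp
  have int: "integrable lborel (\<lambda>x. indicator \<Omega> x *\<^sub>R frechet_derivative (\<lambda>x. \<phi> x \<bullet> b) (at x) b)" for b
    using integrable_continuous_compact_support[OF C_k_1_frechet_continuous[OF C1] cs frechet_derivative_outside_supp] \<Omega>(1)
    by (intro integrable_mult_indicator) (auto intro: borel_open)
  have "(LINT x:\<Omega>|lborel. divergence \<phi> x)
      = (LINT x|lborel. (\<Sum>b\<in>Basis. indicator \<Omega> x *\<^sub>R frechet_derivative (\<lambda>x. \<phi> x \<bullet> b) (at x) b))"
    unfolding set_lebesgue_integral_def divergence_def
    by (simp add: frechet_derivative_inner[OF \<phi>(1)] sum_distrib_left)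
  also have "\<dots> = (\<Sum>b\<in>Basis. (LINT x:\<Omega>|lborel. frechet_derivative (\<lambda>x. \<phi> x \<bullet> b) (at x) b))"
    unfolding set_lebesgue_integral_def by (rule Bochner_Integration.integral_sum) (rule int)
  also have "\<dots> \<le> (\<Sum>b\<in>Basis. 2 * measure lborel (S b))"
  proof (rule sum_mono)
    fix b :: 'a assume b: "b \<in> Basis"
    have "\<bar>\<phi> x \<bullet> b\<bar> \<le> 1" for x using Basis_le_norm[OF b, of "\<phi> x"] \<phi>(3)[of x] by linarith
    then show "(LINT x:\<Omega>|lborel. frechet_derivative (\<lambda>x. \<phi> x \<bullet> b) (at x) b) \<le> 2 * measure lborel (S b)"
      using b by (intro integral_derivative_convex_le C1 cs \<Omega> S) auto
  qed
  finally show ?thesis .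
qed

text \<open>The vertical shadow of the domain is \<open>A\<close>, which gives the main term. A
  horizontal line meets the domain only if its height is within \<open>M * \<epsilon>\<close> of
  \<open>0\<close>, so the other shadows have volume of order \<open>\<epsilon>\<close>.\<close>

lemma perimeter_thin_domain_le:
  fixes A :: "'a::euclidean_space set"
  assumes A: "open A" "bounded A" and f: "convex_on A f" and g: "concave_on A g"
    and M: "\<And>s. s \<in> A \<Longrightarrow> - M \<le> f s" "\<And>s. s \<in> A \<Longrightarrow> g s \<le> M" "M \<ge> 0"
  shows "\<exists>C. \<forall>\<epsilon>>0. perimeter (thin_domain A f g \<epsilon>) \<le> ereal (2 * measure lborel A + C * \<epsilon>)"
proof -
  obtain R where R: "\<And>s. s \<in> A \<Longrightarrow> norm s \<le> R" using A(2) by (meson bounded_iff)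
  \<comment> \<open>A cube for the base points of all relevant horizontal lines: along the line
    direction their coordinate lies between \<open>0\<close> and \<open>1\<close>, in the other
    directions it is that of a point of \<open>A\<close>. The bound \<open>\<bar>R\<bar> + 1\<close>
    covers both cases.\<close>
  define Q :: "'a set" where "Q = cbox (- (\<bar>R\<bar> + 1) *\<^sub>R One) ((\<bar>R\<bar> + 1) *\<^sub>R One)"
  have memQ: "s \<in> Q" if "\<And>j. j \<in> Basis \<Longrightarrow> \<bar>s \<bullet> j\<bar> \<le> \<bar>R\<bar> + 1" for s
    using that by (force simp: Q_def mem_box abs_le_iff)
  \<comment> \<open>One term for each of the \<open>DIM('a)\<close> horizontal directions: twice the
    volume of the cube \<open>Q\<close> times an interval of length \<open>2 * M\<close>, the factor
    \<open>\<epsilon>\<close> being split off.\<close>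
  define C where "C = real DIM('a) * (2 * (measure lborel Q * (2 * M)))"
  have "perimeter (thin_domain A f g \<epsilon>) \<le> ereal (2 * measure lborel A + C * \<epsilon>)" if e: "\<epsilon> > 0" for \<epsilon>
  proof -
    let ?\<Omega> = "thin_domain A f g \<epsilon>"
    have cf: "continuous_on A f" using convex_on_continuous[OF A(1) f] .
    have cg: "continuous_on A g"
      using convex_on_continuous[OF A(1), of "\<lambda>x. - g x"] g continuous_on_minus[of A "\<lambda>x. - g x"]
      by (simp add: concave_on_def)
    have \<Omega>: "open ?\<Omega>" "convex ?\<Omega>" "bounded ?\<Omega>"
    proof -
      show "open ?\<Omega>" by (rule open_thin_domain[OF A(1) cf cg])
      show "convex ?\<Omega>" using convex_thin_domain[OF f g] e by simp
      show "bounded ?\<Omega>"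
      proof (rule bounded_thin_domain[OF A(2)])
        show "\<epsilon> * (- M) \<le> \<epsilon> * f s" "\<epsilon> * g s \<le> \<epsilon> * M" if "s \<in> A" for s
          using e by (auto intro!: mult_left_mono M that simp only: less_imp_le)
      qed
    qed
    define S :: "'a \<times> real \<Rightarrow> ('a \<times> real) set" where
      "S b = (if b = (0, 1) then A \<times> {0..1} else Q \<times> {- (M * \<epsilon>)..M * \<epsilon>})" for b
    have fmA: "A \<in> fmeasurable lborel" using A by (intro bounded_fmeasurable borel_open)
    have fmQ: "Q \<in> fmeasurable lborel" by (simp add: Q_def)
    have prod: "emeasure lborel (X \<times> Y) = emeasure lborel X * emeasure lborel Y" "X \<times> Y \<in> sets borel"
      if "X \<in> fmeasurable lborel" "Y \<in> fmeasurable lborel" for X :: "'a set" and Y :: "real set"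
      using that lborel.emeasure_pair_measure_Times[of X lborel Y] by (auto simp: lborel_prod fmeasurable_def intro: borel_Times)
    have mprod: "measure lborel (X \<times> Y) = measure lborel X * measure lborel Y" "X \<times> Y \<in> fmeasurable lborel"
      if "X \<in> fmeasurable lborel" "Y \<in> fmeasurable lborel" for X :: "'a set" and Y :: "real set"
      using prod[OF that] that by (auto simp: measure_def enn2real_mult fmeasurable_def ennreal_mult_less_top)
    have fmI: "{a..b} \<in> fmeasurable lborel" for a b :: real by (intro bounded_fmeasurable) auto
    have bound: "(LINT x:?\<Omega>|lborel. divergence \<phi> x) \<le> 2 * measure lborel A + C * \<epsilon>"
      if \<phi>: "C_k 1 \<phi>" "compact (supp \<phi>)" "\<forall>x. norm (\<phi> x) \<le> 1" for \<phi> :: "'a \<times> real \<Rightarrow> 'a \<times> real"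
    proof -
      have "(LINT x:?\<Omega>|lborel. divergence \<phi> x) \<le> (\<Sum>b\<in>Basis. 2 * measure lborel (S b))"
      proof (rule integral_divergence_convex_le[OF \<phi>(1,2) _ \<Omega>])
        show "norm (\<phi> x) \<le> 1" for x using \<phi>(3) by blast
        show "S b \<in> fmeasurable lborel" for b
          by (auto simp: S_def intro!: mprod(2) fmA fmQ fmI)
        fix b y :: "'a \<times> real" and \<tau> :: real
        assume b: "b \<in> Basis" and y: "0 \<le> y \<bullet> b" "y \<bullet> b \<le> 1" "y + \<tau> *\<^sub>R b \<in> ?\<Omega>"
        obtain s t where st: "y = (s, t)" by (cases y)
        consider "b = (0, 1)" | k where "k \<in> Basis" "b = (k, 0)" using b by (auto simp: Basis_prod_def)
        then show "y \<in> S b"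
        proof cases
          case 1
          then show ?thesis using y by (simp add: S_def st)
        next
          case 2
          then have bn: "b \<noteq> (0, 1)" by auto
          have A': "s + \<tau> *\<^sub>R k \<in> A" and t: "\<epsilon> * f (s + \<tau> *\<^sub>R k) < t" "t < \<epsilon> * g (s + \<tau> *\<^sub>R k)" and sk: "0 \<le> s \<bullet> k" "s \<bullet> k \<le> 1"
            using y 2 by (auto simp: st)
          have "s \<in> Q"
          proof (rule memQ)
            fix j :: 'a assume j: "j \<in> Basis"
            show "\<bar>s \<bullet> j\<bar> \<le> \<bar>R\<bar> + 1"
            proof (cases "j = k")
              case False
              then have "s \<bullet> j = (s + \<tau> *\<^sub>R k) \<bullet> j" using j 2 by (simp add: inner_add_left inner_Basis)
              then show ?thesis using Basis_le_norm[OF j, of "s + \<tau> *\<^sub>R k"] R[OF A'] by simp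
            qed (use sk in simp)
          qed
          moreover have "\<epsilon> * (- M) \<le> \<epsilon> * f (s + \<tau> *\<^sub>R k)" "\<epsilon> * g (s + \<tau> *\<^sub>R k) \<le> \<epsilon> * M"
            using e by (auto intro!: mult_left_mono M A' simp only: less_imp_le)
          ultimately show ?thesis using t bn by (simp add: S_def st mult.commute)
        qed
      qed
      also have "\<dots> = 2 * measure lborel (S (0, 1)) + (\<Sum>b\<in>Basis - {(0, 1)}. 2 * measure lborel (S b))"
        by (rule sum.remove) (auto simp: Basis_prod_def)
      also have "(\<Sum>b\<in>Basis - {(0, 1)}. 2 * measure lborel (S b)) = (\<Sum>b\<in>Basis - {(0::'a, 1::real)}. 2 * (measure lborel Q * (2 * M * \<epsilon>)))"
        using M(3) e by (intro sum.cong) (auto simp: S_def mprod(1)[OF fmQ fmI])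
      also have "\<dots> = C * \<epsilon>"
      proof -
        have "card (Basis - {(0::'a, 1::real)}) = DIM('a)"
        proof -
          have "(0::'a, 1::real) \<in> Basis" by (simp add: Basis_prod_def)
          from card_Diff_singleton[OF this] show ?thesis by simp
        qed
        then show ?thesis by (simp add: C_def)
      qed
      also have "measure lborel (S (0, 1)) = measure lborel A"
        by (simp add: S_def mprod(1)[OF fmA fmI])
      finally show ?thesis .
    qed
    show ?thesis unfolding perimeter_def using bound by (intro SUP_least) auto
  qed
  then show ?thesis by blast
qed

section \<open>Square integrable functions and the Poincare inequality\<close>

text \<open>Taken over the whole space: functions on a domain enter extended by \<open>0\<close>,
  which turns the set integrals of the weak formulation into plain ones.\<close>

definition square_integrable :: "('a::euclidean_space \<Rightarrow> 'b::euclidean_space) \<Rightarrow> bool" where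
  "square_integrable f \<longleftrightarrow> f \<in> borel_measurable borel \<and> integrable lborel (\<lambda>x. (norm (f x))\<^sup>2)"

lemma square_integrableD:
  "square_integrable f \<Longrightarrow> f \<in> borel_measurable borel"
  "square_integrable f \<Longrightarrow> integrable lborel (\<lambda>x. (norm (f x))\<^sup>2)"
  by (auto simp: square_integrable_def)

lemma square_integrable_bound:
  fixes f :: "'a::euclidean_space \<Rightarrow> 'b::euclidean_space"
  assumes "f \<in> borel_measurable borel" "integrable lborel w" "\<And>x. (norm (f x))\<^sup>2 \<le> w x"
  shows "square_integrable f"
  unfolding square_integrable_def
proof (intro conjI Bochner_Integration.integrable_bound[OF assms(2)])
  show "AE x in lborel. norm ((norm (f x))\<^sup>2) \<le> norm (w x)"
    using assms(3) by (intro AE_I2) (metis abs_ge_self abs_of_nonneg order_trans real_norm_def zero_le_power2)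
qed (use assms(1) in measurable)

lemma norm_add_sq_le: "(norm (a + b))\<^sup>2 \<le> 2 * (norm a)\<^sup>2 + 2 * (norm (b::'b::real_inner))\<^sup>2"
proof -
  have "0 \<le> (norm (a - b))\<^sup>2" by simp
  then show ?thesis by (simp add: power2_norm_eq_inner inner_simps inner_commute algebra_simps)
qed

lemma square_integrable_add:
  assumes "square_integrable f" "square_integrable g"
  shows "square_integrable (\<lambda>x. f x + g x)"
  by (rule square_integrable_bound[where w="\<lambda>x. 2 * (norm (f x))\<^sup>2 + 2 * (norm (g x))\<^sup>2"])
    (use assms norm_add_sq_le in \<open>auto simp: square_integrable_def\<close>)

lemma square_integrable_scaleR: "square_integrable f \<Longrightarrow> square_integrable (\<lambda>x. c *\<^sub>R f x)"
  by (auto simp: square_integrable_def power_mult_distrib)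

lemma square_integrable_diff:
  "square_integrable f \<Longrightarrow> square_integrable g \<Longrightarrow> square_integrable (\<lambda>x. f x - g x)"
  using square_integrable_add[of f "\<lambda>x. (-1) *\<^sub>R g x"] square_integrable_scaleR[of g "-1"] by simp

lemma integrable_inner:
  fixes f g :: "'a::euclidean_space \<Rightarrow> 'b::euclidean_space"
  assumes "square_integrable f" "square_integrable g"
  shows "integrable lborel (\<lambda>x. f x \<bullet> g x)"
proof (rule Bochner_Integration.integrable_bound[where f="\<lambda>x. (norm (f x))\<^sup>2 + (norm (g x))\<^sup>2"])
  show "AE x in lborel. norm (f x \<bullet> g x) \<le> norm ((norm (f x))\<^sup>2 + (norm (g x))\<^sup>2)"
  proof (rule AE_I2)
    fix x
    have "\<bar>f x \<bullet> g x\<bar> \<le> norm (f x) * norm (g x)" by (rule Cauchy_Schwarz_ineq2)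
    also have "\<dots> \<le> (norm (f x))\<^sup>2 + (norm (g x))\<^sup>2"
    proof -
      have "2 * (norm (f x) * norm (g x)) \<le> (norm (f x))\<^sup>2 + (norm (g x))\<^sup>2" "0 \<le> norm (f x) * norm (g x)"
        using sum_squares_bound[of "norm (f x)" "norm (g x)"] by (simp_all add: mult.assoc)
      then show ?thesis by linarith
    qed
    finally show "norm (f x \<bullet> g x) \<le> norm ((norm (f x))\<^sup>2 + (norm (g x))\<^sup>2)" by simp
  qed
  show "(\<lambda>x. f x \<bullet> g x) \<in> borel_measurable lborel"
    using assms by (auto simp: square_integrable_def)
qed (use assms in \<open>auto simp: square_integrable_def\<close>)

lemma integral_norm_scaled_add:
  fixes f g :: "'a::euclidean_space \<Rightarrow> 'b::euclidean_space"
  assumes "square_integrable f" "square_integrable g"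
  shows "(LINT x|lborel. (norm (f x + t *\<^sub>R g x))\<^sup>2) =
    (LINT x|lborel. (norm (f x))\<^sup>2) + 2 * t * (LINT x|lborel. f x \<bullet> g x) + t\<^sup>2 * (LINT x|lborel. (norm (g x))\<^sup>2)"
proof -
  have "(\<lambda>x. (norm (f x + t *\<^sub>R g x))\<^sup>2) = (\<lambda>x. (norm (f x))\<^sup>2 + (2 * t) * (f x \<bullet> g x) + t\<^sup>2 * (norm (g x))\<^sup>2)"
    unfolding power2_norm_eq_inner by (simp add: inner_simps inner_commute algebra_simps power2_eq_square)
  then show ?thesis
    using assms integrable_inner[OF assms] by (simp add: square_integrable_def)
qed

lemma integral_inner_Cauchy_Schwarz:
  fixes f g :: "'a::euclidean_space \<Rightarrow> 'b::euclidean_space"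
  assumes "square_integrable f" "square_integrable g"
  shows "(LINT x|lborel. f x \<bullet> g x)\<^sup>2 \<le> (LINT x|lborel. (norm (f x))\<^sup>2) * (LINT x|lborel. (norm (g x))\<^sup>2)"
proof -
  define X Y Z where "X = (LINT x|lborel. (norm (f x))\<^sup>2)" and "Y = (LINT x|lborel. (norm (g x))\<^sup>2)" and "Z = (LINT x|lborel. f x \<bullet> g x)"
  have q: "0 \<le> X + 2 * t * Z + t\<^sup>2 * Y" for t
  proof -
    have "0 \<le> (LINT x|lborel. (norm (f x + t *\<^sub>R g x))\<^sup>2)" by simp
    then show ?thesis unfolding integral_norm_scaled_add[OF assms] X_def Y_def Z_def .
  qed
  have XY: "X \<ge> 0" "Y \<ge> 0" by (auto simp: X_def Y_def)
  have "Z\<^sup>2 \<le> X * Y"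
  proof (cases "Y = 0")
    case True
    have "Z = 0"
    proof (rule ccontr)
      assume "Z \<noteq> 0"
      \<comment> \<open>With \<open>Y = 0\<close> the quadratic is affine in \<open>t\<close>; this
        choice gives it the value \<open>-1\<close>.\<close>
      then show False using q[of "- (X + 1) / (2 * Z)"] True by (simp add: field_simps)
    qed
    then show ?thesis using XY by simp
  next
    case False
    then have "Y > 0" using XY by simp
    then show ?thesis using q[of "- Z / Y"] by (simp add: field_simps power2_eq_square)
  qed
  then show ?thesis by (simp add: X_def Y_def Z_def)
qed

lemma tendsto_integral_inner:
  fixes f :: "nat \<Rightarrow> 'a::euclidean_space \<Rightarrow> 'b::euclidean_space"
  assumes f: "\<And>n. square_integrable (f n)" "square_integrable F" and g: "square_integrable g"
    and lim: "(\<lambda>n. LINT x|lborel. (norm (f n x - F x))\<^sup>2) \<longlonglongrightarrow> 0"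
  shows "(\<lambda>n. LINT x|lborel. f n x \<bullet> g x) \<longlonglongrightarrow> (LINT x|lborel. F x \<bullet> g x)"
proof -
  let ?d = "\<lambda>n. LINT x|lborel. (f n x - F x) \<bullet> g x"
  let ?G = "LINT x|lborel. (norm (g x))\<^sup>2"
  have "(\<lambda>n. (?d n)\<^sup>2) \<longlonglongrightarrow> 0"
  proof (rule tendsto_sandwich[where f="\<lambda>_. 0"])
    show "\<forall>\<^sub>F n in sequentially. (?d n)\<^sup>2 \<le> (LINT x|lborel. (norm (f n x - F x))\<^sup>2) * ?G"
      using integral_inner_Cauchy_Schwarz[OF square_integrable_diff[OF f(1) f(2)] g] by (intro always_eventually) auto
    show "(\<lambda>n. (LINT x|lborel. (norm (f n x - F x))\<^sup>2) * ?G) \<longlonglongrightarrow> 0"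
      using tendsto_mult_right[OF lim, of ?G] by simp
  qed auto
  then have "(\<lambda>n. sqrt ((?d n)\<^sup>2)) \<longlonglongrightarrow> sqrt 0" by (rule tendsto_real_sqrt)
  then have "?d \<longlonglongrightarrow> 0" by (simp add: tendsto_rabs_zero_iff)
  moreover have "?d n = (LINT x|lborel. f n x \<bullet> g x) - (LINT x|lborel. F x \<bullet> g x)" for n
    using integrable_inner[OF f(1) g] integrable_inner[OF f(2) g] by (simp add: inner_diff_left)
  ultimately show ?thesis by (simp add: LIM_zero_iff)
qed

lemma tendsto_integral_norm_sq:
  fixes f :: "nat \<Rightarrow> 'a::euclidean_space \<Rightarrow> 'b::euclidean_space"
  assumes f: "\<And>n. square_integrable (f n)" "square_integrable F"
    and lim: "(\<lambda>n. LINT x|lborel. (norm (f n x - F x))\<^sup>2) \<longlonglongrightarrow> 0"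
  shows "(\<lambda>n. LINT x|lborel. (norm (f n x))\<^sup>2) \<longlonglongrightarrow> (LINT x|lborel. (norm (F x))\<^sup>2)"
proof -
  have "(LINT x|lborel. (norm (f n x))\<^sup>2) = 2 * (LINT x|lborel. f n x \<bullet> F x) - (LINT x|lborel. (norm (F x))\<^sup>2)
      + (LINT x|lborel. (norm (f n x - F x))\<^sup>2)" for n
    using integral_norm_scaled_add[OF f(1) f(2), of n "-1"] by simp
  moreover have "(\<lambda>n. 2 * (LINT x|lborel. f n x \<bullet> F x) - (LINT x|lborel. (norm (F x))\<^sup>2)
      + (LINT x|lborel. (norm (f n x - F x))\<^sup>2)) \<longlonglongrightarrow> 2 * (LINT x|lborel. F x \<bullet> F x) - (LINT x|lborel. (norm (F x))\<^sup>2) + 0"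
    by (intro tendsto_intros lim tendsto_integral_inner f)
  ultimately show ?thesis by (simp add: power2_norm_eq_inner)
qed

text \<open>Riesz-Fischer on a set of finite measure: a subsequence with summable increments
  converges almost everywhere, and Fatou's lemma turns this into \<open>L^2\<close> convergence of
  the full sequence.\<close>

lemma square_integrable_complete:
  fixes f :: "nat \<Rightarrow> 'a::euclidean_space \<Rightarrow> 'b::euclidean_space"
  assumes f: "\<And>n. square_integrable (f n)" and out: "\<And>n x. x \<notin> \<Omega> \<Longrightarrow> f n x = 0"
    and \<Omega>: "\<Omega> \<in> fmeasurable lborel"
    and Cauchy: "\<And>e. e > 0 \<Longrightarrow> \<exists>N. \<forall>m\<ge>N. \<forall>n\<ge>N. (LINT x|lborel. (norm (f m x - f n x))\<^sup>2) < e"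
  obtains F where "square_integrable F" "\<And>x. x \<notin> \<Omega> \<Longrightarrow> F x = 0"
    "(\<lambda>n. LINT x|lborel. (norm (f n x - F x))\<^sup>2) \<longlonglongrightarrow> 0"
proof -
  have [measurable]: "f n \<in> borel_measurable borel" for n using f square_integrableD by blast
  have [measurable]: "\<Omega> \<in> sets borel" using \<Omega> by (simp add: fmeasurable_def)
  have sd: "square_integrable (\<lambda>x. f m x - f n x)" for m n by (intro square_integrable_diff f)
  have "\<forall>k. \<exists>N. \<forall>m\<ge>N. \<forall>n\<ge>N. (LINT x|lborel. (norm (f m x - f n x))\<^sup>2) < (1/4) ^ k"
    using Cauchy by simp
  then obtain N where N: "\<And>k m n. m \<ge> N k \<Longrightarrow> n \<ge> N k \<Longrightarrow> (LINT x|lborel. (norm (f m x - f n x))\<^sup>2) < (1/4) ^ k"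
    by metis
  \<comment> \<open>Summing the indices makes the subsequence monotone while keeping
    \<open>N k \<le> r k\<close>.\<close>
  define r where "r k = (\<Sum>i\<le>k. N i)" for k
  have rN: "N k \<le> r k" for k unfolding r_def by (rule member_le_sum) auto
  have rmono: "r k \<le> r l" if "k \<le> l" for k l using that unfolding r_def by (intro sum_mono2) auto
  define a where "a k x = f (r (Suc k)) x - f (r k) x" for k x
  have a_out: "x \<notin> \<Omega> \<Longrightarrow> a k x = 0" for k x by (simp add: a_def out)
  have a_meas[measurable]: "a k \<in> borel_measurable borel" for k unfolding a_def by measurable
  have a2: "integrable lborel (\<lambda>x. (norm (a k x))\<^sup>2)" "(LINT x|lborel. (norm (a k x))\<^sup>2) < (1/4) ^ k" for k
    using sd N[of k "r (Suc k)" "r k"] rN[of k] rmono[of k "Suc k"] unfolding a_def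
    by (auto simp: square_integrable_def)
  \<comment> \<open>Young's inequality with weight \<open>2 ^ k\<close>: the squared norm of
    \<open>a k\<close> is below \<open>(1/4) ^ k\<close> and \<open>\<Omega>\<close> has finite
    measure, so the integral of \<open>?w k\<close> is at most a constant times
    \<open>(1/2) ^ k\<close> and the increments are summable almost everywhere.\<close>
  let ?w = "\<lambda>k x. (2 ^ k * (norm (a k x))\<^sup>2 + (1/2) ^ k * indicator \<Omega> x) / 2"
  have bound: "norm (a k x) \<le> ?w k x" for k x
  proof (cases "x \<in> \<Omega>")
    case True
    have "0 \<le> (2 ^ k * norm (a k x) - 1)\<^sup>2" by simp
    then have "2 * 2 ^ k * norm (a k x) \<le> (2 ^ k)\<^sup>2 * (norm (a k x))\<^sup>2 + 1"
      by (simp add: power2_eq_square algebra_simps)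
    then have "norm (a k x) \<le> (2 ^ k * (norm (a k x))\<^sup>2 + (1/2) ^ k) / 2"
      by (simp add: field_simps power2_eq_square)
    then show ?thesis using True by simp
  qed (simp add: a_out)
  have iw: "integrable lborel (?w k)" for k
    using a2(1)[of k] \<Omega> by (auto simp: integrable_indicator_iff fmeasurable_def)
  have Iw: "(LINT x|lborel. ?w k x) \<le> (1/2) ^ k * ((1 + measure lborel \<Omega>) / 2)" for k
  proof -
    have "(LINT x|lborel. ?w k x) = (2 ^ k * (LINT x|lborel. (norm (a k x))\<^sup>2) + (1/2) ^ k * measure lborel \<Omega>) / 2"
      using a2(1)[of k] \<Omega> by (simp add: integrable_indicator_iff fmeasurable_def)
    also have "\<dots> \<le> (2 ^ k * (1/4) ^ k + (1/2) ^ k * measure lborel \<Omega>) / 2"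
      using a2(2)[of k] by (intro divide_right_mono add_right_mono mult_left_mono) auto
    also have "2 ^ k * (1/4) ^ k = (1/2::real) ^ k" by (simp add: power_mult_distrib[symmetric])
    finally show ?thesis by (simp add: field_simps)
  qed
  have "(\<integral>\<^sup>+x. (\<Sum>k. ennreal (?w k x)) \<partial>lborel) = (\<Sum>k. \<integral>\<^sup>+x. ennreal (?w k x) \<partial>lborel)"
    by (rule nn_integral_suminf) measurable
  also have "\<dots> \<le> (\<Sum>k. ennreal ((1/2) ^ k * ((1 + measure lborel \<Omega>) / 2)))"
  proof (rule suminf_le)
    show "(\<integral>\<^sup>+x. ennreal (?w k x) \<partial>lborel) \<le> ennreal ((1/2) ^ k * ((1 + measure lborel \<Omega>) / 2))" for k
      using nn_integral_eq_integral[OF iw[of k]] Iw[of k] by (simp add: ennreal_leI)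
  qed auto
  also have "\<dots> = ennreal (\<Sum>k. (1/2) ^ k * ((1 + measure lborel \<Omega>) / 2))"
    by (intro suminf_ennreal2 summable_mult2) (auto intro!: mult_nonneg_nonneg)
  also have "\<dots> < \<infinity>" by simp
  finally have "(\<integral>\<^sup>+x. (\<Sum>k. ennreal (?w k x)) \<partial>lborel) \<noteq> \<infinity>" by simp
  then have "AE x in lborel. (\<Sum>k. ennreal (?w k x)) \<noteq> \<infinity>"
    by (intro nn_integral_PInf_AE) measurable
  then have conv: "AE x in lborel. convergent (\<lambda>k. f (r k) x)"
  proof eventually_elim
    case (elim x)
    have "summable (\<lambda>k. ?w k x)" using elim by (intro summable_suminf_not_top) auto
    then have "summable (\<lambda>k. a k x)"
      by (rule summable_comparison_test'[of _ 0]) (use bound in auto)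
    then have "convergent (\<lambda>n. \<Sum>k<n. a k x)" by (simp add: summable_iff_convergent)
    moreover have "(\<Sum>k<n. a k x) = f (r n) x - f (r 0) x" for n
      unfolding a_def by (rule sum_lessThan_telescope)
    ultimately have "convergent (\<lambda>n. f (r n) x - f (r 0) x)" by simp
    then have "convergent (\<lambda>n. (f (r n) x - f (r 0) x) + f (r 0) x)" by (intro convergent_add convergent_const)
    then show ?case by simp
  qed
  \<comment> \<open>Where the subsequence diverges \<open>lim\<close> has an unspecified value, but
    that set is null. Outside \<open>\<Omega>\<close> the sequence is constantly \<open>0\<close>,
    so \<open>F\<close> vanishes there everywhere and not only almost everywhere.\<close>
  define F where "F x = lim (\<lambda>k. f (r k) x)" for x
  have F_meas[measurable]: "F \<in> borel_measurable borel" unfolding F_def by measurable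
  have F_out: "F x = 0" if "x \<notin> \<Omega>" for x unfolding F_def using that out by (simp add: lim_const)
  have fatou: "(\<integral>\<^sup>+x. ennreal ((norm (f n x - F x))\<^sup>2) \<partial>lborel) \<le> ennreal ((1/4) ^ j)" if n: "n \<ge> r j" for n j
  proof -
    have "(\<integral>\<^sup>+x. ennreal ((norm (f n x - F x))\<^sup>2) \<partial>lborel)
        = (\<integral>\<^sup>+x. liminf (\<lambda>k. ennreal ((norm (f n x - f (r k) x))\<^sup>2)) \<partial>lborel)"
    proof (rule nn_integral_cong_AE)
      show "AE x in lborel. ennreal ((norm (f n x - F x))\<^sup>2) = liminf (\<lambda>k. ennreal ((norm (f n x - f (r k) x))\<^sup>2))"
        using conv
      proof eventually_elim
        case (elim x)
        then have "(\<lambda>k. f (r k) x) \<longlonglongrightarrow> F x" unfolding F_def by (simp add: convergent_LIMSEQ_iff)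
        then have "(\<lambda>k. ennreal ((norm (f n x - f (r k) x))\<^sup>2)) \<longlonglongrightarrow> ennreal ((norm (f n x - F x))\<^sup>2)"
          by (intro tendsto_ennrealI tendsto_intros)
        then show ?case by (rule lim_imp_Liminf[OF trivial_limit_sequentially, symmetric])
      qed
    qed
    also have "\<dots> \<le> liminf (\<lambda>k. \<integral>\<^sup>+x. ennreal ((norm (f n x - f (r k) x))\<^sup>2) \<partial>lborel)"
      by (rule nn_integral_liminf) measurable
    also have "\<dots> \<le> ennreal ((1/4) ^ j)"
    proof (rule Liminf_le)
      show "\<forall>\<^sub>F k in sequentially. (\<integral>\<^sup>+x. ennreal ((norm (f n x - f (r k) x))\<^sup>2) \<partial>lborel) \<le> ennreal ((1/4) ^ j)"
        using eventually_ge_at_top[of j]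
      proof eventually_elim
        case (elim k)
        have "(\<integral>\<^sup>+x. ennreal ((norm (f n x - f (r k) x))\<^sup>2) \<partial>lborel) = ennreal (LINT x|lborel. (norm (f n x - f (r k) x))\<^sup>2)"
          using sd by (intro nn_integral_eq_integral) (auto simp: square_integrable_def)
        also have "\<dots> \<le> ennreal ((1/4) ^ j)"
          using N[of j n "r k"] n rN[of j] rmono[OF elim] by (intro ennreal_leI less_imp_le) linarith
        finally show ?case .
      qed
    qed simp
    finally show ?thesis .
  qed
  have int: "square_integrable (\<lambda>x. f n x - F x)" "(LINT x|lborel. (norm (f n x - F x))\<^sup>2) \<le> (1/4) ^ j" if n: "n \<ge> r j" for n j
  proof -
    have I: "integrable lborel (\<lambda>x. (norm (f n x - F x))\<^sup>2)"
      using fatou[OF n] by (intro integrableI_bounded) (auto simp: less_top[symmetric] top_unique intro: order.strict_trans1)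
    then show "square_integrable (\<lambda>x. f n x - F x)" by (simp add: square_integrable_def)
    show "(LINT x|lborel. (norm (f n x - F x))\<^sup>2) \<le> (1/4) ^ j"
      using fatou[OF n] nn_integral_eq_integral[OF I] by simp
  qed
  show thesis
  proof
    have "square_integrable (\<lambda>x. f (r 0) x - (f (r 0) x - F x))"
      by (intro square_integrable_diff f int(1)[of 0]) simp
    then show "square_integrable F" by simp
    show "(\<lambda>n. LINT x|lborel. (norm (f n x - F x))\<^sup>2) \<longlonglongrightarrow> 0"
    proof (rule LIMSEQ_I)
      fix e :: real assume "e > 0"
      then obtain j where j: "(1/4) ^ j < e" using real_arch_pow_inv[of e "1/4"] by auto
      have "norm ((LINT x|lborel. (norm (f n x - F x))\<^sup>2) - 0) < e" if "n \<ge> r j" for n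
      proof -
        have "(LINT x|lborel. (norm (f n x - F x))\<^sup>2) \<ge> 0" by simp
        then show ?thesis using int(2)[OF that] j by (simp only: diff_0_right real_norm_def abs_of_nonneg)
      qed
      then show "\<exists>no. \<forall>n\<ge>no. norm ((LINT x|lborel. (norm (f n x - F x))\<^sup>2) - 0) < e" by blast
    qed
  qed (rule F_out)
qed


section \<open>Test functions, integration by parts and the Poincare inequality\<close>

lemma grad_inner: "C_k 1 \<phi> \<Longrightarrow> grad \<phi> x \<bullet> v = frechet_derivative \<phi> (at x) v"
proof -
  assume "C_k 1 \<phi>"
  then have "(\<phi> has_derivative frechet_derivative \<phi> (at x)) (at x)" using C_k_has_derivative[of 0] by simp
  then have lin: "linear (frechet_derivative \<phi> (at x))" by (rule has_derivative_linear)
  have "frechet_derivative \<phi> (at x) v = frechet_derivative \<phi> (at x) (\<Sum>b\<in>Basis. (v \<bullet> b) *\<^sub>R b)"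
    by (simp add: euclidean_representation)
  also have "\<dots> = (\<Sum>b\<in>Basis. (v \<bullet> b) * frechet_derivative \<phi> (at x) b)"
    by (simp add: linear_sum[OF lin] linear_cmul[OF lin])
  also have "\<dots> = grad \<phi> x \<bullet> v"
    by (simp only: grad_def inner_sum_left inner_scaleR_left inner_commute[of v] mult.commute)
  finally show "grad \<phi> x \<bullet> v = frechet_derivative \<phi> (at x) v" by simp
qed

lemma grad_eqI:
  assumes "C_k 1 \<phi>" "\<And>v. frechet_derivative \<phi> (at x) v = w \<bullet> v"
  shows "grad \<phi> x = w"
  by (rule euclidean_eqI) (simp only: grad_inner[OF assms(1)] assms(2))

lemma test_functionD:
  assumes "test_function \<Omega> \<phi>"
  shows "C_k k \<phi>" "compact (supp \<phi>)" "x \<notin> \<Omega> \<Longrightarrow> \<phi> x = 0" "x \<notin> \<Omega> \<Longrightarrow> grad \<phi> x = 0"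
proof -
  show "C_k k \<phi>" "compact (supp \<phi>)" using assms by (auto simp: test_function_def)
  show "x \<notin> \<Omega> \<Longrightarrow> \<phi> x = 0" using assms supp_eq_0[of x \<phi>] by (auto simp: test_function_def)
  show "x \<notin> \<Omega> \<Longrightarrow> grad \<phi> x = 0"
  proof -
    assume "x \<notin> \<Omega>"
    then have "x \<notin> supp \<phi>" using assms by (auto simp: test_function_def)
    then show "grad \<phi> x = 0" by (simp add: grad_def frechet_derivative_outside_supp)
  qed
qed

lemma test_function_continuous_grad:
  assumes "test_function \<Omega> \<phi>"
  shows "continuous_on S (grad \<phi>)"
proof -
  have "continuous_on S (\<lambda>x. \<Sum>b\<in>Basis. frechet_derivative \<phi> (at x) b *\<^sub>R b)"
    by (intro continuous_intros C_k_1_frechet_continuous test_functionD(1)[OF assms])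
  then show ?thesis by (simp add: grad_def[abs_def])
qed

lemma test_function_square_integrable:
  assumes "test_function \<Omega> \<phi>"
  shows "square_integrable \<phi>" "square_integrable (grad \<phi>)" "integrable lborel \<phi>"
proof -
  have c: "continuous_on UNIV \<phi>" using C_k_cont[OF test_functionD(1)[OF assms]] .
  have g: "continuous_on UNIV (grad \<phi>)" by (rule test_function_continuous_grad[OF assms])
  have K: "compact (supp \<phi>)" by (rule test_functionD(2)[OF assms])
  have g0: "grad \<phi> x = 0" if "x \<notin> supp \<phi>" for x
    using frechet_derivative_outside_supp[OF that] by (simp add: grad_def)
  show "integrable lborel \<phi>" by (rule integrable_continuous_compact_support[OF c K]) (rule supp_eq_0)
  show "square_integrable \<phi>" unfolding square_integrable_def
    by (intro conjI borel_measurable_continuous_onI[OF c] integrable_continuous_compact_support[OF _ K])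
      (auto intro!: continuous_intros c simp: supp_eq_0)
  show "square_integrable (grad \<phi>)" unfolding square_integrable_def
    by (intro conjI borel_measurable_continuous_onI[OF g] integrable_continuous_compact_support[OF _ K])
      (auto intro!: continuous_intros g simp: g0)
qed

lemma frechet_derivative_add_scaled:
  fixes \<phi> \<psi> :: "'a::euclidean_space \<Rightarrow> real"
  assumes "C_k 1 \<phi>" "C_k 1 \<psi>"
  shows "frechet_derivative (\<lambda>x. \<phi> x + t * \<psi> x) (at x) v = frechet_derivative \<phi> (at x) v + t * frechet_derivative \<psi> (at x) v"
proof -
  have "(\<phi> has_derivative frechet_derivative \<phi> (at x)) (at x)" "(\<psi> has_derivative frechet_derivative \<psi> (at x)) (at x)"
    using assms C_k_has_derivative[of 0] by simp_all
  then have "((\<lambda>x. \<phi> x + t * \<psi> x) has_derivative (\<lambda>v. frechet_derivative \<phi> (at x) v + t * frechet_derivative \<psi> (at x) v)) (at x)"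
    by (intro has_derivative_add has_derivative_mult_right)
  from fun_cong[OF frechet_derivative_at[OF this], of v] show ?thesis by (rule sym)
qed

lemma test_function_add_scaled:
  assumes \<phi>: "test_function \<Omega> \<phi>" and \<psi>: "test_function \<Omega> \<psi>"
  shows "test_function \<Omega> (\<lambda>x. \<phi> x + t * \<psi> x)" "grad (\<lambda>x. \<phi> x + t * \<psi> x) x = grad \<phi> x + t *\<^sub>R grad \<psi> x"
proof -
  have C: "C_k k (\<lambda>x. \<phi> x + t * \<psi> x)" for k
    by (intro C_k_add C_k_mult C_k_const test_functionD(1)[OF \<phi>] test_functionD(1)[OF \<psi>])
  have sub: "supp (\<lambda>x. \<phi> x + t * \<psi> x) \<subseteq> supp \<phi> \<union> supp \<psi>"
    by (rule supp_subset_closed) (auto simp: supp_eq_0, auto simp: supp_def)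
  have co: "compact (supp \<phi> \<union> supp \<psi>)" using \<phi> \<psi> by (simp add: test_function_def compact_Un)
  have "supp (\<lambda>x. \<phi> x + t * \<psi> x) = (supp \<phi> \<union> supp \<psi>) \<inter> supp (\<lambda>x. \<phi> x + t * \<psi> x)" using sub by blast
  then have "compact (supp (\<lambda>x. \<phi> x + t * \<psi> x))"
    using compact_Int_closed[OF co, of "supp (\<lambda>x. \<phi> x + t * \<psi> x)"] by (simp add: supp_def)
  then show "test_function \<Omega> (\<lambda>x. \<phi> x + t * \<psi> x)"
    using C sub \<phi> \<psi> unfolding test_function_def by blast
  show "grad (\<lambda>x. \<phi> x + t * \<psi> x) x = grad \<phi> x + t *\<^sub>R grad \<psi> x"
    using grad_inner[OF test_functionD(1)[OF \<phi>]] grad_inner[OF test_functionD(1)[OF \<psi>]]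
      frechet_derivative_add_scaled[OF test_functionD(1)[OF \<phi>] test_functionD(1)[OF \<psi>]]
    by (intro grad_eqI C) (simp add: inner_add_left)
qed

lemma test_function_zero: "test_function \<Omega> (\<lambda>_. 0)"
  unfolding test_function_def by (auto intro: C_k_const simp: supp_def)

text \<open>Compact support is demanded of \<open>g\<close> alone, so that \<open>f\<close> may be a
  coordinate function, as in the Poincare inequality.\<close>

lemma integral_mult_frechet:
  fixes f g :: "'a::euclidean_space \<Rightarrow> real"
  assumes f: "C_k 1 f" and g: "C_k 1 g" "compact (supp g)" and b: "norm b = 1"
  shows "(LINT x|lborel. f x * frechet_derivative g (at x) b) = - (LINT x|lborel. frechet_derivative f (at x) b * g x)"
    and "integrable lborel (\<lambda>x. f x * frechet_derivative g (at x) b)"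
    and "integrable lborel (\<lambda>x. frechet_derivative f (at x) b * g x)"
proof -
  have C: "C_k 1 (\<lambda>x. f x * g x)" by (rule C_k_mult[OF f g(1)])
  have D: "frechet_derivative (\<lambda>x. f x * g x) (at x) v = f x * frechet_derivative g (at x) v + frechet_derivative f (at x) v * g x" for x v
  proof -
    have "(f has_derivative frechet_derivative f (at x)) (at x)" "(g has_derivative frechet_derivative g (at x)) (at x)"
      using f g C_k_has_derivative[of 0] by simp_all
    from fun_cong[OF frechet_derivative_at[OF has_derivative_mult[OF this]], of v] show ?thesis by (rule sym)
  qed
  have cf: "continuous_on UNIV f" and cg: "continuous_on UNIV g" using C_k_cont f g by blast+
  show 1: "integrable lborel (\<lambda>x. f x * frechet_derivative g (at x) b)"
    by (rule integrable_continuous_compact_support[OF _ g(2)])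
      (auto intro!: continuous_intros cf C_k_1_frechet_continuous g(1) simp: frechet_derivative_outside_supp)
  show 2: "integrable lborel (\<lambda>x. frechet_derivative f (at x) b * g x)"
    by (rule integrable_continuous_compact_support[OF _ g(2)])
      (auto intro!: continuous_intros cg C_k_1_frechet_continuous f simp: supp_eq_0)
  have "compact (supp (\<lambda>x. f x * g x))" by (rule compact_supp_mono(1)[OF g(2)]) simp
  from integral_directional_derivative_eq_0[OF C this b]
  show "(LINT x|lborel. f x * frechet_derivative g (at x) b) = - (LINT x|lborel. frechet_derivative f (at x) b * g x)"
    unfolding D using 1 2 by simp
qed

text \<open>Since \<open>x \<bullet> b\<close> has derivative 1 along \<open>b\<close>, the integral
  of \<open>\<phi>^2\<close> is minus that of \<open>x \<bullet> b\<close> times the derivative of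
  \<open>\<phi>^2\<close>; boundedness of \<open>\<Omega>\<close> controls the factor
  \<open>x \<bullet> b\<close>.\<close>

lemma Poincare_test_function:
  fixes \<Omega> :: "'a::euclidean_space set"
  assumes R: "\<And>x. x \<in> \<Omega> \<Longrightarrow> norm x \<le> R" and \<phi>: "test_function \<Omega> \<phi>"
  shows "(LINT x|lborel. (\<phi> x)\<^sup>2) \<le> 4 * R\<^sup>2 * (LINT x|lborel. (norm (grad \<phi> x))\<^sup>2)"
proof -
  obtain b :: 'a where b: "b \<in> Basis" using nonempty_Basis by blast
  have nb: "norm b = 1" using b by simp
  note \<phi>D = test_functionD[OF \<phi>]
  let ?D = "\<lambda>x. frechet_derivative \<phi> (at x) b"
  have C2: "C_k 1 (\<lambda>x. \<phi> x * \<phi> x)" by (intro C_k_mult \<phi>D(1))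
  have cs: "compact (supp (\<lambda>x. \<phi> x * \<phi> x))" by (rule compact_supp_mono(1)[OF \<phi>D(2)]) simp
  have Cb: "C_k 1 (\<lambda>x. x \<bullet> b)" by (rule C_k_linear[OF bounded_linear_inner_left])
  have Db: "frechet_derivative (\<lambda>x. x \<bullet> b) (at x) b = 1" for x
  proof -
    have "((\<lambda>x. x \<bullet> b) has_derivative (\<lambda>x. x \<bullet> b)) (at x)"
      by (rule bounded_linear_imp_has_derivative[OF bounded_linear_inner_left])
    from fun_cong[OF frechet_derivative_at[OF this], of b]
    have "frechet_derivative (\<lambda>x. x \<bullet> b) (at x) b = b \<bullet> b" by (rule sym)
    then show ?thesis using b by simp
  qed
  have D2: "frechet_derivative (\<lambda>x. \<phi> x * \<phi> x) (at x) b = 2 * \<phi> x * ?D x" for x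
  proof -
    have "(\<phi> has_derivative frechet_derivative \<phi> (at x)) (at x)"
      using \<phi>D(1)[of 1] C_k_has_derivative[of 0] by simp
    from fun_cong[OF frechet_derivative_at[OF has_derivative_mult[OF this this]], of b]
    have "frechet_derivative (\<lambda>x. \<phi> x * \<phi> x) (at x) b = \<phi> x * ?D x + ?D x * \<phi> x" by (rule sym)
    then show ?thesis by simp
  qed
  note ibp = integral_mult_frechet[OF Cb C2 cs nb, unfolded D2 Db]
  have sq: "integrable lborel (\<lambda>x. (\<phi> x)\<^sup>2)" "integrable lborel (\<lambda>x. (norm (grad \<phi> x))\<^sup>2)"
    using test_function_square_integrable[OF \<phi>] by (auto simp: square_integrable_def)
  have "(LINT x|lborel. (\<phi> x)\<^sup>2) = - (LINT x|lborel. (x \<bullet> b) * (2 * \<phi> x * ?D x))"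
    using ibp(1) by (simp add: power2_eq_square)
  \<comment> \<open>The weights come from the square of
    \<open>\<phi> x / 2 + (x \<bullet> b) * ?D x\<close>. Half of the integral of
    \<open>\<phi>^2\<close> remains to be absorbed on the left, and the doubling gives
    \<open>4 R^2\<close>.\<close>
  also have "\<dots> \<le> (LINT x|lborel. (\<phi> x)\<^sup>2 / 2 + 2 * R\<^sup>2 * (norm (grad \<phi> x))\<^sup>2)"
    unfolding integral_minus[symmetric]
  proof (rule integral_mono)
    show "integrable lborel (\<lambda>x. - ((x \<bullet> b) * (2 * \<phi> x * ?D x)))" using ibp(2) by simp
    show "integrable lborel (\<lambda>x. (\<phi> x)\<^sup>2 / 2 + 2 * R\<^sup>2 * (norm (grad \<phi> x))\<^sup>2)" using sq by simp
    fix x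
    show "- ((x \<bullet> b) * (2 * \<phi> x * ?D x)) \<le> (\<phi> x)\<^sup>2 / 2 + 2 * R\<^sup>2 * (norm (grad \<phi> x))\<^sup>2"
    proof (cases "x \<in> \<Omega>")
      case True
      have "\<bar>x \<bullet> b\<bar> \<le> R" using R[OF True] Basis_le_norm[OF b, of x] by linarith
      moreover have "\<bar>?D x\<bar> \<le> norm (grad \<phi> x)"
        using Basis_le_norm[OF b, of "grad \<phi> x"] grad_inner[OF \<phi>D(1), of x b] by simp
      ultimately have "\<bar>(x \<bullet> b) * ?D x\<bar> \<le> R * norm (grad \<phi> x)" unfolding abs_mult by (intro mult_mono) auto
      then have "((x \<bullet> b) * ?D x)\<^sup>2 \<le> (R * norm (grad \<phi> x))\<^sup>2" by (rule abs_le_square_iff[THEN iffD1, OF order_trans[OF _ abs_ge_self]])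
      moreover have "0 \<le> (\<phi> x / 2 + (x \<bullet> b) * ?D x)\<^sup>2" by simp
      ultimately show ?thesis by (simp add: power2_eq_square algebra_simps)
    next
      case False
      then show ?thesis using \<phi>D(3)[OF False] by simp
    qed
  qed
  also have "\<dots> = (LINT x|lborel. (\<phi> x)\<^sup>2) / 2 + 2 * R\<^sup>2 * (LINT x|lborel. (norm (grad \<phi> x))\<^sup>2)"
    using sq by simp
  finally show ?thesis by simp
qed

section \<open>Variational characterisation of the torsional rigidity\<close>

text \<open>A concave substitute for the quotient of the squared integral by the Dirichlet energy.
  For the solution \<open>u\<close>, testing the equation with \<open>u\<close> itself equates the
  integral of \<open>u\<close> with its Dirichlet energy, so the maximum is the torsional rigidity
  with no extra factor.\<close>

definition torsion_energy :: "('a::euclidean_space \<Rightarrow> real) \<Rightarrow> real" where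
  "torsion_energy \<phi> = 2 * (LINT x|lborel. \<phi> x) - (LINT x|lborel. (norm (grad \<phi> x))\<^sup>2)"

lemma torsion_energy_bounded:
  fixes \<Omega> :: "'a::euclidean_space set"
  assumes \<Omega>: "open \<Omega>" "bounded \<Omega>"
  obtains K where "\<And>\<phi>. test_function \<Omega> \<phi> \<Longrightarrow> torsion_energy \<phi> \<le> K"
proof -
  obtain R0 where R0: "\<And>x. x \<in> \<Omega> \<Longrightarrow> norm x \<le> R0" using \<Omega>(2) by (meson bounded_iff)
  define R where "R = \<bar>R0\<bar> + 1"
  have R: "norm x \<le> R" if "x \<in> \<Omega>" for x using R0[OF that] by (simp add: R_def)
  have Rpos: "R > 0" by (simp add: R_def add_nonneg_pos)
  have fm: "\<Omega> \<in> fmeasurable lborel" using \<Omega> by (intro bounded_fmeasurable borel_open)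
  then have iO: "integrable lborel (\<lambda>x. indicator \<Omega> x :: real)" by (simp add: integrable_indicator_iff fmeasurable_def)
  \<comment> \<open>Young's inequality \<open>2 \<phi> \<le> s \<phi>^2 + 1/s\<close> is tuned so
    that the Poincare constant \<open>4 R^2\<close> makes the Dirichlet integral cancel
    exactly.\<close>
  define s where "s = 1 / (4 * R\<^sup>2)"
  have s: "s > 0" using Rpos by (simp add: s_def)
  show thesis
  proof
    fix \<phi> assume \<phi>: "test_function \<Omega> \<phi>"
    note sq = test_function_square_integrable[OF \<phi>]
    have i2: "integrable lborel (\<lambda>x. (\<phi> x)\<^sup>2)" using sq(1) by (simp add: square_integrable_def)
    have "2 * (LINT x|lborel. \<phi> x) = (LINT x|lborel. 2 * \<phi> x)" by simp
    also have "\<dots> \<le> (LINT x|lborel. s * (\<phi> x)\<^sup>2 + (1 / s) * indicator \<Omega> x)"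
    proof (rule integral_mono)
      fix x
      show "2 * \<phi> x \<le> s * (\<phi> x)\<^sup>2 + (1 / s) * indicator \<Omega> x"
      proof (cases "x \<in> \<Omega>")
        case True
        have "0 \<le> (s * \<phi> x - 1)\<^sup>2 / s" using s by simp
        also have "\<dots> = s * (\<phi> x)\<^sup>2 + 1 / s - 2 * \<phi> x" using s by (simp add: power2_eq_square field_simps)
        finally show ?thesis using True by simp
      qed (simp add: test_functionD(3)[OF \<phi>])
    qed (use i2 iO sq(3) in auto)
    also have "\<dots> = s * (LINT x|lborel. (\<phi> x)\<^sup>2) + (1 / s) * measure lborel \<Omega>"
      using i2 iO fm by (simp add: fmeasurable_def)
    also have "s * (LINT x|lborel. (\<phi> x)\<^sup>2) \<le> s * (4 * R\<^sup>2 * (LINT x|lborel. (norm (grad \<phi> x))\<^sup>2))"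
      using Poincare_test_function[OF R \<phi>] s by (intro mult_left_mono) auto
    also have "\<dots> = (LINT x|lborel. (norm (grad \<phi> x))\<^sup>2)" using Rpos by (simp add: s_def)
    finally show "torsion_energy \<phi> \<le> (1 / s) * measure lborel \<Omega>" by (simp add: torsion_energy_def)
  qed
qed

lemma torsion_energy_add_scaled:
  assumes \<phi>: "test_function \<Omega> \<phi>" and \<psi>: "test_function \<Omega> \<psi>"
  shows "torsion_energy (\<lambda>x. \<phi> x + t * \<psi> x) = torsion_energy \<phi>
    + 2 * t * ((LINT x|lborel. \<psi> x) - (LINT x|lborel. grad \<phi> x \<bullet> grad \<psi> x)) - t\<^sup>2 * (LINT x|lborel. (norm (grad \<psi> x))\<^sup>2)"
  unfolding torsion_energy_def test_function_add_scaled(2)[OF \<phi> \<psi>]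
  using test_function_square_integrable[OF \<phi>] test_function_square_integrable[OF \<psi>]
  by (simp add: integral_norm_scaled_add algebra_simps)

lemma quadratic_nonneg_imp_zero:
  fixes a b :: real
  assumes "\<And>t. 0 \<le> 2 * t * a + t\<^sup>2 * b"
  shows "a = 0"
proof (rule ccontr)
  assume a: "a \<noteq> 0"
  \<comment> \<open>A positive number above \<open>b\<close>: at \<open>t = - a / c\<close> the
    quadratic is then at most \<open>- a^2 / c\<close>.\<close>
  define c where "c = \<bar>b\<bar> + 1"
  have c: "c > 0" "b < c" by (auto simp: c_def)
  have "0 \<le> 2 * (- a / c) * a + (- a / c)\<^sup>2 * b" by (rule assms)
  also have "\<dots> \<le> 2 * (- a / c) * a + (- a / c)\<^sup>2 * c" using c by (intro add_left_mono mult_left_mono) auto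
  also have "\<dots> = - (a\<^sup>2 / c)" using c by (simp add: power2_eq_square field_simps)
  also have "\<dots> < 0" using a c by simp
  finally show False by simp
qed

lemma set_integral_eq_integral:
  fixes f :: "'a::euclidean_space \<Rightarrow> 'b::{banach, second_countable_topology}"
  assumes "\<And>x. x \<notin> \<Omega> \<Longrightarrow> f x = 0"
  shows "(LINT x:\<Omega>|lborel. f x) = (LINT x|lborel. f x)"
  unfolding set_lebesgue_integral_def
  by (rule Bochner_Integration.integral_cong) (auto simp: indicator_def assms)

text \<open>Direct method. Concavity makes a maximising sequence of test functions Cauchy in the
  Dirichlet norm, hence in \<open>H^1\<close> by the Poincare inequality; the limit belongs to
  \<open>H1_0\<close> by construction, and the equation is the vanishing of the first
  variation.\<close>

lemma torsion_function_exists: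
  fixes \<Omega> :: "'a::euclidean_space set"
  assumes \<Omega>: "open \<Omega>" "bounded \<Omega>"
  obtains u where "torsion_function \<Omega> u" "(LINT x:\<Omega>|lborel. u x) = (SUP \<phi>\<in>{\<phi>. test_function \<Omega> \<phi>}. torsion_energy \<phi>)"
proof -
  obtain K where K: "\<And>\<phi>. test_function \<Omega> \<phi> \<Longrightarrow> torsion_energy \<phi> \<le> K"
    using torsion_energy_bounded[OF \<Omega>] by blast
  define T where "T = (SUP \<phi>\<in>{\<phi>. test_function \<Omega> \<phi>}. torsion_energy \<phi>)"
  have ne: "{\<phi>. test_function \<Omega> \<phi>} \<noteq> {}" using test_function_zero by blast
  have bdd: "bdd_above (torsion_energy ` {\<phi>. test_function \<Omega> \<phi>})" by (rule bdd_aboveI[where M=K]) (use K in auto)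
  have T: "torsion_energy \<phi> \<le> T" if "test_function \<Omega> \<phi>" for \<phi>
    unfolding T_def using that by (intro cSUP_upper bdd) auto
  have "\<exists>\<phi>. test_function \<Omega> \<phi> \<and> T - 1 / Suc n < torsion_energy \<phi>" for n
  proof -
    have "T - 1 / Suc n < T" by simp
    then show ?thesis unfolding T_def using less_cSUP_iff[OF ne bdd] by auto
  qed
  then obtain \<phi> where \<phi>: "\<And>n. test_function \<Omega> (\<phi> n)" and \<phi>T: "\<And>n. T - 1 / Suc n < torsion_energy (\<phi> n)" by metis
  obtain R0 where R0: "\<And>x. x \<in> \<Omega> \<Longrightarrow> norm x \<le> R0" using \<Omega>(2) by (meson bounded_iff)
  note sq = test_function_square_integrable[OF \<phi>]
  have fm: "\<Omega> \<in> fmeasurable lborel" using \<Omega> by (intro bounded_fmeasurable borel_open)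
  have [measurable]: "\<Omega> \<in> sets borel" using \<Omega>(1) by (rule borel_open)
  \<comment> \<open>Function and gradient are bundled into one vector-valued map, so that a single
    use of completeness yields both limits.\<close>
  define F where "F n x = (\<phi> n x, grad (\<phi> n) x)" for n x
  have nF: "(norm (F m x - F n x))\<^sup>2 = (\<phi> m x - \<phi> n x)\<^sup>2 + (norm (grad (\<phi> m) x - grad (\<phi> n) x))\<^sup>2" for m n x
    by (simp add: F_def norm_Pair)
  have F_sq: "square_integrable (F n)" for n
  proof (rule square_integrable_bound)
    show "F n \<in> borel_measurable borel" unfolding F_def borel_prod[symmetric]
      using square_integrableD(1)[OF sq(1)[of n]] square_integrableD(1)[OF sq(2)[of n]] by measurable
    show "integrable lborel (\<lambda>x. (norm (\<phi> n x))\<^sup>2 + (norm (grad (\<phi> n) x))\<^sup>2)"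
      using sq[of n] by (auto simp: square_integrable_def)
  qed (simp add: F_def norm_Pair)
  have diff: "test_function \<Omega> (\<lambda>x. \<phi> m x - \<phi> n x)" "grad (\<lambda>x. \<phi> m x - \<phi> n x) x = grad (\<phi> m) x - grad (\<phi> n) x" for m n x
    using test_function_add_scaled[OF \<phi>[of m] \<phi>[of n], of "-1"] by simp_all
  have grad_Cauchy: "(LINT x|lborel. (norm (grad (\<phi> m) x - grad (\<phi> n) x))\<^sup>2) \<le> 2 * (1 / Suc m + 1 / Suc n)" for m n
  proof -
    define D where "D = (LINT x|lborel. (norm (grad (\<phi> m) x - grad (\<phi> n) x))\<^sup>2)"
    define p where "p = (LINT x|lborel. \<phi> m x - \<phi> n x) - (LINT x|lborel. grad (\<phi> n) x \<bullet> grad (\<lambda>x. \<phi> m x - \<phi> n x) x)"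
    have e: "torsion_energy (\<lambda>x. \<phi> n x + t * (\<phi> m x - \<phi> n x)) = torsion_energy (\<phi> n) + 2 * t * p - t\<^sup>2 * D" for t
      using torsion_energy_add_scaled[OF \<phi>[of n] diff(1)[of m n], of t] by (simp add: p_def D_def diff(2))
    have "torsion_energy (\<phi> m) = torsion_energy (\<phi> n) + 2 * p - D" using e[of 1] by simp
    \<comment> \<open>The midpoint of \<open>\<phi> m\<close> and \<open>\<phi> n\<close> is a
      competitor as well; its energy exceeds the mean of the two energies by \<open>D / 4\<close>,
      while both energies are already close to \<open>T\<close>.\<close>
    moreover have "torsion_energy (\<phi> n) + p - D / 4 \<le> T"
      using e[of "1/2"] T[OF test_function_add_scaled(1)[OF \<phi>[of n] diff(1)[of m n], of "1/2"]]
      by (simp add: power2_eq_square)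
    ultimately have "D \<le> 4 * T - 2 * torsion_energy (\<phi> m) - 2 * torsion_energy (\<phi> n)" by linarith
    then show ?thesis using \<phi>T[of m] \<phi>T[of n] unfolding D_def by argo
  qed
  define C where "C = 4 * R0\<^sup>2 + 1"
  have C: "C > 0" by (simp add: C_def add_nonneg_pos)
  have F_Cauchy: "(LINT x|lborel. (norm (F m x - F n x))\<^sup>2) \<le> C * (2 * (1 / Suc m + 1 / Suc n))" for m n
  proof -
    have "(LINT x|lborel. (norm (F m x - F n x))\<^sup>2) = (LINT x|lborel. (\<phi> m x - \<phi> n x)\<^sup>2) + (LINT x|lborel. (norm (grad (\<phi> m) x - grad (\<phi> n) x))\<^sup>2)"
      unfolding nF using test_function_square_integrable[OF diff(1)[of m n]]
      by (intro Bochner_Integration.integral_add) (auto simp: square_integrable_def diff(2))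
    also have "\<dots> \<le> C * (LINT x|lborel. (norm (grad (\<phi> m) x - grad (\<phi> n) x))\<^sup>2)"
      using Poincare_test_function[OF R0 diff(1)[of m n]] by (simp add: C_def diff(2) algebra_simps)
    also have "\<dots> \<le> C * (2 * (1 / Suc m + 1 / Suc n))" using C grad_Cauchy by (intro mult_left_mono) auto
    finally show ?thesis .
  qed
  have F_out: "F n x = 0" if "x \<notin> \<Omega>" for n x
    using test_functionD(3,4)[OF \<phi> that] by (simp add: F_def zero_prod_def)
  have cau: "\<exists>N. \<forall>m\<ge>N. \<forall>n\<ge>N. (LINT x|lborel. (norm (F m x - F n x))\<^sup>2) < e" if e: "e > 0" for e :: real
  proof -
    obtain N where N: "4 * C / e < real N" using reals_Archimedean2 by blast
    have "(LINT x|lborel. (norm (F m x - F n x))\<^sup>2) < e" if "m \<ge> N" "n \<ge> N" for m n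
    proof -
      have Npos: "real (Suc N) > 0" by simp
      have "1 / Suc m \<le> 1 / real (Suc N)" "1 / Suc n \<le> 1 / real (Suc N)" using that by (auto intro!: divide_left_mono)
      then have "C * (2 * (1 / Suc m + 1 / Suc n)) \<le> C * (2 * (1 / Suc N + 1 / Suc N))"
        using C by (intro mult_left_mono add_mono) auto
      also have "\<dots> = 4 * C / Suc N" by simp
      also have "\<dots> < e"
      proof -
        have "4 * C < real N * e" using N e by (simp add: pos_divide_less_eq)
        also have "\<dots> \<le> real (Suc N) * e" using e by (intro mult_right_mono) auto
        finally show ?thesis by (simp add: pos_divide_less_eq mult.commute)
      qed
      finally show ?thesis using F_Cauchy[of m n] by linarith
    qed
    then show ?thesis by blast
  qed
  obtain G where G: "square_integrable G" "\<And>x. x \<notin> \<Omega> \<Longrightarrow> G x = 0"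
    and G_lim: "(\<lambda>n. LINT x|lborel. (norm (F n x - G x))\<^sup>2) \<longlonglongrightarrow> 0"
    using square_integrable_complete[OF F_sq F_out fm cau] by blast
  define u g where "u x = fst (G x)" and "g x = snd (G x)" for x
  have G_eq: "G x = (u x, g x)" for x by (simp add: u_def g_def)
  have Gm: "G \<in> borel_measurable borel" and Gi: "integrable lborel (\<lambda>x. (norm (G x))\<^sup>2)"
    using G(1) by (auto simp: square_integrable_def)
  have nG: "(norm (G x))\<^sup>2 = (u x)\<^sup>2 + (norm (g x))\<^sup>2" for x by (simp add: G_eq norm_Pair)
  have um: "u \<in> borel_measurable borel" and gm: "g \<in> borel_measurable borel"
    using Gm unfolding u_def[abs_def] g_def[abs_def] borel_prod[symmetric] by measurable
  have u_sq: "square_integrable u" and g_sq: "square_integrable g"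
    by (rule square_integrable_bound[OF _ Gi]; use um gm nG in simp)+
  have out: "u x = 0" "g x = 0" if "x \<notin> \<Omega>" for x using G(2)[OF that] by (auto simp: u_def g_def)
  have nFG: "(norm (F n x - G x))\<^sup>2 = (\<phi> n x - u x)\<^sup>2 + (norm (grad (\<phi> n) x - g x))\<^sup>2" for n x
    by (simp add: F_def G_eq norm_Pair)
  have split: "(LINT x|lborel. (norm (F n x - G x))\<^sup>2) = (LINT x|lborel. (norm (\<phi> n x - u x))\<^sup>2) + (LINT x|lborel. (norm (grad (\<phi> n) x - g x))\<^sup>2)" for n
    unfolding nFG using square_integrable_diff[OF sq(1)[of n] u_sq] square_integrable_diff[OF sq(2)[of n] g_sq]
    by (subst Bochner_Integration.integral_add) (auto simp: square_integrable_def)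
  have u_lim: "(\<lambda>n. LINT x|lborel. (norm (\<phi> n x - u x))\<^sup>2) \<longlonglongrightarrow> 0"
    by (rule tendsto_sandwich[OF _ _ tendsto_const G_lim]) (auto simp: split intro!: always_eventually)
  have g_lim: "(\<lambda>n. LINT x|lborel. (norm (grad (\<phi> n) x - g x))\<^sup>2) \<longlonglongrightarrow> 0"
    by (rule tendsto_sandwich[OF _ _ tendsto_const G_lim]) (auto simp: split intro!: always_eventually)
  have ind_sq: "square_integrable (indicator \<Omega> :: 'a \<Rightarrow> real)"
  proof (rule square_integrable_bound)
    show "integrable lborel (indicator \<Omega> :: 'a \<Rightarrow> real)" using fm by (simp add: integrable_indicator_iff fmeasurable_def)
  qed (auto simp: indicator_def)
  have ind_mult: "(LINT x|lborel. v x \<bullet> indicator \<Omega> x) = (LINT x|lborel. v x)" if "\<And>x. x \<notin> \<Omega> \<Longrightarrow> v x = 0" for v :: "'a \<Rightarrow> real"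
    by (rule Bochner_Integration.integral_cong) (auto simp: indicator_def that)
  have int_u: "(\<lambda>n. LINT x|lborel. \<phi> n x) \<longlonglongrightarrow> (LINT x|lborel. u x)"
  proof -
    have 1: "(LINT x|lborel. \<phi> n x \<bullet> indicator \<Omega> x) = (LINT x|lborel. \<phi> n x)" for n
      by (rule ind_mult) (rule test_functionD(3)[OF \<phi>])
    have 2: "(LINT x|lborel. u x \<bullet> indicator \<Omega> x) = (LINT x|lborel. u x)"
      by (rule ind_mult) (rule out(1))
    show ?thesis using tendsto_integral_inner[OF sq(1) u_sq ind_sq u_lim] unfolding 1 2 .
  qed
  have g_test: "(\<lambda>n. LINT x|lborel. grad (\<phi> n) x \<bullet> v x) \<longlonglongrightarrow> (LINT x|lborel. g x \<bullet> v x)" if "square_integrable v" for v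
    by (rule tendsto_integral_inner[OF sq(2) g_sq that g_lim])
  have g_norm: "(\<lambda>n. LINT x|lborel. (norm (grad (\<phi> n) x))\<^sup>2) \<longlonglongrightarrow> (LINT x|lborel. (norm (g x))\<^sup>2)"
    by (rule tendsto_integral_norm_sq[OF sq(2) g_sq g_lim])
  have energy_lim: "(\<lambda>n. torsion_energy (\<phi> n)) \<longlonglongrightarrow> T"
  proof (rule tendsto_sandwich)
    show "(\<lambda>n. T - 1 / Suc n) \<longlonglongrightarrow> T"
      using tendsto_diff[OF tendsto_const LIMSEQ_inverse_real_of_nat, of T] by (simp only: inverse_eq_divide diff_0_right)
    show "\<forall>\<^sub>F n in sequentially. T - 1 / real (Suc n) \<le> torsion_energy (\<phi> n)"
      by (intro always_eventually allI less_imp_le \<phi>T)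
    show "\<forall>\<^sub>F n in sequentially. torsion_energy (\<phi> n) \<le> T" by (intro always_eventually allI T \<phi>)
  qed (rule tendsto_const)
  have "(\<lambda>n. torsion_energy (\<phi> n)) \<longlonglongrightarrow> 2 * (LINT x|lborel. u x) - (LINT x|lborel. (norm (g x))\<^sup>2)"
    unfolding torsion_energy_def by (intro tendsto_intros int_u g_norm)
  then have T_eq: "T = 2 * (LINT x|lborel. u x) - (LINT x|lborel. (norm (g x))\<^sup>2)"
    using energy_lim LIMSEQ_unique by blast
  have EL: "(LINT x|lborel. g x \<bullet> grad \<psi> x) = (LINT x|lborel. \<psi> x)" if \<psi>: "test_function \<Omega> \<psi>" for \<psi>
  proof -
    let ?N = "LINT x|lborel. (norm (grad \<psi> x))\<^sup>2"
    \<comment> \<open>The competitors \<open>\<phi> n x + t * \<psi> x\<close> never exceed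
      \<open>T\<close>; as \<open>n\<close> grows this leaves a quadratic in \<open>t\<close> that
      is nonnegative everywhere, so its linear coefficient vanishes.\<close>
    have "0 \<le> 2 * t * ((LINT x|lborel. g x \<bullet> grad \<psi> x) - (LINT x|lborel. \<psi> x)) + t\<^sup>2 * ?N" for t
    proof -
      have "(\<lambda>n. torsion_energy (\<lambda>x. \<phi> n x + t * \<psi> x)) \<longlonglongrightarrow>
          T + 2 * t * ((LINT x|lborel. \<psi> x) - (LINT x|lborel. g x \<bullet> grad \<psi> x)) - t\<^sup>2 * ?N"
        unfolding torsion_energy_add_scaled[OF \<phi> \<psi>]
        by (intro tendsto_intros energy_lim g_test test_function_square_integrable(2)[OF \<psi>])
      then have "T + 2 * t * ((LINT x|lborel. \<psi> x) - (LINT x|lborel. g x \<bullet> grad \<psi> x)) - t\<^sup>2 * ?N \<le> T"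
        by (rule LIMSEQ_le_const2) (auto intro!: T test_function_add_scaled(1)[OF \<phi> \<psi>])
      then show ?thesis by (simp add: algebra_simps)
    qed
    from quadratic_nonneg_imp_zero[OF this] show ?thesis by simp
  qed
  \<comment> \<open>The limit \<open>u\<close> need not be a test function, so the equation is
    tested with \<open>\<phi> n\<close> and passed to the limit. The integral of \<open>u\<close>
    then equals the Dirichlet energy, which identifies it with \<open>T\<close>.\<close>
  have "(\<lambda>n. LINT x|lborel. grad (\<phi> n) x \<bullet> g x) \<longlonglongrightarrow> (LINT x|lborel. g x \<bullet> g x)" by (rule g_test[OF g_sq])
  moreover have "(LINT x|lborel. grad (\<phi> n) x \<bullet> g x) = (LINT x|lborel. \<phi> n x)" for n
    using EL[OF \<phi>[of n]] by (simp add: inner_commute)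
  ultimately have "(LINT x|lborel. g x \<bullet> g x) = (LINT x|lborel. u x)"
    using int_u LIMSEQ_unique by auto
  then have T_u: "T = (LINT x|lborel. u x)" using T_eq by (simp add: power2_norm_eq_inner)
  have L2: "L2_on \<Omega> v" if "square_integrable v" for v :: "'a \<Rightarrow> 'c::euclidean_space"
  proof -
    have [measurable]: "v \<in> borel_measurable borel" using that by (rule square_integrableD)
    have "integrable lborel (\<lambda>x. indicator \<Omega> x *\<^sub>R (norm (v x))\<^sup>2)"
      using square_integrableD(2)[OF that] by (intro integrable_mult_indicator) auto
    then show ?thesis unfolding L2_on_def set_borel_measurable_def set_integrable_def by simp
  qed
  \<comment> \<open>In each coordinate the identity is integration by parts for the smooth
    \<open>\<phi> n\<close>, and both sides are continuous under the \<open>L^2\<close>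
    limits.\<close>
  have wg: "weak_gradient \<Omega> u g"
    unfolding weak_gradient_def
  proof (intro allI impI)
    fix \<psi> assume \<psi>: "test_function \<Omega> \<psi>"
    note \<psi>D = test_functionD[OF \<psi>] and \<psi>sq = test_function_square_integrable[OF \<psi>]
    have i1: "integrable lborel (\<lambda>x. u x *\<^sub>R grad \<psi> x)"
    proof (rule Bochner_Integration.integrable_bound[where f="\<lambda>x. (norm (u x))\<^sup>2 + (norm (grad \<psi> x))\<^sup>2"])
      show "AE x in lborel. norm (u x *\<^sub>R grad \<psi> x) \<le> norm ((norm (u x))\<^sup>2 + (norm (grad \<psi> x))\<^sup>2)"
      proof (rule AE_I2)
        fix x
        have "2 * (\<bar>u x\<bar> * norm (grad \<psi> x)) \<le> \<bar>u x\<bar>\<^sup>2 + (norm (grad \<psi> x))\<^sup>2" "0 \<le> \<bar>u x\<bar> * norm (grad \<psi> x)"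
          using sum_squares_bound[of "\<bar>u x\<bar>" "norm (grad \<psi> x)"] by (simp_all add: mult.assoc)
        then have "\<bar>u x\<bar> * norm (grad \<psi> x) \<le> \<bar>u x\<bar>\<^sup>2 + (norm (grad \<psi> x))\<^sup>2" by linarith
        then show "norm (u x *\<^sub>R grad \<psi> x) \<le> norm ((norm (u x))\<^sup>2 + (norm (grad \<psi> x))\<^sup>2)" by simp
      qed
      show "(\<lambda>x. u x *\<^sub>R grad \<psi> x) \<in> borel_measurable lborel"
        using um square_integrableD(1)[OF \<psi>sq(2)] by simp
    qed (use u_sq \<psi>sq in \<open>auto simp: square_integrable_def\<close>)
    have i2: "integrable lborel (\<lambda>x. \<psi> x *\<^sub>R g x)"
    proof (rule Bochner_Integration.integrable_bound[where f="\<lambda>x. (norm (\<psi> x))\<^sup>2 + (norm (g x))\<^sup>2"])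
      show "AE x in lborel. norm (\<psi> x *\<^sub>R g x) \<le> norm ((norm (\<psi> x))\<^sup>2 + (norm (g x))\<^sup>2)"
      proof (rule AE_I2)
        fix x
        have "2 * (\<bar>\<psi> x\<bar> * norm (g x)) \<le> \<bar>\<psi> x\<bar>\<^sup>2 + (norm (g x))\<^sup>2" "0 \<le> \<bar>\<psi> x\<bar> * norm (g x)"
          using sum_squares_bound[of "\<bar>\<psi> x\<bar>" "norm (g x)"] by (simp_all add: mult.assoc)
        then have "\<bar>\<psi> x\<bar> * norm (g x) \<le> \<bar>\<psi> x\<bar>\<^sup>2 + (norm (g x))\<^sup>2" by linarith
        then show "norm (\<psi> x *\<^sub>R g x) \<le> norm ((norm (\<psi> x))\<^sup>2 + (norm (g x))\<^sup>2)" by simp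
      qed
      show "(\<lambda>x. \<psi> x *\<^sub>R g x) \<in> borel_measurable lborel"
        using gm square_integrableD(1)[OF \<psi>sq(1)] by simp
    qed (use g_sq \<psi>sq in \<open>auto simp: square_integrable_def\<close>)
    have "(LINT x|lborel. u x *\<^sub>R grad \<psi> x) = - (LINT x|lborel. \<psi> x *\<^sub>R g x)"
    proof (rule euclidean_eqI)
      fix b :: 'a assume b: "b \<in> Basis"
      have nb: "norm b = 1" using b by simp
      let ?D = "\<lambda>x. frechet_derivative \<psi> (at x) b"
      have D_sq: "square_integrable ?D"
      proof (rule square_integrable_bound[OF _ square_integrableD(2)[OF \<psi>sq(2)]])
        show "?D \<in> borel_measurable borel"
          by (intro borel_measurable_continuous_onI C_k_1_frechet_continuous \<psi>D(1))
        show "(norm (?D x))\<^sup>2 \<le> (norm (grad \<psi> x))\<^sup>2" for x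
          using Basis_le_norm[OF b, of "grad \<psi> x"] by (simp add: grad_inner[OF \<psi>D(1)] abs_le_square_iff[symmetric])
      qed
      have [measurable]: "\<psi> \<in> borel_measurable borel" using \<psi>sq(1) by (rule square_integrableD)
      have \<psi>b_sq: "square_integrable (\<lambda>x. \<psi> x *\<^sub>R b)"
        unfolding square_integrable_def using square_integrableD(2)[OF \<psi>sq(1)] nb by simp
      have "(\<lambda>n. LINT x|lborel. \<phi> n x \<bullet> ?D x) \<longlonglongrightarrow> (LINT x|lborel. u x \<bullet> ?D x)"
        by (rule tendsto_integral_inner[OF sq(1) u_sq D_sq u_lim])
      moreover have "(\<lambda>n. - (LINT x|lborel. grad (\<phi> n) x \<bullet> (\<psi> x *\<^sub>R b))) \<longlonglongrightarrow> - (LINT x|lborel. g x \<bullet> (\<psi> x *\<^sub>R b))"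
        by (intro tendsto_minus g_test \<psi>b_sq)
      moreover have "(LINT x|lborel. \<phi> n x \<bullet> ?D x) = - (LINT x|lborel. grad (\<phi> n) x \<bullet> (\<psi> x *\<^sub>R b))" for n
        using integral_mult_frechet(1)[OF test_functionD(1)[OF \<phi>[of n]] \<psi>D(1,2) nb]
        by (simp add: grad_inner[OF test_functionD(1)[OF \<phi>]] mult.commute)
      ultimately have "(LINT x|lborel. u x \<bullet> ?D x) = - (LINT x|lborel. g x \<bullet> (\<psi> x *\<^sub>R b))"
        using LIMSEQ_unique by auto
      moreover have "(LINT x|lborel. u x *\<^sub>R grad \<psi> x) \<bullet> b = (LINT x|lborel. u x \<bullet> ?D x)"
        by (subst integral_inner_left[symmetric]) (use i1 in \<open>auto simp: grad_inner[OF \<psi>D(1)]\<close>)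
      moreover have "(LINT x|lborel. \<psi> x *\<^sub>R g x) \<bullet> b = (LINT x|lborel. g x \<bullet> (\<psi> x *\<^sub>R b))"
        by (subst integral_inner_left[symmetric]) (use i2 in auto)
      ultimately show "(LINT x|lborel. u x *\<^sub>R grad \<psi> x) \<bullet> b = (- (LINT x|lborel. \<psi> x *\<^sub>R g x)) \<bullet> b"
        by simp
    qed
    then show "(LINT x:\<Omega>|lborel. u x *\<^sub>R grad \<psi> x) = - (LINT x:\<Omega>|lborel. \<psi> x *\<^sub>R g x)"
      by (simp add: set_integral_eq_integral out)
  qed
  have H10: "H1_0 \<Omega> u g"
    unfolding H1_0_def H1_def
  proof (intro conjI exI[of _ \<phi>] L2 u_sq g_sq wg allI \<phi>)
    have "(LINT x:\<Omega>|lborel. (\<phi> n x - u x)\<^sup>2) = (LINT x|lborel. (norm (\<phi> n x - u x))\<^sup>2)" for n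
      using out test_functionD(3)[OF \<phi>] by (subst set_integral_eq_integral) auto
    then show "(\<lambda>n. LINT x:\<Omega>|lborel. (\<phi> n x - u x)\<^sup>2) \<longlonglongrightarrow> 0" using u_lim by simp
    have "(LINT x:\<Omega>|lborel. (norm (grad (\<phi> n) x - g x))\<^sup>2) = (LINT x|lborel. (norm (grad (\<phi> n) x - g x))\<^sup>2)" for n
      using out test_functionD(4)[OF \<phi>] by (subst set_integral_eq_integral) auto
    then show "(\<lambda>n. LINT x:\<Omega>|lborel. (norm (grad (\<phi> n) x - g x))\<^sup>2) \<longlonglongrightarrow> 0" using g_lim by simp
  qed
  show thesis
  proof (rule that)
    have "(LINT x:\<Omega>|lborel. g x \<bullet> grad \<psi> x) = (LINT x:\<Omega>|lborel. \<psi> x)" if \<psi>: "test_function \<Omega> \<psi>" for \<psi>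
      using EL[OF \<psi>] out test_functionD(3)[OF \<psi>] by (simp add: set_integral_eq_integral)
    then show "torsion_function \<Omega> u" unfolding torsion_function_def using H10 by blast
    show "(LINT x:\<Omega>|lborel. u x) = (SUP \<phi>\<in>{\<phi>. test_function \<Omega> \<phi>}. torsion_energy \<phi>)"
      using T_u out by (simp add: T_def set_integral_eq_integral)
  qed
qed

text \<open>Symmetry replaces uniqueness of the weak solution: testing the equation of one solution with
  the approximations of the other shows that both integrals equal the mixed Dirichlet integral.\<close>

lemma torsion_function_integral_unique:
  fixes \<Omega> :: "'a::euclidean_space set"
  assumes \<Omega>: "open \<Omega>" "bounded \<Omega>" and u: "torsion_function \<Omega> u" and v: "torsion_function \<Omega> v"
  shows "(LINT x:\<Omega>|lborel. u x) = (LINT x:\<Omega>|lborel. v x)"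
proof -
  have fm: "\<Omega> \<in> fmeasurable lborel" using \<Omega> by (intro bounded_fmeasurable borel_open)
  have ind_sq: "square_integrable (indicator \<Omega> :: 'a \<Rightarrow> real)"
  proof (rule square_integrable_bound)
    show "integrable lborel (indicator \<Omega> :: 'a \<Rightarrow> real)" using fm by (simp add: integrable_indicator_iff fmeasurable_def)
    show "(indicator \<Omega> :: 'a \<Rightarrow> real) \<in> borel_measurable borel"
      using fm by (intro borel_measurable_indicator) (simp add: fmeasurable_def)
  qed (auto simp: indicator_def)
  have L2: "square_integrable (\<lambda>x. indicator \<Omega> x *\<^sub>R w x)" if "L2_on \<Omega> w" for w :: "'a \<Rightarrow> 'c::euclidean_space"
  proof -
    have "(\<lambda>x. (norm (indicator \<Omega> x *\<^sub>R w x))\<^sup>2) = (\<lambda>x. indicator \<Omega> x *\<^sub>R (norm (w x))\<^sup>2)"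
      by (auto simp: indicator_def)
    then show ?thesis
      using that unfolding L2_on_def square_integrable_def set_borel_measurable_def set_integrable_def by simp
  qed
  have mixed: "(LINT x:\<Omega>|lborel. u x) = (LINT x|lborel. (indicator \<Omega> x *\<^sub>R g x) \<bullet> (indicator \<Omega> x *\<^sub>R g' x))"
    if H: "H1_0 \<Omega> u g" and sq': "square_integrable (\<lambda>x. indicator \<Omega> x *\<^sub>R g' x)"
      and E: "\<And>\<phi>. test_function \<Omega> \<phi> \<Longrightarrow> (LINT x:\<Omega>|lborel. g' x \<bullet> grad \<phi> x) = (LINT x:\<Omega>|lborel. \<phi> x)" for u g g'
  proof -
    obtain \<phi> where \<phi>: "\<And>n. test_function \<Omega> (\<phi> n)"
      and ul: "(\<lambda>n. LINT x:\<Omega>|lborel. (\<phi> n x - u x)\<^sup>2) \<longlonglongrightarrow> 0"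
      and gl: "(\<lambda>n. LINT x:\<Omega>|lborel. (norm (grad (\<phi> n) x - g x))\<^sup>2) \<longlonglongrightarrow> 0"
      using H unfolding H1_0_def by blast
    note sq = test_function_square_integrable[OF \<phi>]
    have uq: "square_integrable (\<lambda>x. indicator \<Omega> x *\<^sub>R u x)" and gq: "square_integrable (\<lambda>x. indicator \<Omega> x *\<^sub>R g x)"
    proof -
      have "L2_on \<Omega> u" "L2_on \<Omega> g" using H unfolding H1_0_def H1_def by blast+
      from this[THEN L2] show "square_integrable (\<lambda>x. indicator \<Omega> x *\<^sub>R u x)" "square_integrable (\<lambda>x. indicator \<Omega> x *\<^sub>R g x)" .
    qed
    have "(LINT x:\<Omega>|lborel. (\<phi> n x - u x)\<^sup>2) = (LINT x|lborel. (norm (\<phi> n x - indicator \<Omega> x *\<^sub>R u x))\<^sup>2)" for n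
      unfolding set_lebesgue_integral_def
      by (rule Bochner_Integration.integral_cong) (auto simp: indicator_def test_functionD(3)[OF \<phi>])
    then have ul': "(\<lambda>n. LINT x|lborel. (norm (\<phi> n x - indicator \<Omega> x *\<^sub>R u x))\<^sup>2) \<longlonglongrightarrow> 0" using ul by simp
    have "(LINT x:\<Omega>|lborel. (norm (grad (\<phi> n) x - g x))\<^sup>2) = (LINT x|lborel. (norm (grad (\<phi> n) x - indicator \<Omega> x *\<^sub>R g x))\<^sup>2)" for n
      unfolding set_lebesgue_integral_def
      by (rule Bochner_Integration.integral_cong) (auto simp: indicator_def test_functionD(4)[OF \<phi>])
    then have gl': "(\<lambda>n. LINT x|lborel. (norm (grad (\<phi> n) x - indicator \<Omega> x *\<^sub>R g x))\<^sup>2) \<longlonglongrightarrow> 0" using gl by simp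
    have "(\<lambda>n. LINT x|lborel. \<phi> n x \<bullet> indicator \<Omega> x) \<longlonglongrightarrow> (LINT x|lborel. (indicator \<Omega> x *\<^sub>R u x) \<bullet> indicator \<Omega> x)"
      by (rule tendsto_integral_inner[OF sq(1) uq ind_sq ul'])
    moreover have "(LINT x|lborel. \<phi> n x \<bullet> indicator \<Omega> x) = (LINT x:\<Omega>|lborel. \<phi> n x)" for n
      unfolding set_lebesgue_integral_def by (simp add: mult.commute)
    moreover have "(LINT x|lborel. (indicator \<Omega> x *\<^sub>R u x) \<bullet> indicator \<Omega> x) = (LINT x:\<Omega>|lborel. u x)"
      unfolding set_lebesgue_integral_def by (rule Bochner_Integration.integral_cong) (auto simp: indicator_def)
    ultimately have 1: "(\<lambda>n. LINT x:\<Omega>|lborel. \<phi> n x) \<longlonglongrightarrow> (LINT x:\<Omega>|lborel. u x)" by simp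
    have "(\<lambda>n. LINT x|lborel. grad (\<phi> n) x \<bullet> (indicator \<Omega> x *\<^sub>R g' x)) \<longlonglongrightarrow> (LINT x|lborel. (indicator \<Omega> x *\<^sub>R g x) \<bullet> (indicator \<Omega> x *\<^sub>R g' x))"
      by (rule tendsto_integral_inner[OF sq(2) gq sq' gl'])
    moreover have "(LINT x|lborel. grad (\<phi> n) x \<bullet> (indicator \<Omega> x *\<^sub>R g' x)) = (LINT x:\<Omega>|lborel. \<phi> n x)" for n
    proof -
      have "(LINT x|lborel. grad (\<phi> n) x \<bullet> (indicator \<Omega> x *\<^sub>R g' x)) = (LINT x:\<Omega>|lborel. g' x \<bullet> grad (\<phi> n) x)"
        unfolding set_lebesgue_integral_def by (simp add: inner_commute)
      also have "\<dots> = (LINT x:\<Omega>|lborel. \<phi> n x)" by (rule E[OF \<phi>])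
      finally show ?thesis .
    qed
    ultimately show ?thesis using 1 LIMSEQ_unique by auto
  qed
  obtain g where g: "H1_0 \<Omega> u g" "\<And>\<phi>. test_function \<Omega> \<phi> \<Longrightarrow> (LINT x:\<Omega>|lborel. g x \<bullet> grad \<phi> x) = (LINT x:\<Omega>|lborel. \<phi> x)"
    using u unfolding torsion_function_def by blast
  obtain g' where g': "H1_0 \<Omega> v g'" "\<And>\<phi>. test_function \<Omega> \<phi> \<Longrightarrow> (LINT x:\<Omega>|lborel. g' x \<bullet> grad \<phi> x) = (LINT x:\<Omega>|lborel. \<phi> x)"
    using v unfolding torsion_function_def by blast
  have gq: "square_integrable (\<lambda>x. indicator \<Omega> x *\<^sub>R g x)" "square_integrable (\<lambda>x. indicator \<Omega> x *\<^sub>R g' x)"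
  proof -
    have "L2_on \<Omega> g" "L2_on \<Omega> g'" using g(1) g'(1) unfolding H1_0_def H1_def by blast+
    from this[THEN L2] show "square_integrable (\<lambda>x. indicator \<Omega> x *\<^sub>R g x)" "square_integrable (\<lambda>x. indicator \<Omega> x *\<^sub>R g' x)" .
  qed
  show ?thesis
    using mixed[OF g(1) gq(2) g'(2)] mixed[OF g'(1) gq(1) g(2)] by (simp add: inner_commute)
qed

text \<open>Existence of a solution and uniqueness of its integral make the definite description
  meaningful. From here on only smooth compactly supported functions are estimated: each of them
  bounds the torsional rigidity from below, a bound uniform over all of them from above.\<close>

theorem torsional_rigidity_eq_SUP:
  fixes \<Omega> :: "'a::euclidean_space set"
  assumes \<Omega>: "open \<Omega>" "bounded \<Omega>"
  shows "torsional_rigidity \<Omega> = (SUP \<phi>\<in>{\<phi>. test_function \<Omega> \<phi>}. torsion_energy \<phi>)"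
proof -
  obtain u where u: "torsion_function \<Omega> u" "(LINT x:\<Omega>|lborel. u x) = (SUP \<phi>\<in>{\<phi>. test_function \<Omega> \<phi>}. torsion_energy \<phi>)"
    using torsion_function_exists[OF \<Omega>] by blast
  show ?thesis unfolding torsional_rigidity_def
  proof (rule the_equality)
    show "\<exists>u. torsion_function \<Omega> u \<and> (SUP \<phi>\<in>{\<phi>. test_function \<Omega> \<phi>}. torsion_energy \<phi>) = (LINT x:\<Omega>|lborel. u x)"
      using u by metis
    fix T assume "\<exists>u. torsion_function \<Omega> u \<and> T = (LINT x:\<Omega>|lborel. u x)"
    then show "T = (SUP \<phi>\<in>{\<phi>. test_function \<Omega> \<phi>}. torsion_energy \<phi>)"
      using u torsion_function_integral_unique[OF \<Omega>] by metis
  qed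
qed

lemma torsional_rigidity_ge:
  assumes "open \<Omega>" "bounded \<Omega>" "test_function \<Omega> \<phi>"
  shows "torsion_energy \<phi> \<le> torsional_rigidity \<Omega>"
proof -
  obtain K where "\<And>\<phi>. test_function \<Omega> \<phi> \<Longrightarrow> torsion_energy \<phi> \<le> K"
    using torsion_energy_bounded[OF assms(1,2)] by blast
  then show ?thesis unfolding torsional_rigidity_eq_SUP[OF assms(1,2)]
    using assms(3) by (intro cSUP_upper bdd_aboveI[where M=K]) auto
qed

lemma torsional_rigidity_le:
  assumes "open \<Omega>" "bounded \<Omega>" "\<And>\<phi>. test_function \<Omega> \<phi> \<Longrightarrow> torsion_energy \<phi> \<le> K"
  shows "torsional_rigidity \<Omega> \<le> K"
  unfolding torsional_rigidity_eq_SUP[OF assms(1,2)]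
  using assms(3) test_function_zero by (intro cSUP_least) auto

section \<open>Smooth approximations\<close>

text \<open>Finitely many bumps on balls inside \<open>A\<close> have a sum that is bounded below on
  \<open>K\<close> by a positive constant; amplifying the sum pushes \<open>smooth_step\<close>
  towards 1. Since that limit is approached only at infinity, the cutoff comes close to 1 on
  \<open>K\<close> without reaching it.\<close>

lemma smooth_cutoff:
  fixes A :: "'a::euclidean_space set"
  assumes A: "open A" and K: "compact K" "K \<subseteq> A" and e: "e > 0"
  obtains \<eta> :: "'a \<Rightarrow> real" where "\<And>k. C_k k \<eta>" "compact (supp \<eta>)" "supp \<eta> \<subseteq> A"
    "\<And>s. 0 \<le> \<eta> s" "\<And>s. \<eta> s \<le> 1" "\<And>s. s \<in> K \<Longrightarrow> \<eta> s > 1 - e"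
proof -
  have "\<forall>x\<in>K. \<exists>r>0. cball x r \<subseteq> A" using A K(2) open_contains_cball by blast
  then obtain r where r: "\<And>x. x \<in> K \<Longrightarrow> r x > 0" "\<And>x. x \<in> K \<Longrightarrow> cball x (r x) \<subseteq> A" by metis
  have cover: "K \<subseteq> (\<Union>x\<in>K. ball x (r x))" using r(1) by fastforce
  obtain D where D: "D \<subseteq> K" "finite D" "K \<subseteq> (\<Union>x\<in>D. ball x (r x))"
    by (rule compactE_image[OF K(1) open_ball cover])
  \<comment> \<open>The squared radius minus the squared distance is a polynomial in
    \<open>s\<close> that is positive exactly on the ball, so each summand is smooth and vanishes
    off that ball.\<close>
  define G where "G s = (\<Sum>x\<in>D. smooth_step ((r x)\<^sup>2 - (s - x) \<bullet> (s - x)))" for s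
  define K' where "K' = (\<Union>x\<in>D. cball x (r x))"
  have K': "compact K'" "K' \<subseteq> A" using D r(2) by (auto simp: K'_def)
  have sq: "C_k k (\<lambda>s. (s - x) \<bullet> (s - x))" for k and x :: 'a
  proof -
    have "C_k k (\<lambda>s. \<Sum>b\<in>Basis. ((s - x) \<bullet> b) * ((s - x) \<bullet> b))"
      by (intro C_k_sum C_k_mult C_k_linear_left[OF bounded_linear_inner_left] C_k_diff C_k_linear[OF bounded_linear_ident] C_k_const)
    then show ?thesis by (simp add: euclidean_inner[symmetric])
  qed
  have G: "C_k k G" for k
    unfolding G_def[abs_def] by (intro C_k_sum C_k_smooth_step C_k_diff C_k_const sq)
  have d2: "(dist x s)\<^sup>2 = (s - x) \<bullet> (s - x)" for x s :: 'a
    by (subst dist_commute) (simp only: dist_norm power2_norm_eq_inner)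
  have G_out: "G s = 0" if "s \<notin> K'" for s
    unfolding G_def
  proof (rule sum.neutral, intro ballI smooth_step_eq_0)
    fix x assume "x \<in> D"
    then have "r x < dist x s" "r x > 0" using that r(1) D(1) by (auto simp: K'_def)
    then have "(r x)\<^sup>2 \<le> (dist x s)\<^sup>2" by (intro power_mono) auto
    then show "(r x)\<^sup>2 - (s - x) \<bullet> (s - x) \<le> 0" unfolding d2 by simp
  qed
  have G_pos: "G s > 0" if sK: "s \<in> K" for s
  proof -
    obtain x where x: "x \<in> D" "dist x s < r x" using D(3) sK by auto
    then have "(dist x s)\<^sup>2 < (r x)\<^sup>2" by (intro power_strict_mono) auto
    then have "smooth_step ((r x)\<^sup>2 - (s - x) \<bullet> (s - x)) > 0"
      unfolding d2 by (intro smooth_step_pos) simp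
    then show ?thesis unfolding G_def using D(2) x(1) smooth_step_bounds(1) by (intro sum_pos2) auto
  qed
  obtain \<delta> where \<delta>: "\<delta> > 0" "\<And>s. s \<in> K \<Longrightarrow> \<delta> \<le> G s"
  proof (cases "K = {}")
    case False
    have "continuous_on K G" using C_k_cont[OF G] continuous_on_subset by blast
    then obtain s0 where "s0 \<in> K" "\<And>s. s \<in> K \<Longrightarrow> G s0 \<le> G s"
      using continuous_attains_inf[OF K(1) False] by blast
    then show ?thesis using G_pos that by blast
  qed (use that[of 1] in auto)
  have "\<forall>\<^sub>F y in at_top. smooth_step y > 1 - e"
    using order_tendstoD(1)[OF smooth_step_at_top] e by simp
  then obtain Y where Y: "\<And>y. y \<ge> Y \<Longrightarrow> smooth_step y > 1 - e" by (auto simp: eventually_at_top_linorder)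
  \<comment> \<open>Chosen so that \<open>m * G s - 1 \<ge> \<bar>Y\<bar>\<close> on
    \<open>K\<close>, where \<open>G s \<ge> \<delta>\<close>.\<close>
  define m where "m = (\<bar>Y\<bar> + 1) / \<delta>"
  have m: "m > 0" using \<delta>(1) by (simp add: m_def add_nonneg_pos)
  define \<eta> where "\<eta> s = smooth_step (m * G s - 1)" for s
  have sub: "supp \<eta> \<subseteq> K'"
    by (rule supp_subset_closed) (auto simp: \<eta>_def G_out smooth_step_eq_0 compact_imp_closed K')
  show thesis
  proof
    show "C_k k \<eta>" for k unfolding \<eta>_def[abs_def] by (intro C_k_smooth_step C_k_diff C_k_mult C_k_const G)
    have "supp \<eta> = K' \<inter> supp \<eta>" using sub by blast
    then show "compact (supp \<eta>)" using compact_Int_closed[OF K'(1), of "supp \<eta>"] by (simp add: supp_def)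
    show "supp \<eta> \<subseteq> A" using sub K'(2) by blast
    show "0 \<le> \<eta> s" "\<eta> s \<le> 1" for s by (auto simp: \<eta>_def smooth_step_bounds)
    show "\<eta> s > 1 - e" if "s \<in> K" for s
    proof -
      have "m * \<delta> \<le> m * G s" using m \<delta>(2)[OF that] by (intro mult_left_mono) auto
      then have "Y \<le> m * G s - 1" using \<delta>(1) by (simp add: m_def)
      then show ?thesis unfolding \<eta>_def by (rule Y)
    qed
  qed
qed

text \<open>The torsion profile and the perimeter field are built from \<open>f\<close> and
  \<open>g\<close>, which are merely continuous. On the compact support of a cutoff these are
  replaced by Stone-Weierstrass polynomials kept strictly between them, which later confines
  supports to the domain; elsewhere the polynomials are uncontrolled, but the cutoff
  vanishes.\<close>

lemma smooth_approximations:
  fixes A :: "'a::euclidean_space set" and f g :: "'a \<Rightarrow> real"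
  assumes A: "open A" and f: "continuous_on A f" and g: "continuous_on A g" and fg: "\<And>s. s \<in> A \<Longrightarrow> f s < g s"
  obtains \<eta> p q :: "nat \<Rightarrow> 'a \<Rightarrow> real" where
    "\<And>n k. C_k k (\<eta> n)" "\<And>n k. C_k k (p n)" "\<And>n k. C_k k (q n)"
    "\<And>n. compact (supp (\<eta> n))" "\<And>n. supp (\<eta> n) \<subseteq> A" "\<And>n s. 0 \<le> \<eta> n s" "\<And>n s. \<eta> n s \<le> 1"
    "\<And>n s. s \<in> supp (\<eta> n) \<Longrightarrow> f s < p n s \<and> p n s \<le> q n s \<and> q n s < g s"
    "\<And>s. s \<in> A \<Longrightarrow> (\<lambda>n. \<eta> n s) \<longlonglongrightarrow> 1" "\<And>s. s \<in> A \<Longrightarrow> (\<lambda>n. p n s) \<longlonglongrightarrow> f s" "\<And>s. s \<in> A \<Longrightarrow> (\<lambda>n. q n s) \<longlonglongrightarrow> g s"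
proof -
  define good where "good C \<longleftrightarrow> (\<forall>n. compact (C n) \<and> C n \<subseteq> A) \<and> (\<forall>K. compact K \<longrightarrow> K \<subseteq> A \<longrightarrow> (\<exists>N. \<forall>n\<ge>N. K \<subseteq> C n))"
    for C :: "nat \<Rightarrow> 'a set"
  have "\<exists>C. good C"
  proof (rule open_Union_compact_subsets[OF A])
    fix C :: "nat \<Rightarrow> 'a set"
    assume "\<And>n. compact (C n)" "\<And>n. C n \<subseteq> A" "\<And>K. compact K \<Longrightarrow> K \<subseteq> A \<Longrightarrow> \<exists>N. \<forall>n\<ge>N. K \<subseteq> C n"
    then have "good C" unfolding good_def by simp
    then show "\<exists>C. good C" by blast
  qed
  then obtain C where "good C" by blast
  then have C: "\<And>n. compact (C n)" "\<And>n. C n \<subseteq> A" and CA: "\<And>K. compact K \<Longrightarrow> K \<subseteq> A \<Longrightarrow> \<exists>N. \<forall>n\<ge>N. K \<subseteq> C n"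
    unfolding good_def by blast+
  define P where "P n \<eta> p q \<longleftrightarrow> (\<forall>k. C_k k \<eta> \<and> C_k k p \<and> C_k k q) \<and> compact (supp \<eta>) \<and> supp \<eta> \<subseteq> A \<and> (\<forall>s. 0 \<le> \<eta> s \<and> \<eta> s \<le> 1)
    \<and> (\<forall>s\<in>C n. 1 - 1 / Suc n < \<eta> s) \<and> (\<forall>s\<in>supp \<eta>. f s < p s \<and> p s \<le> q s \<and> q s < g s \<and> p s < f s + 1 / Suc n \<and> g s - 1 / Suc n < q s)"
    for n and \<eta> p q :: "'a \<Rightarrow> real"
  have "\<exists>\<eta> p q. P n \<eta> p q" for n
  proof -
    obtain \<eta> :: "'a \<Rightarrow> real" where \<eta>: "\<And>k. C_k k \<eta>" "compact (supp \<eta>)" "supp \<eta> \<subseteq> A"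
      "\<And>s. 0 \<le> \<eta> s" "\<And>s. \<eta> s \<le> 1" "\<And>s. s \<in> C n \<Longrightarrow> \<eta> s > 1 - 1 / Suc n"
      using smooth_cutoff[OF A C(1,2), of "1 / Suc n" n] by auto
    let ?K = "supp \<eta>"
    have cf: "continuous_on ?K f" and cg: "continuous_on ?K g" using f g \<eta>(3) continuous_on_subset by blast+
    obtain \<delta> where \<delta>: "\<delta> > 0" "\<And>s. s \<in> ?K \<Longrightarrow> \<delta> \<le> g s - f s"
    proof (cases "?K = {}")
      case False
      have "continuous_on ?K (\<lambda>s. g s - f s)" by (intro continuous_intros cf cg)
      then obtain s0 where s0: "s0 \<in> ?K" "\<And>s. s \<in> ?K \<Longrightarrow> g s0 - f s0 \<le> g s - f s"
        using continuous_attains_inf[OF \<eta>(2) False] by blast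
      have "g s0 - f s0 > 0" using fg s0(1) \<eta>(3) by fastforce
      then show ?thesis using s0(2) that by blast
    qed (use that[of 1] in auto)
    \<comment> \<open>\<open>p\<close> will run in the band of width \<open>\<tau>\<close> above
      \<open>f\<close>, \<open>q\<close> in the one below \<open>g\<close>. The bound by
      \<open>\<delta> / 2\<close> keeps the bands from overlapping, the bound by
      \<open>1 / Suc n\<close> forces convergence.\<close>
    define \<tau> where "\<tau> = min (\<delta> / 2) (1 / Suc n)"
    have \<tau>: "\<tau> > 0" "2 * \<tau> \<le> \<delta>" "\<tau> \<le> 1 / Suc n" using \<delta>(1) by (auto simp: \<tau>_def)
    have c: "continuous_on ?K (\<lambda>s. f s + \<tau> / 2)" "continuous_on ?K (\<lambda>s. g s - \<tau> / 2)"
      by (intro continuous_intros cf cg)+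
    have \<tau>2: "\<tau> / 2 > 0" using \<tau>(1) by simp
    obtain p where p: "real_polynomial_function p" "\<And>s. s \<in> ?K \<Longrightarrow> \<bar>f s + \<tau> / 2 - p s\<bar> < \<tau> / 2"
      using Stone_Weierstrass_real_polynomial_function[OF \<eta>(2) c(1) \<tau>2] by blast
    obtain q where q: "real_polynomial_function q" "\<And>s. s \<in> ?K \<Longrightarrow> \<bar>g s - \<tau> / 2 - q s\<bar> < \<tau> / 2"
      using Stone_Weierstrass_real_polynomial_function[OF \<eta>(2) c(2) \<tau>2] by blast
    have "P n \<eta> p q"
      unfolding P_def
    proof (intro conjI allI ballI)
      fix s assume s: "s \<in> ?K"
      have 1: "f s < p s" "p s < f s + \<tau>" using p(2)[OF s] by (auto simp: abs_if split: if_splits)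
      have 2: "q s < g s" "g s - \<tau> < q s" using q(2)[OF s] by (auto simp: abs_if split: if_splits)
      show "f s < p s" "q s < g s" using 1 2 by auto
      show "p s \<le> q s" using 1 2 \<delta>(2)[OF s] \<tau>(2) by linarith
      show "p s < f s + 1 / real (Suc n)" "g s - 1 / real (Suc n) < q s" using 1 2 \<tau>(3) by linarith+
    qed (use \<eta> in \<open>auto intro!: C_k_real_polynomial p(1) q(1) simp del: C_k.simps\<close>)
    then show ?thesis by blast
  qed
  then obtain \<eta> p q where P: "\<And>n. P n (\<eta> n) (p n) (q n)" by metis
  have inv: "(\<lambda>n. 1 / real (Suc n)) \<longlonglongrightarrow> 0" using LIMSEQ_inverse_real_of_nat by (simp add: inverse_eq_divide)
  \<comment> \<open>On \<open>C n\<close> the cutoff exceeds \<open>1 - 1 / Suc n\<close>, which is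
    at least \<open>0\<close> even for \<open>n = 0\<close>. Hence a point of \<open>A\<close>
    eventually lies in the supports, where the bounds on \<open>p\<close> and \<open>q\<close> are
    available.\<close>
  have ev: "\<forall>\<^sub>F n in sequentially. s \<in> C n \<and> s \<in> supp (\<eta> n)" if s: "s \<in> A" for s
  proof -
    obtain N where N: "\<forall>n\<ge>N. {s} \<subseteq> C n" using CA[of "{s}"] s by auto
    show ?thesis using eventually_ge_at_top[of N]
    proof eventually_elim
      case (elim n)
      then have "s \<in> C n" using N by auto
      moreover have "1 - 1 / Suc n < \<eta> n s" using P[of n] \<open>s \<in> C n\<close> by (auto simp: P_def)
      moreover have "1 - 1 / real (Suc n) \<ge> 0" by simp
      ultimately have "\<eta> n s \<noteq> 0" by linarith
      then show ?case using \<open>s \<in> C n\<close> supp_eq_0 by blast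
    qed
  qed
  have P1: "1 - 1 / real (Suc n) \<le> \<eta> n s" if "s \<in> C n" for n s
    using P[of n] that unfolding P_def by (meson less_imp_le)
  have P2: "f s \<le> p n s" "p n s \<le> f s + 1 / real (Suc n)" "q n s \<le> g s" "g s - 1 / real (Suc n) \<le> q n s"
    if "s \<in> supp (\<eta> n)" for n s
    using P[of n] that unfolding P_def by (meson less_imp_le)+
  show thesis
  proof (rule that[of \<eta> p q])
    fix s assume s: "s \<in> A"
    show "(\<lambda>n. \<eta> n s) \<longlonglongrightarrow> 1"
    proof (rule tendsto_sandwich[where h="\<lambda>_. 1" and f="\<lambda>n. 1 - 1 / real (Suc n)"])
      show "(\<lambda>n. 1 - 1 / real (Suc n)) \<longlonglongrightarrow> 1" using tendsto_diff[OF tendsto_const inv, of 1] by simp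
      show "\<forall>\<^sub>F n in sequentially. 1 - 1 / real (Suc n) \<le> \<eta> n s"
        by (rule eventually_mono[OF ev[OF s]]) (use P1 P2 in blast)
      show "\<forall>\<^sub>F n in sequentially. \<eta> n s \<le> 1" using P by (auto simp: P_def)
    qed (rule tendsto_const)
    show "(\<lambda>n. p n s) \<longlonglongrightarrow> f s"
    proof (rule tendsto_sandwich[where f="\<lambda>_. f s" and h="\<lambda>n. f s + 1 / real (Suc n)"])
      show "(\<lambda>n. f s + 1 / real (Suc n)) \<longlonglongrightarrow> f s" using tendsto_add[OF tendsto_const inv, of "f s"] by simp
      show "\<forall>\<^sub>F n in sequentially. f s \<le> p n s"
        by (rule eventually_mono[OF ev[OF s]]) (use P1 P2 in blast)
      show "\<forall>\<^sub>F n in sequentially. p n s \<le> f s + 1 / real (Suc n)"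
        by (rule eventually_mono[OF ev[OF s]]) (use P1 P2 in blast)
    qed (rule tendsto_const)
    show "(\<lambda>n. q n s) \<longlonglongrightarrow> g s"
    proof (rule tendsto_sandwich[where h="\<lambda>_. g s" and f="\<lambda>n. g s - 1 / real (Suc n)"])
      show "(\<lambda>n. g s - 1 / real (Suc n)) \<longlonglongrightarrow> g s" using tendsto_diff[OF tendsto_const inv, of "g s"] by simp
      show "\<forall>\<^sub>F n in sequentially. q n s \<le> g s"
        by (rule eventually_mono[OF ev[OF s]]) (use P1 P2 in blast)
      show "\<forall>\<^sub>F n in sequentially. g s - 1 / real (Suc n) \<le> q n s"
        by (rule eventually_mono[OF ev[OF s]]) (use P1 P2 in blast)
    qed (rule tendsto_const)
  qed (use P in \<open>auto simp: P_def simp del: C_k.simps\<close>)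
qed

section \<open>Calculus and integration on vertical slices\<close>

lemma integral_FTC_Ioo:
  fixes u U :: "real \<Rightarrow> real"
  assumes "a \<le> b" "\<And>t. (U has_real_derivative u t) (at t)" "continuous_on UNIV u"
  shows "(LINT t|lborel. indicator {a<..<b} t * u t) = U b - U a"
proof -
  have [measurable]: "u \<in> borel_measurable borel" using assms(3) by (rule borel_measurable_continuous_onI)
  have "(LINT t|lborel. indicator {a<..<b} t * u t) = (LINT t|lborel. indicator {a..b} t *\<^sub>R u t)"
  proof (rule integral_cong_AE)
    have "AE t in lborel. t \<noteq> a" "AE t in lborel. t \<noteq> b" by (auto intro: AE_lborel_singleton)
    then show "AE t in lborel. indicator {a<..<b} t * u t = indicator {a..b} t *\<^sub>R u t"
      by eventually_elim (auto simp: indicator_def)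
  qed measurable
  also have "\<dots> = U b - U a"
    by (rule integral_FTC_Icc[OF assms(1)])
      (use assms in \<open>auto intro: continuous_on_subset has_field_derivative_at_within simp flip: has_real_derivative_iff_has_vector_derivative\<close>)
  finally show ?thesis .
qed

lemma frechet_derivative_snd_direction:
  fixes w :: "'a::euclidean_space \<times> real \<Rightarrow> real"
  assumes "C_k 1 w" "((\<lambda>t. w (s, t)) has_real_derivative D) (at t)"
  shows "frechet_derivative w (at (s, t)) (0, 1) = D"
proof -
  have "((\<lambda>\<tau>. w ((s, 0) + \<tau> *\<^sub>R (0, 1))) has_vector_derivative frechet_derivative w (at ((s, 0) + t *\<^sub>R (0, 1))) (0, 1)) (at t)"
    by (rule C_k_along_line[OF assms(1)])
  then have "((\<lambda>\<tau>. w (s, \<tau>)) has_real_derivative frechet_derivative w (at (s, t)) (0, 1)) (at t)"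
    by (simp add: has_real_derivative_iff_has_vector_derivative)
  then show ?thesis using assms(2) DERIV_unique by blast
qed

lemma snd_direction_has_derivative:
  fixes w :: "'a::euclidean_space \<times> real \<Rightarrow> real"
  assumes "C_k 1 w"
  shows "((\<lambda>t. w (s, t)) has_real_derivative frechet_derivative w (at (s, t)) (0, 1)) (at t)"
proof -
  have "((\<lambda>\<tau>. w ((s, 0) + \<tau> *\<^sub>R (0, 1))) has_vector_derivative frechet_derivative w (at ((s, 0) + t *\<^sub>R (0, 1))) (0, 1)) (at t)"
    by (rule C_k_along_line[OF assms(1)])
  then show ?thesis by (simp add: has_real_derivative_iff_has_vector_derivative)
qed

lemma integral_thin_domain:
  fixes A :: "'a::euclidean_space set" and F :: "'a \<times> real \<Rightarrow> real"
  assumes "integrable lborel (\<lambda>x. indicator (thin_domain A f g \<epsilon>) x * F x)"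
  shows "(LINT x:thin_domain A f g \<epsilon>|lborel. F x) = (LINT s|lborel. indicator A s * (LINT t|lborel. indicator {\<epsilon> * f s<..<\<epsilon> * g s} t * F (s, t)))"
proof -
  have "(LINT x:thin_domain A f g \<epsilon>|lborel. F x) = (LINT x|(lborel \<Otimes>\<^sub>M lborel). indicator (thin_domain A f g \<epsilon>) x * F x)"
    by (simp add: set_lebesgue_integral_def lborel_prod)
  also have "\<dots> = (LINT s|lborel. LINT t|lborel. indicator (thin_domain A f g \<epsilon>) (s, t) * F (s, t))"
    by (rule lborel_pair.integral_fst'[symmetric]) (use assms in \<open>simp add: lborel_prod\<close>)
  also have "\<dots> = (LINT s|lborel. indicator A s * (LINT t|lborel. indicator {\<epsilon> * f s<..<\<epsilon> * g s} t * F (s, t)))"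
  proof (rule Bochner_Integration.integral_cong)
    fix s
    have "indicator (thin_domain A f g \<epsilon>) (s, t) = (indicator A s * indicator {\<epsilon> * f s<..<\<epsilon> * g s} t :: real)" for t
      by (auto simp: indicator_def)
    then show "(LINT t|lborel. indicator (thin_domain A f g \<epsilon>) (s, t) * F (s, t))
      = indicator A s * (LINT t|lborel. indicator {\<epsilon> * f s<..<\<epsilon> * g s} t * F (s, t))"
      by (simp add: mult.assoc)
  qed simp
  finally show ?thesis .
qed

section \<open>Thin domains\<close>

lemma integrable_indicator_bounded:
  fixes F :: "'a::euclidean_space \<Rightarrow> real"
  assumes "(\<lambda>x. indicator \<Omega> x * F x) \<in> borel_measurable borel" "bounded \<Omega>" "\<And>x. x \<in> \<Omega> \<Longrightarrow> \<bar>F x\<bar> \<le> B"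
  shows "integrable lborel (\<lambda>x. indicator \<Omega> x * F x)"
proof -
  obtain R where R: "\<And>x. x \<in> \<Omega> \<Longrightarrow> norm x \<le> R" using assms(2) by (meson bounded_iff)
  show ?thesis
  proof (rule integrable_bounded_support[OF assms(1), where B="\<bar>B\<bar>" and R=R])
    show "norm (indicator \<Omega> x * F x) \<le> \<bar>B\<bar>" for x
      using assms(3)[of x] by (cases "x \<in> \<Omega>") auto
    show "indicator \<Omega> x * F x = 0" if "norm x > R" for x
      using R[of x] that by (auto simp: indicator_def)
  qed
qed

locale thin_family =
  fixes A :: "'a::euclidean_space set" and f g :: "'a \<Rightarrow> real" and M :: real
  assumes open_A: "open A" and bounded_A: "bounded A"
    and cont_f: "continuous_on A f" and cont_g: "continuous_on A g"
    and f_less_g: "\<And>s. s \<in> A \<Longrightarrow> f s < g s"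
    and f_ge: "\<And>s. s \<in> A \<Longrightarrow> - M \<le> f s" and g_le: "\<And>s. s \<in> A \<Longrightarrow> g s \<le> M"
begin

text \<open>Every member of the family is the unit-scale domain of another instance of the locale,
  so whatever is shown for \<open>U\<close> holds at all scales by reinterpretation.\<close>

lemma scaled: "0 < \<epsilon> \<Longrightarrow> thin_family A (\<lambda>s. \<epsilon> * f s) (\<lambda>s. \<epsilon> * g s) (\<epsilon> * M)"
  using open_A bounded_A cont_f cont_g f_less_g f_ge g_le mult_left_mono[OF f_ge, of _ \<epsilon>]
  by unfold_locales (auto intro!: continuous_intros mult_left_mono)

abbreviation "U \<equiv> thin_domain A f g 1"

lemma open_U: "open U" by (rule open_thin_domain[OF open_A cont_f cont_g])

lemma bounded_U: "bounded U" by (rule bounded_thin_domain[OF bounded_A, of "- M" 1 f g M]) (use f_ge g_le in auto)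

lemma A_sets [measurable]: "A \<in> sets borel" using open_A by (rule borel_open)

lemma U_sets [measurable]: "U \<in> sets borel" using open_U by (rule borel_open)

text \<open>Continuity on \<open>A\<close> says nothing about measurability off \<open>A\<close>.
  The extensions by \<open>0\<close> are Borel on the whole space and agree with \<open>f\<close>
  and \<open>g\<close> wherever the indicator of \<open>A\<close> or of \<open>U\<close> is
  nonzero.\<close>

definition f_ext where "f_ext s = indicator A s *\<^sub>R f s"
definition g_ext where "g_ext s = indicator A s *\<^sub>R g s"

lemma f_ext_meas [measurable]: "f_ext \<in> borel_measurable borel"
  unfolding f_ext_def by (rule borel_measurable_continuous_on_indicator[OF A_sets cont_f])

lemma g_ext_meas [measurable]: "g_ext \<in> borel_measurable borel"
  unfolding g_ext_def by (rule borel_measurable_continuous_on_indicator[OF A_sets cont_g])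

lemma integrable_A: "integrable lborel (\<lambda>s. indicator A s * c :: real)"
  using bounded_fmeasurable[OF bounded_A A_sets] by (simp add: integrable_indicator_iff fmeasurable_def)

text \<open>On a slice of length \<open>h\<close> the integrand is the squared derivative of the
  one-dimensional torsion function, and \<open>h^3 / 12\<close> is the torsional rigidity of an
  interval of that length.\<close>

lemma integral_second_moment:
  "(LINT x:U|lborel. (snd x - (f (fst x) + g (fst x)) / 2)\<^sup>2) = (LINT s:A|lborel. (g s - f s) ^ 3) / 12"
  "integrable lborel (\<lambda>x. indicator U x * (snd x - (f (fst x) + g (fst x)) / 2)\<^sup>2)"
proof -
  let ?H = "\<lambda>x. (snd x - (f (fst x) + g (fst x)) / 2)\<^sup>2"
  have eq: "(\<lambda>x. indicator U x * ?H x) = (\<lambda>x. indicator U x * (snd x - (f_ext (fst x) + g_ext (fst x)) / 2)\<^sup>2)"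
    by (auto simp: f_ext_def g_ext_def indicator_def)
  have meas: "(\<lambda>x. indicator U x * ?H x) \<in> borel_measurable borel"
    unfolding eq borel_prod[symmetric] using U_sets[unfolded borel_prod[symmetric]] by measurable
  show int: "integrable lborel (\<lambda>x. indicator U x * ?H x)"
  proof (rule integrable_indicator_bounded[OF meas bounded_U])
    fix x assume x: "x \<in> U"
    obtain s t where st: "x = (s, t)" by (cases x)
    have "\<bar>t - (f s + g s) / 2\<bar> \<le> 2 * M"
    proof -
      have "f s < t" "t < g s" "- M \<le> f s" "g s \<le> M" using x f_ge[of s] g_le[of s] by (auto simp: st)
      then have "t - (f s + g s) / 2 \<le> 2 * M" "(f s + g s) / 2 - t \<le> 2 * M" by (simp_all add: field_simps)
      then show ?thesis by linarith
    qed
    then have "\<bar>t - (f s + g s) / 2\<bar>\<^sup>2 \<le> (2 * M)\<^sup>2" by (intro power_mono) auto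
    then show "\<bar>?H x\<bar> \<le> (2 * M)\<^sup>2" by (simp add: st)
  qed
  have "(LINT x:U|lborel. ?H x) = (LINT s|lborel. indicator A s * (LINT t|lborel. indicator {1 * f s<..<1 * g s} t * ?H (s, t)))"
    by (rule integral_thin_domain[OF int])
  also have "\<dots> = (LINT s|lborel. indicator A s * ((g s - f s) ^ 3 / 12))"
  proof (rule Bochner_Integration.integral_cong)
    fix s
    show "indicator A s * (LINT t|lborel. indicator {1 * f s<..<1 * g s} t * ?H (s, t)) = indicator A s * ((g s - f s) ^ 3 / 12)"
    proof (cases "s \<in> A")
      case True
      define m where "m = (f s + g s) / 2"
      have "(LINT t|lborel. indicator {f s<..<g s} t * (t - m)\<^sup>2) = (g s - m) ^ 3 / 3 - (f s - m) ^ 3 / 3"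
      proof (rule integral_FTC_Ioo)
        show "((\<lambda>t. (t - m) ^ 3 / 3) has_real_derivative (t - m)\<^sup>2) (at t)" for t
          by (auto intro!: derivative_eq_intros simp: power2_eq_square)
      qed (use f_less_g[OF True] in \<open>auto intro!: continuous_intros\<close>)
      also have "\<dots> = (g s - f s) ^ 3 / 12"
        unfolding m_def by (simp add: power3_eq_cube field_simps)
      finally show ?thesis by (simp add: m_def)
    qed simp
  qed simp
  finally show "(LINT x:U|lborel. ?H x) = (LINT s:A|lborel. (g s - f s) ^ 3) / 12"
    by (simp add: set_lebesgue_integral_def)
qed

text \<open>Duality with the vertical field \<open>t - m\<close>, where \<open>m\<close> is the
  mid-height: its derivative in \<open>t\<close> is 1, so integration by parts on vertical lines
  expresses the integral of \<open>\<phi>\<close> through the vertical derivative alone. Completing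
  the square gives the bound; dropping the horizontal gradient loses nothing at leading
  order.\<close>

lemma torsional_rigidity_upper:
  "torsional_rigidity U \<le> (LINT s:A|lborel. (g s - f s) ^ 3) / 12"
proof (rule torsional_rigidity_le[OF open_U bounded_U])
  fix \<phi> :: "'a \<times> real \<Rightarrow> real" assume \<phi>: "test_function U \<phi>"
  note \<phi>D = test_functionD[OF \<phi>] and \<phi>sq = test_function_square_integrable[OF \<phi>]
  let ?D = "\<lambda>x. frechet_derivative \<phi> (at x) (0, 1)"
  let ?m = "\<lambda>x. (f (fst x) + g (fst x)) / 2"
  let ?w = "\<lambda>x. indicator U x * (snd x - ?m x)"
  have D0: "?D x = 0" if "x \<notin> U" for x
    using \<phi>D(4)[OF that] grad_inner[OF \<phi>D(1), of x "(0, 1)"] by simp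
  have Dc: "continuous_on UNIV ?D" by (rule C_k_1_frechet_continuous[OF \<phi>D(1)])
  have [measurable]: "?D \<in> borel_measurable borel" by (rule borel_measurable_continuous_onI[OF Dc])
  have D_le: "(?D x)\<^sup>2 \<le> (norm (grad \<phi> x))\<^sup>2" for x
  proof -
    have "\<bar>grad \<phi> x \<bullet> (0, 1)\<bar> \<le> norm (grad \<phi> x) * norm (0::'a, 1::real)" by (rule Cauchy_Schwarz_ineq2)
    then have "\<bar>?D x\<bar> \<le> norm (grad \<phi> x)" by (simp add: grad_inner[OF \<phi>D(1)] norm_Pair)
    then show ?thesis by (metis abs_ge_zero power2_abs power_mono)
  qed
  have D_sq: "integrable lborel (\<lambda>x. (?D x)\<^sup>2)"
    by (rule Bochner_Integration.integrable_bound[OF square_integrableD(2)[OF \<phi>sq(2)]])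
      (use D_le in \<open>auto intro!: AE_I2\<close>)
  have w_sq: "integrable lborel (\<lambda>x. (?w x)\<^sup>2)"
  proof -
    have "(\<lambda>x. (?w x)\<^sup>2) = (\<lambda>x. indicator U x * (snd x - ?m x)\<^sup>2)" by (auto simp: indicator_def)
    then show ?thesis using integral_second_moment(2) by simp
  qed
  have w_meas: "?w \<in> borel_measurable borel"
  proof -
    have eq: "?w = (\<lambda>x. indicator U x * (snd x - (f_ext (fst x) + g_ext (fst x)) / 2))"
      by (auto simp: f_ext_def g_ext_def indicator_def)
    show ?thesis unfolding eq borel_prod[symmetric] using U_sets[unfolded borel_prod[symmetric]] by measurable
  qed
  have wsi: "square_integrable ?w" and Dsi: "square_integrable ?D"
    unfolding square_integrable_def using w_meas w_sq D_sq by auto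
  have Dw: "integrable lborel (\<lambda>x. ?D x * ?w x)" using integrable_inner[OF Dsi wsi] by simp
  have "(LINT x|lborel. \<phi> x + ?D x * ?w x) = 0"
  proof -
    have i: "integrable (lborel \<Otimes>\<^sub>M lborel) (\<lambda>x. \<phi> x + ?D x * ?w x)"
      unfolding lborel_prod using \<phi>sq(3) Dw by simp
    have "(LINT x|lborel. \<phi> x + ?D x * ?w x) = (LINT s|lborel. LINT t|lborel. \<phi> (s, t) + ?D (s, t) * ?w (s, t))"
      using lborel_pair.integral_fst'[OF i] by (simp add: lborel_prod)
    also have "\<dots> = (LINT s|(lborel :: 'a measure). 0)"
    proof (rule Bochner_Integration.integral_cong)
      fix s :: 'a
      define c where "c = (f s + g s) / 2"
      \<comment> \<open>With the mid-height frozen to the constant \<open>c\<close> of this slice,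
        \<open>?k\<close> is smooth with compact support on the whole space, although the mid-height
        as a function of \<open>s\<close> need not be smooth.\<close>
      let ?k = "\<lambda>x. \<phi> x * (snd x - c)"
      have C: "C_k 1 ?k"
        by (intro C_k_mult \<phi>D(1) C_k_diff C_k_const C_k_linear[OF bounded_linear_snd])
      have cs: "compact (supp ?k)" by (rule compact_supp_mono(1)[OF \<phi>D(2)]) simp
      have nb: "norm (0::'a, 1::real) = 1" by (simp add: norm_Pair)
      have fk: "frechet_derivative ?k (at (s, t)) (0, 1) = \<phi> (s, t) + ?D (s, t) * ?w (s, t)" for t
      proof -
        have "((\<lambda>t. ?k (s, t)) has_real_derivative ?D (s, t) * (t - c) + 1 * \<phi> (s, t)) (at t)"
        proof -
          have "((\<lambda>t. t - c) has_real_derivative 1) (at t)" by (auto intro!: derivative_eq_intros)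
          from DERIV_mult[OF snd_direction_has_derivative[OF \<phi>D(1)[of 1], of s t] this] show ?thesis by simp
        qed
        then have "frechet_derivative ?k (at (s, t)) (0, 1) = ?D (s, t) * (t - c) + 1 * \<phi> (s, t)"
          by (rule frechet_derivative_snd_direction[OF C])
        moreover have "?D (s, t) * (t - c) = ?D (s, t) * ?w (s, t)"
          using D0[of "(s, t)"] by (cases "(s, t) \<in> U") (auto simp: c_def)
        ultimately show ?thesis by simp
      qed
      have "(LINT \<tau>|lborel. frechet_derivative ?k (at ((s, 0) + \<tau> *\<^sub>R (0, 1))) (0, 1)) = 0"
        by (rule integral_line_derivative_eq_0[OF C cs nb])
      then show "(LINT t|lborel. \<phi> (s, t) + ?D (s, t) * ?w (s, t)) = 0" by (simp add: fk)
    qed simp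
    finally show ?thesis by simp
  qed
  then have eq: "2 * (LINT x|lborel. \<phi> x) = - (LINT x|lborel. 2 * (?D x * ?w x))"
    using \<phi>sq(3) Dw by simp
  also have "\<dots> \<le> (LINT x|lborel. (norm (grad \<phi> x))\<^sup>2 + (?w x)\<^sup>2)"
    unfolding integral_minus[symmetric]
  proof (rule integral_mono)
    show "integrable lborel (\<lambda>x. - (2 * (?D x * ?w x)))" using Dw by simp
    show "integrable lborel (\<lambda>x. (norm (grad \<phi> x))\<^sup>2 + (?w x)\<^sup>2)"
      using w_sq square_integrableD(2)[OF \<phi>sq(2)] by simp
    fix x
    have "0 \<le> (?D x + ?w x)\<^sup>2" by simp
    then have "- (2 * (?D x * ?w x)) \<le> (?D x)\<^sup>2 + (?w x)\<^sup>2" by (simp add: power2_sum)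
    then show "- (2 * (?D x * ?w x)) \<le> (norm (grad \<phi> x))\<^sup>2 + (?w x)\<^sup>2" using D_le[of x] by linarith
  qed
  also have "\<dots> = (LINT x|lborel. (norm (grad \<phi> x))\<^sup>2) + (LINT x|lborel. (?w x)\<^sup>2)"
    using w_sq square_integrableD(2)[OF \<phi>sq(2)] by simp
  also have "(LINT x|lborel. (?w x)\<^sup>2) = (LINT x:U|lborel. (snd x - ?m x)\<^sup>2)"
    unfolding set_lebesgue_integral_def
    by (rule Bochner_Integration.integral_cong) (auto simp: indicator_def)
  also note integral_second_moment(1)
  finally show "torsion_energy \<phi> \<le> (LINT s:A|lborel. (g s - f s) ^ 3) / 12"
    by (simp add: torsion_energy_def)
qed

end

section \<open>Lower bound for the torsional rigidity\<close>

lemma integral_scale_snd: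
  fixes H :: "'a::euclidean_space \<times> real \<Rightarrow> real"
  assumes c: "continuous_on UNIV H" and K: "compact K" "\<And>x. x \<notin> K \<Longrightarrow> H x = 0" and e: "\<epsilon> > 0"
  shows "(LINT x|lborel. H (fst x, snd x / \<epsilon>)) = \<epsilon> * (LINT x|lborel. H x)"
    and "integrable lborel (\<lambda>x. H (fst x, snd x / \<epsilon>))"
proof -
  have i: "integrable (lborel \<Otimes>\<^sub>M lborel) H"
    unfolding lborel_prod by (rule integrable_continuous_compact_support[OF c K])
  have lin: "bounded_linear (\<lambda>x::'a \<times> real. (fst x, \<epsilon> * snd x))"
    by (intro bounded_linear_Pair bounded_linear_fst bounded_linear_mult_right[THEN bounded_linear_compose] bounded_linear_snd)
  let ?K = "(\<lambda>x. (fst x, \<epsilon> * snd x)) ` K"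
  have K': "compact ?K" by (intro compact_continuous_image linear_continuous_on lin K)
  have c': "continuous_on UNIV (\<lambda>x. H (fst x, snd x / \<epsilon>))"
    by (rule continuous_on_compose2[OF c]) (use e in \<open>auto intro!: continuous_intros\<close>)
  have out: "H (fst x, snd x / \<epsilon>) = 0" if "x \<notin> ?K" for x
  proof (rule K(2), rule notI)
    assume "(fst x, snd x / \<epsilon>) \<in> K"
    from imageI[OF this, of "\<lambda>x. (fst x, \<epsilon> * snd x)"] show False using that e by simp
  qed
  show i2: "integrable lborel (\<lambda>x. H (fst x, snd x / \<epsilon>))"
    by (rule integrable_continuous_compact_support[OF c' K' out])
  then have i': "integrable (lborel \<Otimes>\<^sub>M lborel) (\<lambda>x. H (fst x, snd x / \<epsilon>))" unfolding lborel_prod .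
  have "(LINT x|lborel. H (fst x, snd x / \<epsilon>)) = (LINT s|lborel. LINT t|lborel. H (s, t / \<epsilon>))"
    using lborel_pair.integral_fst'[OF i'] by (simp add: lborel_prod)
  also have "\<dots> = (LINT s|lborel. \<epsilon> * (LINT t|lborel. H (s, t)))"
  proof (rule Bochner_Integration.integral_cong)
    fix s
    show "(LINT t|lborel. H (s, t / \<epsilon>)) = \<epsilon> * (LINT t|lborel. H (s, t))"
      using lborel_integral_real_affine[of \<epsilon> "\<lambda>t. H (s, t / \<epsilon>)" 0] e by simp
  qed simp
  also have "\<dots> = \<epsilon> * (LINT x|lborel. H x)"
    using lborel_pair.integral_fst'[OF i] by (simp add: lborel_prod)
  finally show "(LINT x|lborel. H (fst x, snd x / \<epsilon>)) = \<epsilon> * (LINT x|lborel. H x)" .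
qed

context thin_family begin

text \<open>The test function on the thin domain is \<open>\<epsilon>\<^sup>2 v(s, t/\<epsilon>)\<close>; only the vertical derivative survives
  at the leading order \<open>\<epsilon>\<^sup>3\<close>.\<close>

lemma torsional_rigidity_lower:
  assumes v: "test_function U v" and e: "0 < \<epsilon>"
  shows "\<epsilon> ^ 3 * (2 * (LINT x|lborel. v x) - (LINT x|lborel. (frechet_derivative v (at x) (0, 1))\<^sup>2))
    - \<epsilon> ^ 5 * (LINT x|lborel. (norm (grad v x))\<^sup>2) \<le> torsional_rigidity (thin_domain A f g \<epsilon>)"
proof -
  interpret e: thin_family A "\<lambda>s. \<epsilon> * f s" "\<lambda>s. \<epsilon> * g s" "\<epsilon> * M" by (rule scaled[OF e])
  have dom: "thin_domain A f g \<epsilon> = e.U" by (simp add: thin_domain_def)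
  note vD = test_functionD[OF v] and vsq = test_function_square_integrable[OF v]
  let ?D = "\<lambda>x. frechet_derivative v (at x) (0, 1)"
  define \<phi> where "\<phi> x = \<epsilon>\<^sup>2 * v (fst x, snd x / \<epsilon>)" for x
  have lin: "bounded_linear (\<lambda>x::'a \<times> real. (fst x, snd x / \<epsilon>))"
    by (intro bounded_linear_Pair bounded_linear_fst bounded_linear_divide[THEN bounded_linear_compose] bounded_linear_snd)
  have lin': "bounded_linear (\<lambda>x::'a \<times> real. (fst x, \<epsilon> * snd x))"
    by (intro bounded_linear_Pair bounded_linear_fst bounded_linear_mult_right[THEN bounded_linear_compose] bounded_linear_snd)
  have C: "C_k k \<phi>" for k
    unfolding \<phi>_def[abs_def] by (intro C_k_mult C_k_const C_k_linear_right[OF lin] vD(1))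
  let ?K = "(\<lambda>x. (fst x, \<epsilon> * snd x)) ` supp v"
  have K: "compact ?K" by (intro compact_continuous_image linear_continuous_on lin' vD(2))
  have sub: "supp \<phi> \<subseteq> ?K"
  proof (rule supp_subset_closed[OF compact_imp_closed[OF K]])
    fix x assume x: "x \<notin> ?K"
    have "(fst x, snd x / \<epsilon>) \<notin> supp v"
    proof
      assume "(fst x, snd x / \<epsilon>) \<in> supp v"
      from imageI[OF this, of "\<lambda>x. (fst x, \<epsilon> * snd x)"] show False using x e by simp
    qed
    then show "\<phi> x = 0" by (simp add: \<phi>_def supp_eq_0)
  qed
  have KU: "?K \<subseteq> e.U"
  proof
    fix x assume "x \<in> ?K"
    then obtain y where y: "y \<in> supp v" "x = (fst y, \<epsilon> * snd y)" by (rule imageE)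
    obtain s t where "y = (s, t)" by (cases y)
    then have "x = (s, \<epsilon> * t)" "(s, t) \<in> supp v" using y by auto
    moreover have "supp v \<subseteq> U" using v by (simp add: test_function_def)
    ultimately show "x \<in> e.U" using e by (auto simp: subset_iff)
  qed
  have "supp \<phi> = ?K \<inter> supp \<phi>" using sub by blast
  then have "compact (supp \<phi>)" using compact_Int_closed[OF K, of "supp \<phi>"] by (simp add: supp_def)
  then have \<phi>: "test_function e.U \<phi>" unfolding test_function_def using C sub KU by blast
  \<comment> \<open>The horizontal gradient of \<open>\<phi>\<close> carries the factor
    \<open>\<epsilon>^2\<close>, the vertical derivative only
    \<open>\<epsilon>^2 / \<epsilon>\<close>. Squaring, and multiplying by the
    \<open>\<epsilon>\<close> of the change of variables, gives the orders 5 and 3.\<close>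
  have grad_\<phi>: "(norm (grad \<phi> x))\<^sup>2 \<le> \<epsilon> ^ 4 * (norm (grad v (fst x, snd x / \<epsilon>)))\<^sup>2 + \<epsilon>\<^sup>2 * (?D (fst x, snd x / \<epsilon>))\<^sup>2" for x
  proof -
    define y where "y = (fst x, snd x / \<epsilon>)"
    obtain a b where ab: "grad v y = (a, b)" by (cases "grad v y")
    have "(\<phi> has_derivative (\<lambda>h. \<epsilon>\<^sup>2 * frechet_derivative v (at y) (fst h, snd h / \<epsilon>))) (at x)"
    proof -
      have "(v has_derivative frechet_derivative v (at y)) (at y)"
        by (rule C_k_has_derivative[OF vD(1)])
      from has_derivative_compose[OF bounded_linear_imp_has_derivative[OF lin, of "at x"] this[unfolded y_def]]
      show ?thesis unfolding \<phi>_def[abs_def] y_def by (rule has_derivative_mult_right)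
    qed
    from fun_cong[OF frechet_derivative_at[OF this]]
    have fd: "frechet_derivative \<phi> (at x) h = \<epsilon>\<^sup>2 * (a \<bullet> fst h + b * (snd h / \<epsilon>))" for h
      using grad_inner[OF vD(1)[of 1], of y "(fst h, snd h / \<epsilon>)"] by (simp add: ab inner_prod_def)
    have g\<phi>: "grad \<phi> x = (\<epsilon>\<^sup>2 *\<^sub>R a, \<epsilon> * b)"
    proof (rule grad_eqI[OF C])
      fix h :: "'a \<times> real"
      show "frechet_derivative \<phi> (at x) h = (\<epsilon>\<^sup>2 *\<^sub>R a, \<epsilon> * b) \<bullet> h"
        unfolding fd using e by (simp add: inner_prod_def power2_eq_square algebra_simps)
    qed
    have "?D y = b" using grad_inner[OF vD(1)[of 1], of y "(0, 1)"] by (simp add: ab)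
    moreover have "(norm (grad v y))\<^sup>2 = (norm a)\<^sup>2 + b\<^sup>2" by (simp add: ab norm_Pair)
    moreover have "(norm (grad \<phi> x))\<^sup>2 = \<epsilon> ^ 4 * (norm a)\<^sup>2 + \<epsilon>\<^sup>2 * b\<^sup>2"
      unfolding g\<phi> by (simp add: norm_Pair power_mult_distrib flip: power_mult)
    moreover have "0 \<le> \<epsilon> ^ 4 * b\<^sup>2" by simp
    ultimately show ?thesis unfolding y_def[symmetric] by (simp add: distrib_left)
  qed
  have cv: "continuous_on UNIV v" and cg: "continuous_on UNIV (\<lambda>x. (norm (grad v x))\<^sup>2)" and cD: "continuous_on UNIV (\<lambda>x. (?D x)\<^sup>2)"
    by (intro C_k_cont[OF vD(1)] continuous_intros test_function_continuous_grad[OF v] C_k_1_frechet_continuous[OF vD(1)])+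
  have g0: "(norm (grad v x))\<^sup>2 = 0" "(?D x)\<^sup>2 = 0" if "x \<notin> supp v" for x
    using frechet_derivative_outside_supp[OF that] by (auto simp: grad_def)
  note sv = integral_scale_snd[OF cv vD(2) supp_eq_0[of _ v] e]
    and sg = integral_scale_snd[OF cg vD(2) g0(1) e] and sD = integral_scale_snd[OF cD vD(2) g0(2) e]
  have "(LINT x|lborel. (norm (grad \<phi> x))\<^sup>2) \<le> (LINT x|lborel. \<epsilon> ^ 4 * (norm (grad v (fst x, snd x / \<epsilon>)))\<^sup>2 + \<epsilon>\<^sup>2 * (?D (fst x, snd x / \<epsilon>))\<^sup>2)"
    using sg(2) sD(2) square_integrableD(2)[OF test_function_square_integrable(2)[OF \<phi>]] grad_\<phi>
    by (intro integral_mono) auto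
  also have "\<dots> = \<epsilon> ^ 4 * (\<epsilon> * (LINT x|lborel. (norm (grad v x))\<^sup>2)) + \<epsilon>\<^sup>2 * (\<epsilon> * (LINT x|lborel. (?D x)\<^sup>2))"
    using sg sD by simp
  finally have "(LINT x|lborel. (norm (grad \<phi> x))\<^sup>2) \<le> \<dots>" .
  moreover have "(LINT x|lborel. \<phi> x) = \<epsilon>\<^sup>2 * (\<epsilon> * (LINT x|lborel. v x))"
    unfolding \<phi>_def using sv by simp
  moreover have "torsion_energy \<phi> \<le> torsional_rigidity e.U"
    by (rule torsional_rigidity_ge[OF e.open_U e.bounded_U \<phi>])
  ultimately show ?thesis
    unfolding dom torsion_energy_def by (simp add: power2_eq_square power_numeral_reduce algebra_simps)
qed


lemma M_nonneg: "A \<noteq> {} \<Longrightarrow> 0 \<le> M"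
proof -
  assume "A \<noteq> {}"
  then obtain s where "s \<in> A" by blast
  then show ?thesis using f_ge[of s] g_le[of s] f_less_g[of s] by linarith
qed

text \<open>The integrand is \<open>2 w - (w')^2\<close> for the torsion function
  \<open>w = (t - f)(g - t)/2\<close> of the slice; on a slice of length \<open>h\<close> its two
  terms contribute \<open>h^3 / 6\<close> and \<open>- h^3 / 12\<close>. This is the value that the
  smoothed profiles have to reach.\<close>

lemma torsion_profile_integral:
  "(LINT x:U|lborel. (snd x - f (fst x)) * (g (fst x) - snd x) - ((f (fst x) + g (fst x)) / 2 - snd x)\<^sup>2)
    = (LINT s:A|lborel. (g s - f s) ^ 3) / 12"
proof -
  let ?H = "\<lambda>x. (snd x - f (fst x)) * (g (fst x) - snd x) - ((f (fst x) + g (fst x)) / 2 - snd x)\<^sup>2"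
  have eq: "(\<lambda>x. indicator U x * ?H x) = (\<lambda>x. indicator U x * ((snd x - f_ext (fst x)) * (g_ext (fst x) - snd x) - ((f_ext (fst x) + g_ext (fst x)) / 2 - snd x)\<^sup>2))"
    by (auto simp: f_ext_def g_ext_def indicator_def)
  have meas: "(\<lambda>x. indicator U x * ?H x) \<in> borel_measurable borel"
    unfolding eq borel_prod[symmetric] using U_sets[unfolded borel_prod[symmetric]] by measurable
  have int: "integrable lborel (\<lambda>x. indicator U x * ?H x)"
  proof (rule integrable_indicator_bounded[OF meas bounded_U])
    fix x assume x: "x \<in> U"
    obtain s t where st: "x = (s, t)" by (cases x)
    have b: "f s < t" "t < g s" "- M \<le> f s" "g s \<le> M" using x f_ge[of s] g_le[of s] by (auto simp: st)
    have "\<bar>(f s + g s) / 2 - t\<bar> \<le> 2 * M" using b by (simp add: abs_le_iff field_simps)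
    then have "\<bar>(f s + g s) / 2 - t\<bar>\<^sup>2 \<le> (2 * M)\<^sup>2" by (intro power_mono) auto
    then have 1: "((f s + g s) / 2 - t)\<^sup>2 \<le> 4 * M\<^sup>2" by (simp add: power_mult_distrib)
    have "(t - f s) * (g s - t) \<le> (2 * M) * (2 * M)" using b by (intro mult_mono) auto
    then have 2: "(t - f s) * (g s - t) \<le> 4 * M\<^sup>2" by (simp add: power2_eq_square)
    have 3: "0 \<le> (t - f s) * (g s - t)" using b by simp
    show "\<bar>?H x\<bar> \<le> 4 * M\<^sup>2 + 4 * M\<^sup>2"
      using 1 2 3 zero_le_power2[of "(f s + g s) / 2 - t"] unfolding st fst_conv snd_conv by linarith
  qed
  have "(LINT x:U|lborel. ?H x) = (LINT s|lborel. indicator A s * (LINT t|lborel. indicator {1 * f s<..<1 * g s} t * ?H (s, t)))"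
    by (rule integral_thin_domain[OF int])
  also have "\<dots> = (LINT s|lborel. indicator A s * ((g s - f s) ^ 3 / 12))"
  proof (rule Bochner_Integration.integral_cong)
    fix s
    show "indicator A s * (LINT t|lborel. indicator {1 * f s<..<1 * g s} t * ?H (s, t)) = indicator A s * ((g s - f s) ^ 3 / 12)"
    proof (cases "s \<in> A")
      case True
      \<comment> \<open>With mid-height \<open>m\<close> and half the thickness \<open>h\<close>,
        the integrand is \<open>h^2 - 2 (t - m)^2\<close>.\<close>
      define m h where "m = (f s + g s) / 2" and "h = (g s - f s) / 2"
      have fg: "f s = m - h" "g s = m + h" by (auto simp: m_def h_def field_simps)
      have "(LINT t|lborel. indicator {f s<..<g s} t * ?H (s, t))
        = (h\<^sup>2 * (g s) - 2 / 3 * (g s - m) ^ 3) - (h\<^sup>2 * (f s) - 2 / 3 * (f s - m) ^ 3)"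
      proof (rule integral_FTC_Ioo)
        show "((\<lambda>t. h\<^sup>2 * t - 2 / 3 * (t - m) ^ 3) has_real_derivative ?H (s, t)) (at t)" for t
        proof -
          have "((\<lambda>t. h\<^sup>2 * t - 2 / 3 * (t - m) ^ 3) has_real_derivative h\<^sup>2 - 2 * (t - m)\<^sup>2) (at t)"
            by (auto intro!: derivative_eq_intros simp: power2_eq_square)
          moreover have "h\<^sup>2 - 2 * (t - m)\<^sup>2 = ?H (s, t)"
            by (simp add: fg power2_eq_square field_simps)
          ultimately show ?thesis by simp
        qed
      qed (use f_less_g[OF True] in \<open>auto intro!: continuous_intros\<close>)
      also have "\<dots> = (g s - f s) ^ 3 / 12"
        by (simp add: fg power3_eq_cube power2_eq_square field_simps)
      finally show ?thesis by simp
    qed simp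
  qed simp
  finally show ?thesis by (simp add: set_lebesgue_integral_def)
qed

text \<open>The parabola \<open>Q\<close> between the two polynomials is cut off where
  \<open>n * Q \<le> 1\<close>, which confines the support to the compact set between their graphs.
  The factor \<open>\<eta> n\<close> depends on \<open>s\<close> alone and is never differentiated
  vertically; horizontal derivatives may explode with \<open>n\<close>, but they do not occur in
  this limit.\<close>

lemma torsion_profile_approximation:
  assumes ne: "A \<noteq> {}"
  obtains v where "\<And>n. test_function U (v n)"
    "(\<lambda>n. 2 * (LINT x|lborel. v n x) - (LINT x|lborel. (frechet_derivative (v n) (at x) (0, 1))\<^sup>2))
      \<longlonglongrightarrow> (LINT s:A|lborel. (g s - f s) ^ 3) / 12"
proof -
  obtain \<eta> p q :: "nat \<Rightarrow> 'a \<Rightarrow> real" where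
    C: "\<And>n k. C_k k (\<eta> n)" "\<And>n k. C_k k (p n)" "\<And>n k. C_k k (q n)"
    and K: "\<And>n. compact (supp (\<eta> n))" "\<And>n. supp (\<eta> n) \<subseteq> A" and \<eta>01: "\<And>n s. 0 \<le> \<eta> n s" "\<And>n s. \<eta> n s \<le> 1"
    and pq: "\<And>n s. s \<in> supp (\<eta> n) \<Longrightarrow> f s < p n s \<and> p n s \<le> q n s \<and> q n s < g s"
    and lim: "\<And>s. s \<in> A \<Longrightarrow> (\<lambda>n. \<eta> n s) \<longlonglongrightarrow> 1" "\<And>s. s \<in> A \<Longrightarrow> (\<lambda>n. p n s) \<longlonglongrightarrow> f s" "\<And>s. s \<in> A \<Longrightarrow> (\<lambda>n. q n s) \<longlonglongrightarrow> g s"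
    using smooth_approximations[OF open_A cont_f cont_g f_less_g] by blast
  have M0: "0 \<le> M" by (rule M_nonneg[OF ne])
  define Q where "Q n x = (snd x - p n (fst x)) * (q n (fst x) - snd x)" for n and x :: "'a \<times> real"
  define v where "v n x = 1 / 2 * (\<eta> n (fst x) * (Q n x * smooth_step (real n * Q n x - 1)))" for n and x :: "'a \<times> real"
  define D where "D n x = 1 / 2 * \<eta> n (fst x) * (p n (fst x) + q n (fst x) - 2 * snd x)
    * (smooth_step (real n * Q n x - 1) + real n * Q n x * smooth_step' (real n * Q n x - 1))" for n and x :: "'a \<times> real"
  have Ckv: "C_k k (v n)" for k n
    unfolding v_def[abs_def] Q_def
    by (intro C_k_mult C_k_const C_k_smooth_step C_k_diff C_k_linear[OF bounded_linear_snd] C_k_linear_right[OF bounded_linear_fst] C)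
  let ?K = "\<lambda>n. {x. fst x \<in> supp (\<eta> n) \<and> p n (fst x) \<le> snd x \<and> snd x \<le> q n (fst x)}"
  have KU: "?K n \<subseteq> U" for n
  proof
    fix x assume "x \<in> ?K n"
    then show "x \<in> U" using pq[of "fst x" n] K(2)[of n] by (cases x) auto
  qed
  have cK: "compact (?K n)" for n
  proof -
    have "closed (supp (\<eta> n))" by (simp add: supp_def)
    then have "closed ((fst :: 'a \<times> real \<Rightarrow> 'a) -` supp (\<eta> n))" by (rule closed_vimage_fst)
    moreover have c: "continuous_on UNIV (\<lambda>x::'a \<times> real. p n (fst x))" "continuous_on UNIV (\<lambda>x::'a \<times> real. q n (fst x))"
      using C_k_cont[OF C_k_linear_right[OF bounded_linear_fst C(2)[of 0 n]]] C_k_cont[OF C_k_linear_right[OF bounded_linear_fst C(3)[of 0 n]]] by auto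
    then have "closed {x::'a \<times> real. p n (fst x) \<le> snd x}" "closed {x::'a \<times> real. snd x \<le> q n (fst x)}"
      by (auto intro!: closed_Collect_le continuous_intros)
    ultimately have "closed ((fst -` supp (\<eta> n)) \<inter> {x. p n (fst x) \<le> snd x} \<inter> {x. snd x \<le> q n (fst x)})"
      by (intro closed_Int)
    also have "(fst -` supp (\<eta> n)) \<inter> {x. p n (fst x) \<le> snd x} \<inter> {x. snd x \<le> q n (fst x)} = ?K n" by auto
    finally show ?thesis using bounded_subset[OF bounded_U KU] by (simp add: compact_eq_bounded_closed)
  qed
  \<comment> \<open>Outside the strip one factor of \<open>Q\<close> is negative; the order of
    \<open>p\<close> and \<open>q\<close> keeps the other one nonnegative.\<close>
  have Q_neg: "Q n x \<le> 0" if x: "fst x \<in> supp (\<eta> n)" "x \<notin> ?K n" for n x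
  proof -
    have "p n (fst x) \<le> q n (fst x)" using pq[OF x(1)] by simp
    then consider "snd x < p n (fst x)" "snd x \<le> q n (fst x)" | "q n (fst x) < snd x" "p n (fst x) \<le> snd x" using x by force
    then show ?thesis by cases (auto simp: Q_def mult_nonneg_nonpos mult_nonpos_nonneg)
  qed
  have step0: "smooth_step (real n * y - 1) = 0" "smooth_step' (real n * y - 1) = 0" if "y \<le> 0" for n y
  proof -
    have "real n * y \<le> 0" using that by (simp add: mult_nonneg_nonpos)
    then show "smooth_step (real n * y - 1) = 0" "smooth_step' (real n * y - 1) = 0"
      by (auto simp: smooth_step_def smooth_step'_def)
  qed
  have v_out: "v n x = 0" "D n x = 0" if "x \<notin> ?K n" for n x
    using Q_neg[of x n] that step0 supp_eq_0[of "fst x" "\<eta> n"]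
    by (cases "fst x \<in> supp (\<eta> n)"; simp add: v_def D_def)+
  have sub: "supp (v n) \<subseteq> ?K n" for n by (rule supp_subset_closed[OF compact_imp_closed[OF cK]]) (rule v_out)
  have "supp (v n) = ?K n \<inter> supp (v n)" for n using sub[of n] by blast
  then have "compact (supp (v n))" for n using compact_Int_closed[OF cK[of n], of "supp (v n)"] by (simp add: supp_def)
  then have v: "test_function U (v n)" for n unfolding test_function_def using Ckv sub KU by blast
  have D: "frechet_derivative (v n) (at x) (0, 1) = D n x" for n x
  proof -
    obtain s t where st: "x = (s, t)" by (cases x)
    have dQ: "((\<lambda>t. Q n (s, t)) has_real_derivative (p n s + q n s - 2 * t)) (at t)"
      unfolding Q_def by (auto intro!: derivative_eq_intros)
    have "((\<lambda>t. real n * Q n (s, t) - 1) has_real_derivative real n * (p n s + q n s - 2 * t)) (at t)"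
      by (auto intro!: derivative_eq_intros dQ)
    from DERIV_chain2[OF smooth_step_deriv this]
    have dS: "((\<lambda>t. smooth_step (real n * Q n (s, t) - 1)) has_real_derivative
        smooth_step' (real n * Q n (s, t) - 1) * (real n * (p n s + q n s - 2 * t))) (at t)" .
    have "((\<lambda>t. v n (s, t)) has_real_derivative 1 / 2 * (\<eta> n s * ((p n s + q n s - 2 * t) * smooth_step (real n * Q n (s, t) - 1)
        + smooth_step' (real n * Q n (s, t) - 1) * (real n * (p n s + q n s - 2 * t)) * Q n (s, t)))) (at t)"
      unfolding v_def fst_conv by (intro DERIV_cmult DERIV_mult dQ dS)
    then have "((\<lambda>t. v n (s, t)) has_real_derivative D n (s, t)) (at t)"
      by (rule DERIV_cong) (simp add: D_def field_simps)
    from frechet_derivative_snd_direction[OF Ckv this] show ?thesis by (simp add: st)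
  qed
  have v_cont: "continuous_on UNIV (v n)" for n by (rule C_k_cont[OF Ckv])
  have D_cont: "continuous_on UNIV (D n)" for n using C_k_1_frechet_continuous[OF Ckv, of UNIV n "(0, 1)"] by (simp add: D)
  have iv: "integrable lborel (v n)" for n by (rule integrable_continuous_compact_support[OF v_cont cK v_out(1)])
  have iD: "integrable lborel (\<lambda>x. (D n x)\<^sup>2)" for n
    by (rule integrable_continuous_compact_support[OF _ cK[of n]]) (auto intro!: continuous_intros D_cont simp: v_out(2))
  \<comment> \<open>In the strip heights lie between \<open>- M\<close> and \<open>M\<close>, so
    \<open>Q \<le> 4 M^2\<close> and \<open>v \<le> 2 M^2\<close>. The last factor of
    \<open>D\<close> is at most \<open>1 + 3\<close> by \<open>smooth_step'_bound\<close>, hence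
    \<open>\<bar>D\<bar> \<le> 8 M\<close>, and \<open>68 = 2 * 2 + 64\<close>.\<close>
  have bound: "\<bar>2 * v n x - (D n x)\<^sup>2\<bar> \<le> 68 * M\<^sup>2" for n x
  proof (cases "x \<in> ?K n")
    case True
    obtain s t where st: "x = (s, t)" by (cases x)
    have xU: "(s, t) \<in> U" using True KU st by blast
    have s: "s \<in> supp (\<eta> n)" and sA: "s \<in> A" using True xU by (auto simp: st)
    have b: "- M \<le> p n s" "q n s \<le> M" "p n s \<le> t" "t \<le> q n s" using True pq[OF s] f_ge[OF sA] g_le[OF sA] by (auto simp: st)
    have Qb: "0 \<le> Q n x" "Q n x \<le> (2 * M) * (2 * M)"
      unfolding Q_def st fst_conv snd_conv using b M0 by (intro mult_nonneg_nonneg mult_mono; linarith)+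
    have "0 \<le> v n x" unfolding v_def using \<eta>01 Qb smooth_step_bounds by simp
    moreover have "v n x \<le> 2 * M\<^sup>2"
    proof -
      have "\<eta> n (fst x) * (Q n x * smooth_step (real n * Q n x - 1)) \<le> 1 * ((2 * M) * (2 * M) * 1)"
        using \<eta>01 Qb smooth_step_bounds M0 by (intro mult_mono mult_nonneg_nonneg) auto
      then show ?thesis by (simp add: v_def power2_eq_square)
    qed
    moreover have "(D n x)\<^sup>2 \<le> (8 * M)\<^sup>2"
    proof -
      have "\<bar>smooth_step (real n * Q n x - 1) + real n * Q n x * smooth_step' (real n * Q n x - 1)\<bar> \<le> 1 + 3"
        using smooth_step_bounds[of "real n * Q n x - 1"] smooth_step'_bound[of "real n * Q n x - 1"] by simp
      moreover have "\<bar>p n s + q n s - 2 * t\<bar> \<le> 4 * M" using b by linarith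
      ultimately have "\<bar>D n x\<bar> \<le> (1 / 2 * 1 * (4 * M)) * (1 + 3)"
        unfolding D_def abs_mult using \<eta>01 M0 by (intro mult_mono) (auto simp: st)
      then have "\<bar>D n x\<bar>\<^sup>2 \<le> (8 * M)\<^sup>2" by (intro power_mono) auto
      then show ?thesis by simp
    qed
    moreover have "0 \<le> (D n x)\<^sup>2" "0 \<le> M\<^sup>2" "(8 * M)\<^sup>2 = 64 * M\<^sup>2" by (simp_all add: power_mult_distrib)
    ultimately have "2 * v n x - (D n x)\<^sup>2 \<le> 68 * M\<^sup>2" "- (2 * v n x - (D n x)\<^sup>2) \<le> 68 * M\<^sup>2" by linarith+
    then show ?thesis by (rule abs_leI)
  next
    case False
    then show ?thesis by (simp add: v_out)
  qed
  have v_U: "indicator U x * (2 * v n x - (D n x)\<^sup>2) = 2 * v n x - (D n x)\<^sup>2" for n x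
  proof (cases "x \<in> U")
    case False
    then have "x \<notin> ?K n" using KU[of n] by blast
    from v_out[OF this] show ?thesis by simp
  qed simp
  have "(\<lambda>n. LINT x|lborel. indicator U x * (2 * v n x - (D n x)\<^sup>2)) \<longlonglongrightarrow>
    (LINT x|lborel. indicator U x * ((snd x - f (fst x)) * (g (fst x) - snd x) - ((f (fst x) + g (fst x)) / 2 - snd x)\<^sup>2))"
  proof (rule integral_dominated_convergence[where w="\<lambda>x. indicator U x * (68 * M\<^sup>2)"])
    let ?H = "\<lambda>x. (snd x - f (fst x)) * (g (fst x) - snd x) - ((f (fst x) + g (fst x)) / 2 - snd x)\<^sup>2"
    have eq: "(\<lambda>x. indicator U x * ?H x) = (\<lambda>x. indicator U x * ((snd x - f_ext (fst x)) * (g_ext (fst x) - snd x) - ((f_ext (fst x) + g_ext (fst x)) / 2 - snd x)\<^sup>2))"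
      by (auto simp: f_ext_def g_ext_def indicator_def)
    have "(\<lambda>x. indicator U x * ?H x) \<in> borel_measurable borel"
      unfolding eq borel_prod[symmetric] using U_sets[unfolded borel_prod[symmetric]] by measurable
    then show "(\<lambda>x. indicator U x * ?H x) \<in> borel_measurable lborel" by simp
    show "(\<lambda>x. indicator U x * (2 * v n x - (D n x)\<^sup>2)) \<in> borel_measurable lborel" for n
      unfolding v_U using iv[of n] iD[of n] by simp
    show "integrable lborel (\<lambda>x. indicator U x * (68 * M\<^sup>2))"
      using bounded_fmeasurable[OF bounded_U U_sets] by (simp add: integrable_indicator_iff fmeasurable_def)
    show "AE x in lborel. norm (indicator U x * (2 * v n x - (D n x)\<^sup>2)) \<le> indicator U x * (68 * M\<^sup>2)" for n
      using bound[of n] by (intro AE_I2) (auto simp: indicator_def)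
    show "AE x in lborel. (\<lambda>n. indicator U x * (2 * v n x - (D n x)\<^sup>2)) \<longlonglongrightarrow> indicator U x * ?H x"
    proof (rule AE_I2)
      fix x :: "'a \<times> real"
      obtain s t where st: "x = (s, t)" by (cases x)
      show "(\<lambda>n. indicator U x * (2 * v n x - (D n x)\<^sup>2)) \<longlonglongrightarrow> indicator U x * ?H x"
      proof (cases "x \<in> U")
        case True
        then have s: "s \<in> A" and t: "f s < t" "t < g s" by (auto simp: st)
        define Q0 where "Q0 = (t - f s) * (g s - t)"
        have Q0: "Q0 > 0" using t by (simp add: Q0_def)
        have Ql: "(\<lambda>n. Q n x) \<longlonglongrightarrow> Q0" unfolding Q_def Q0_def st fst_conv snd_conv by (intro tendsto_intros lim s)
        \<comment> \<open>At a point of \<open>U\<close> the parabolas converge to a positive value,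
          so the argument of the cutoff tends to infinity: the cutoff tends to 1 and the term with
          its derivative disappears.\<close>
        have top: "filterlim (\<lambda>n. real n * Q n x - 1) at_top sequentially"
        proof -
          have "filterlim (\<lambda>n. Q n x * real n) at_top sequentially"
            by (rule filterlim_tendsto_pos_mult_at_top[OF Ql Q0 filterlim_real_sequentially])
          then have "filterlim (\<lambda>n. -1 + Q n x * real n) at_top sequentially"
            by (rule filterlim_tendsto_add_at_top[OF tendsto_const])
          then show ?thesis by (simp add: mult.commute)
        qed
        have S: "(\<lambda>n. smooth_step (real n * Q n x - 1)) \<longlonglongrightarrow> 1" by (rule filterlim_compose[OF smooth_step_at_top top])
        have S': "(\<lambda>n. real n * Q n x * smooth_step' (real n * Q n x - 1)) \<longlonglongrightarrow> 0"
          using filterlim_compose[OF smooth_step'_at_top top] by simp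
        have "(\<lambda>n. v n x) \<longlonglongrightarrow> 1 / 2 * (1 * (Q0 * 1))"
          unfolding v_def by (intro tendsto_intros Ql S) (use lim(1)[OF s] in \<open>simp add: st\<close>)
        moreover have "(\<lambda>n. D n x) \<longlonglongrightarrow> 1 / 2 * 1 * (f s + g s - 2 * t) * (1 + 0)"
          unfolding D_def st fst_conv snd_conv by (intro tendsto_intros lim[OF s] S[unfolded st] S'[unfolded st])
        ultimately have "(\<lambda>n. 2 * v n x - (D n x)\<^sup>2) \<longlonglongrightarrow> 2 * (1 / 2 * (1 * (Q0 * 1))) - (1 / 2 * 1 * (f s + g s - 2 * t) * (1 + 0))\<^sup>2"
          by (intro tendsto_intros)
        moreover have "2 * (1 / 2 * (1 * (Q0 * 1))) - (1 / 2 * 1 * (f s + g s - 2 * t) * (1 + 0))\<^sup>2 = ?H x"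
        proof -
          have e: "1 / 2 * 1 * (f s + g s - 2 * t) * (1 + 0) = (f s + g s) / 2 - t" by (simp add: field_simps)
          show ?thesis unfolding e by (simp add: st Q0_def)
        qed
        ultimately show ?thesis using True by simp
      qed simp
    qed
  qed
  then have "(\<lambda>n. LINT x|lborel. 2 * v n x - (D n x)\<^sup>2) \<longlonglongrightarrow> (LINT s:A|lborel. (g s - f s) ^ 3) / 12"
    unfolding v_U torsion_profile_integral[symmetric] by (simp add: set_lebesgue_integral_def)
  moreover have "(LINT x|lborel. 2 * v n x - (D n x)\<^sup>2) = 2 * (LINT x|lborel. v n x) - (LINT x|lborel. (D n x)\<^sup>2)" for n
    using iv[of n] iD[of n] by simp
  ultimately have "(\<lambda>n. 2 * (LINT x|lborel. v n x) - (LINT x|lborel. (frechet_derivative (v n) (at x) (0, 1))\<^sup>2))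
      \<longlonglongrightarrow> (LINT s:A|lborel. (g s - f s) ^ 3) / 12" by (simp add: D)
  then show thesis using that v by blast
qed

end

section \<open>Lower bound for the perimeter\<close>

lemma divergence_vertical:
  fixes w :: "'a::euclidean_space \<times> real \<Rightarrow> real"
  assumes w: "C_k 1 w"
  shows "divergence (\<lambda>x. (0, w x)) x = frechet_derivative w (at x) (0, 1)"
proof -
  have "(w has_derivative frechet_derivative w (at x)) (at x)" using C_k_has_derivative[of 0 w] w by simp
  then have "((\<lambda>x. (0::'a, w x)) has_derivative (\<lambda>h. (0, frechet_derivative w (at x) h))) (at x)"
    by (intro has_derivative_Pair has_derivative_const)
  from frechet_derivative_at[OF this]
  have "frechet_derivative (\<lambda>x. (0::'a, w x)) (at x) = (\<lambda>h. (0, frechet_derivative w (at x) h))" by (rule sym)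
  then have "divergence (\<lambda>x. (0, w x)) x = (\<Sum>b\<in>Basis. frechet_derivative w (at x) b * snd b)"
    by (simp add: divergence_def inner_prod_def)
  also have "\<dots> = frechet_derivative w (at x) (0, 1) * snd (0::'a, 1::real) + (\<Sum>b\<in>Basis - {(0, 1)}. frechet_derivative w (at x) b * snd b)"
    by (rule sum.remove) (auto simp: Basis_prod_def)
  also have "(\<Sum>b\<in>Basis - {(0, 1)}. frechet_derivative w (at x) b * snd b) = 0"
    by (rule sum.neutral) (auto simp: Basis_prod_def)
  finally show ?thesis by simp
qed

context thin_family begin

text \<open>The competing fields imitate the outer normal of a thin slab:
  \<open>smooth_step y - smooth_step (- y)\<close> is a smoothed sign of the height above the
  mid-height, tending to 1 on the upper graph and to \<open>-1\<close> on the lower one. Each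
  vertical slice over \<open>A\<close> contributes 2 in the limit, so the bound holds for
  \<open>U\<close> itself and not only asymptotically.\<close>

lemma perimeter_ge: "ereal (2 * measure lborel A) \<le> perimeter U"
proof -
  obtain \<eta> p q :: "nat \<Rightarrow> 'a \<Rightarrow> real" where
    C: "\<And>n k. C_k k (\<eta> n)" "\<And>n k. C_k k (p n)" "\<And>n k. C_k k (q n)"
    and K: "\<And>n. compact (supp (\<eta> n))" "\<And>n. supp (\<eta> n) \<subseteq> A" and \<eta>01: "\<And>n s. 0 \<le> \<eta> n s" "\<And>n s. \<eta> n s \<le> 1"
    and pq: "\<And>n s. s \<in> supp (\<eta> n) \<Longrightarrow> f s < p n s \<and> p n s \<le> q n s \<and> q n s < g s"
    and lim: "\<And>s. s \<in> A \<Longrightarrow> (\<lambda>n. \<eta> n s) \<longlonglongrightarrow> 1" "\<And>s. s \<in> A \<Longrightarrow> (\<lambda>n. p n s) \<longlonglongrightarrow> f s" "\<And>s. s \<in> A \<Longrightarrow> (\<lambda>n. q n s) \<longlonglongrightarrow> g s"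
    using smooth_approximations[OF open_A cont_f cont_g f_less_g] by blast
  define y where "y n x = real n * (snd x - (p n (fst x) + q n (fst x)) / 2)" for n and x :: "'a \<times> real"
  \<comment> \<open>A cutoff in height that provides compact support: the bracket is at least 1 for
    \<open>\<bar>t\<bar> \<le> M\<close>, where both graphs lie, and nonpositive once
    \<open>t^2 \<ge> M^2 + 1\<close>.\<close>
  define z where "z n x = real n * ((M\<^sup>2 + 1) - snd x * snd x)" for n and x :: "'a \<times> real"
  define w where "w n x = \<eta> n (fst x) * ((smooth_step (y n x) - smooth_step (- y n x)) * smooth_step (z n x))" for n x
  have Ck: "C_k k (w n)" for k n
    unfolding w_def[abs_def] y_def[abs_def] z_def divide_inverse
    by (intro C_k_mult C_k_const C_k_smooth_step C_k_diff C_k_add C_k_minus C_k_linear[OF bounded_linear_snd]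
        C_k_linear_right[OF bounded_linear_fst] C)
  have w_le: "\<bar>w n x\<bar> \<le> 1" for n x
  proof -
    have "\<bar>smooth_step (y n x) - smooth_step (- y n x)\<bar> \<le> 1"
      using smooth_step_bounds[of "y n x"] smooth_step_bounds[of "- y n x"] by linarith
    then have "\<bar>\<eta> n (fst x)\<bar> * (\<bar>smooth_step (y n x) - smooth_step (- y n x)\<bar> * \<bar>smooth_step (z n x)\<bar>) \<le> 1 * (1 * 1)"
      using \<eta>01 smooth_step_bounds by (intro mult_mono mult_nonneg_nonneg) auto
    then show ?thesis by (simp add: w_def abs_mult)
  qed
  let ?K = "\<lambda>n. supp (\<eta> n) \<times> {- (\<bar>M\<bar> + 1)..\<bar>M\<bar> + 1}"
  have cK: "compact (?K n)" for n using K(1) by (intro compact_Times) auto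
  have w_out: "w n x = 0" if x: "x \<notin> ?K n" for n x
  proof (cases "fst x \<in> supp (\<eta> n)")
    case True
    then have "\<bar>M\<bar> + 1 < \<bar>snd x\<bar>" using x by (cases x) auto
    then have "(\<bar>M\<bar> + 1)\<^sup>2 \<le> \<bar>snd x\<bar>\<^sup>2" by (intro power_mono) auto
    then have "M\<^sup>2 + 1 \<le> snd x * snd x" by (simp add: power2_eq_square algebra_simps)
    then have "z n x \<le> 0" unfolding z_def by (intro mult_nonneg_nonpos) auto
    then show ?thesis by (simp add: w_def smooth_step_eq_0)
  qed (simp add: w_def supp_eq_0)
  have sub: "supp (w n) \<subseteq> ?K n" for n by (rule supp_subset_closed[OF compact_imp_closed[OF cK]]) (rule w_out)
  have "supp (w n) = ?K n \<inter> supp (w n)" for n using sub[of n] by blast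
  then have cs: "compact (supp (w n))" for n using compact_Int_closed[OF cK[of n], of "supp (w n)"] by (simp add: supp_def)
  have w_cont: "continuous_on UNIV (w n)" for n by (rule C_k_cont[OF Ck])
  have Dw_cont: "continuous_on UNIV (\<lambda>x. frechet_derivative (w n) (at x) (0, 1))" for n
    by (rule C_k_1_frechet_continuous[OF Ck])
  \<comment> \<open>The integral of the divergence after the fundamental theorem of calculus on each
    vertical slice.\<close>
  define J where "J n = (LINT s|lborel. indicator A s * (w n (s, g s) - w n (s, f s)))" for n
  have J_le: "ereal (J n) \<le> perimeter U" for n
  proof -
    let ?\<phi> = "\<lambda>x. (0::'a, w n x)"
    have "C_k 1 ?\<phi>"
      using C_k_linear_left[OF bounded_linear_Pair[OF bounded_linear_zero bounded_linear_ident] Ck, of 1 n] .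
    moreover have "compact (supp ?\<phi>)" by (rule compact_supp_mono(1)[OF cs[of n]]) (simp add: zero_prod_def)
    moreover have "norm (?\<phi> x) \<le> 1" for x using w_le[of n x] by (simp add: norm_Pair)
    moreover have "(LINT x:U|lborel. divergence ?\<phi> x) = J n"
    proof -
      have int: "integrable lborel (\<lambda>x. indicator U x * frechet_derivative (w n) (at x) (0, 1))"
        using integrable_continuous_compact_support[OF Dw_cont[of n] cs[of n] frechet_derivative_outside_supp]
          integrable_mult_indicator[of U lborel "\<lambda>x. frechet_derivative (w n) (at x) (0, 1)"] by simp
      have "(LINT x:U|lborel. divergence ?\<phi> x) = (LINT x:U|lborel. frechet_derivative (w n) (at x) (0, 1))"
        by (simp add: divergence_vertical[OF Ck])
      also have "\<dots> = (LINT s|lborel. indicator A s * (LINT t|lborel. indicator {1 * f s<..<1 * g s} t * frechet_derivative (w n) (at (s, t)) (0, 1)))"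
        by (rule integral_thin_domain[OF int])
      also have "\<dots> = J n"
        unfolding J_def
      proof (rule Bochner_Integration.integral_cong)
        fix s
        show "indicator A s * (LINT t|lborel. indicator {1 * f s<..<1 * g s} t * frechet_derivative (w n) (at (s, t)) (0, 1))
          = indicator A s * (w n (s, g s) - w n (s, f s))"
        proof (cases "s \<in> A")
          case True
          have "(LINT t|lborel. indicator {f s<..<g s} t * frechet_derivative (w n) (at (s, t)) (0, 1)) = w n (s, g s) - w n (s, f s)"
          proof (rule integral_FTC_Ioo)
            show "((\<lambda>t. w n (s, t)) has_real_derivative frechet_derivative (w n) (at (s, t)) (0, 1)) (at t)" for t
              by (rule snd_direction_has_derivative[OF Ck])
            show "continuous_on UNIV (\<lambda>t. frechet_derivative (w n) (at (s, t)) (0, 1))"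
              by (rule continuous_on_compose2[OF Dw_cont]) (auto intro!: continuous_intros)
          qed (use f_less_g[OF True] in simp)
          then show ?thesis by simp
        qed simp
      qed simp
      finally show ?thesis .
    qed
    ultimately show ?thesis unfolding perimeter_def by (intro SUP_upper2[of ?\<phi>]) auto
  qed
  have "J \<longlonglongrightarrow> (LINT s|lborel. indicator A s * 2)"
    unfolding J_def
  proof (rule integral_dominated_convergence[where w="\<lambda>s. indicator A s * 2"])
    show "(\<lambda>s. indicator A s * (w n (s, g s) - w n (s, f s))) \<in> borel_measurable lborel" for n
    proof -
      have [measurable]: "w n \<in> borel_measurable (borel \<Otimes>\<^sub>M borel)"
        unfolding borel_prod by (rule borel_measurable_continuous_onI[OF w_cont])
      have "(\<lambda>s. indicator A s * (w n (s, g s) - w n (s, f s))) = (\<lambda>s. indicator A s * (w n (s, g_ext s) - w n (s, f_ext s)))"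
        by (auto simp: f_ext_def g_ext_def indicator_def)
      then show ?thesis by simp
    qed
    show "integrable lborel (\<lambda>s. indicator A s * 2 :: real)" by (rule integrable_A)
    show "AE s in lborel. norm (indicator A s * (w n (s, g s) - w n (s, f s))) \<le> indicator A s * 2" for n
    proof (rule AE_I2)
      fix s
      have "\<bar>w n (s, g s) - w n (s, f s)\<bar> \<le> 2" using w_le[of n "(s, g s)"] w_le[of n "(s, f s)"] by linarith
      then show "norm (indicator A s * (w n (s, g s) - w n (s, f s))) \<le> indicator A s * 2" by (auto simp: indicator_def)
    qed
    show "AE s in lborel. (\<lambda>n. indicator A s * (w n (s, g s) - w n (s, f s))) \<longlonglongrightarrow> indicator A s * 2"
    proof (rule AE_I2)
      fix s
      show "(\<lambda>n. indicator A s * (w n (s, g s) - w n (s, f s))) \<longlonglongrightarrow> indicator A s * 2"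
      proof (cases "s \<in> A")
        case True
        have b: "- M \<le> f s" "g s \<le> M" "f s < g s" using f_ge g_le f_less_g True by auto
        have top: "filterlim (\<lambda>n. real n * c n) at_top sequentially" if "c \<longlonglongrightarrow> l" "l > 0" for c and l :: real
          using filterlim_tendsto_pos_mult_at_top[OF that filterlim_real_sequentially] by (simp add: mult.commute)
        have S: "(\<lambda>n. smooth_step (real n * c n)) \<longlonglongrightarrow> 1" if "c \<longlonglongrightarrow> l" "l > 0" for c and l :: real
          by (rule filterlim_compose[OF smooth_step_at_top top[OF that]])
        have S0: "(\<lambda>n. smooth_step (- (real n * c n))) \<longlonglongrightarrow> 0" if c: "c \<longlonglongrightarrow> l" "l > 0" for c and l :: real
        proof (rule Lim_transform_eventually[OF tendsto_const])
          show "\<forall>\<^sub>F n in sequentially. 0 = smooth_step (- (real n * c n))"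
            using order_tendstoD(1)[OF c] by eventually_elim (simp add: smooth_step_eq_0)
        qed
        have Z: "(\<lambda>n. smooth_step (z n (s, t))) \<longlonglongrightarrow> 1" if t: "\<bar>t\<bar> \<le> M" for t
        proof -
          have "\<bar>t\<bar>\<^sup>2 \<le> M\<^sup>2" using t by (intro power_mono) auto
          then have "(M\<^sup>2 + 1) - t * t > 0" by (simp add: power2_eq_square)
          from S[OF tendsto_const this] show ?thesis by (simp add: z_def)
        qed
        have bt: "\<bar>g s\<bar> \<le> M" "\<bar>f s\<bar> \<le> M" using b by auto
        have cg: "(\<lambda>n. g s - (p n s + q n s) / 2) \<longlonglongrightarrow> g s - (f s + g s) / 2"
          and cf: "(\<lambda>n. (p n s + q n s) / 2 - f s) \<longlonglongrightarrow> (f s + g s) / 2 - f s"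
          by (intro tendsto_intros lim True; simp)+
        have pos: "g s - (f s + g s) / 2 > 0" "(f s + g s) / 2 - f s > 0" using b(3) by (auto simp: field_simps)
        have "(\<lambda>n. w n (s, g s)) \<longlonglongrightarrow> 1 * ((1 - 0) * 1)"
          unfolding w_def y_def fst_conv snd_conv by (intro tendsto_intros lim(1)[OF True] S[OF cg pos(1)] S0[OF cg pos(1)] Z bt)
        moreover have "(\<lambda>n. w n (s, f s)) \<longlonglongrightarrow> 1 * ((0 - 1) * 1)"
        proof -
          have eq: "y n (s, f s) = - (real n * ((p n s + q n s) / 2 - f s))" for n by (simp add: y_def algebra_simps)
          show ?thesis unfolding w_def eq fst_conv minus_minus
            by (intro tendsto_intros lim(1)[OF True] S[OF cf pos(2)] S0[OF cf pos(2)] Z bt)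
        qed
        ultimately have "(\<lambda>n. w n (s, g s) - w n (s, f s)) \<longlonglongrightarrow> 1 * ((1 - 0) * 1) - 1 * ((0 - 1) * 1)"
          by (rule tendsto_diff)
        then show ?thesis using True by simp
      qed simp
    qed
  qed simp
  also have "(LINT s|lborel. indicator A s * 2) = 2 * measure lborel A" by simp
  finally have "J \<longlonglongrightarrow> 2 * measure lborel A" .
  then have "(\<lambda>n. ereal (J n)) \<longlonglongrightarrow> ereal (2 * measure lborel A)" by simp
  then show ?thesis by (rule LIMSEQ_le_const2) (use J_le in auto)
qed

text \<open>The upper estimate holds at every scale without error. For the lower one a nearly
  optimal profile is fixed first, and only then \<open>\<epsilon>\<close> tends to \<open>0\<close>,
  so that its possibly huge Dirichlet integral \<open>N\<close> is removed by the factor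
  \<open>\<epsilon>^2\<close>.\<close>

lemma torsional_rigidity_thin_limit:
  assumes ne: "A \<noteq> {}"
  shows "((\<lambda>\<epsilon>. torsional_rigidity (thin_domain A f g \<epsilon>) / \<epsilon> ^ 3) \<longlongrightarrow> (LINT s:A|lborel. (g s - f s) ^ 3) / 12) (at_right 0)"
proof (rule order_tendstoI)
  let ?I = "(LINT s:A|lborel. (g s - f s) ^ 3) / 12"
  let ?T = "\<lambda>\<epsilon>. torsional_rigidity (thin_domain A f g \<epsilon>) / \<epsilon> ^ 3"
  fix a assume a: "?I < a"
  show "\<forall>\<^sub>F \<epsilon> in at_right 0. ?T \<epsilon> < a"
    using eventually_at_right_less[of "0::real"]
  proof eventually_elim
    case (elim \<epsilon>)
    interpret e: thin_family A "\<lambda>s. \<epsilon> * f s" "\<lambda>s. \<epsilon> * g s" "\<epsilon> * M" by (rule scaled[OF elim])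
    have dom: "thin_domain A f g \<epsilon> = e.U" by (simp add: thin_domain_def)
    have "(LINT s:A|lborel. (\<epsilon> * g s - \<epsilon> * f s) ^ 3) = \<epsilon> ^ 3 * (LINT s:A|lborel. (g s - f s) ^ 3)"
      by (simp add: right_diff_distrib[symmetric] power_mult_distrib)
    then have "torsional_rigidity e.U \<le> \<epsilon> ^ 3 * ?I" using e.torsional_rigidity_upper by simp
    then have "?T \<epsilon> \<le> ?I" unfolding dom using elim by (simp add: field_simps)
    then show ?case using a by linarith
  qed
next
  let ?I = "(LINT s:A|lborel. (g s - f s) ^ 3) / 12"
  let ?T = "\<lambda>\<epsilon>. torsional_rigidity (thin_domain A f g \<epsilon>) / \<epsilon> ^ 3"
  fix a assume a: "a < ?I"
  obtain v where v: "\<And>n. test_function U (v n)"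
    and lim: "(\<lambda>n. 2 * (LINT x|lborel. v n x) - (LINT x|lborel. (frechet_derivative (v n) (at x) (0, 1))\<^sup>2)) \<longlonglongrightarrow> ?I"
    using torsion_profile_approximation[OF ne] by blast
  obtain n where n: "a < 2 * (LINT x|lborel. v n x) - (LINT x|lborel. (frechet_derivative (v n) (at x) (0, 1))\<^sup>2)"
    using order_tendstoD(1)[OF lim a] eventually_sequentially by auto
  define E N where "E = 2 * (LINT x|lborel. v n x) - (LINT x|lborel. (frechet_derivative (v n) (at x) (0, 1))\<^sup>2)"
    and "N = (LINT x|lborel. (norm (grad (v n) x))\<^sup>2)"
  have "((\<lambda>\<epsilon>. E - \<epsilon>\<^sup>2 * N) \<longlongrightarrow> E - 0\<^sup>2 * N) (at_right 0)" by (intro tendsto_intros)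
  then have "\<forall>\<^sub>F \<epsilon> in at_right 0. a < E - \<epsilon>\<^sup>2 * N" using n by (intro order_tendstoD(1)) (auto simp: E_def)
  then show "\<forall>\<^sub>F \<epsilon> in at_right 0. a < ?T \<epsilon>"
    using eventually_at_right_less[of "0::real"]
  proof eventually_elim
    case (elim \<epsilon>)
    have "\<epsilon> ^ 3 * (E - \<epsilon>\<^sup>2 * N) = \<epsilon> ^ 3 * E - \<epsilon> ^ 5 * N" by (simp add: algebra_simps flip: power_add)
    also have "\<dots> \<le> torsional_rigidity (thin_domain A f g \<epsilon>)"
      using torsional_rigidity_lower[OF v[of n] elim(2)] by (simp add: E_def N_def)
    finally have "E - \<epsilon>\<^sup>2 * N \<le> ?T \<epsilon>" using elim(2) by (simp add: field_simps)
    then show ?case using elim(1) by linarith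
  qed
qed

lemma torsional_rigidity_nonneg: "0 \<le> torsional_rigidity U"
proof -
  have "frechet_derivative (\<lambda>_. 0 :: real) (at x) = (\<lambda>_. 0)" for x :: "'a \<times> real"
    by (rule frechet_derivative_const)
  then have "torsion_energy (\<lambda>_::'a \<times> real. 0) = 0" by (simp add: torsion_energy_def grad_def)
  then show ?thesis using torsional_rigidity_ge[OF open_U bounded_U test_function_zero] by simp
qed

lemma measure_U: "measure lborel U = (LINT s:A|lborel. g s - f s)"
proof -
  have eq: "(\<lambda>s. indicator A s * (g s - f s)) = (\<lambda>s. indicator A s * (g_ext s - f_ext s))"
    by (auto simp: f_ext_def g_ext_def indicator_def)
  have I: "integrable lborel (\<lambda>s. indicator A s * (g s - f s))"
  proof (rule integrable_indicator_bounded[OF _ bounded_A])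
    show "(\<lambda>s. indicator A s * (g s - f s)) \<in> borel_measurable borel" unfolding eq by measurable
    show "\<bar>g s - f s\<bar> \<le> 2 * M" if "s \<in> A" for s using f_ge[OF that] g_le[OF that] f_less_g[OF that] by linarith
  qed
  have nn: "0 \<le> indicator A s * (g s - f s)" for s using f_less_g[of s] by (auto simp: indicator_def)
  have "emeasure lborel U = (\<integral>\<^sup>+s. ennreal (indicator A s * (g s - f s)) \<partial>lborel)"
    unfolding emeasure_thin_domain[OF open_A cont_f cont_g] by (intro nn_integral_cong) (auto simp: indicator_def)
  also have "\<dots> = ennreal (LINT s|lborel. indicator A s * (g s - f s))"
    using nn by (intro nn_integral_eq_integral[OF I]) auto
  finally show ?thesis
    using nn by (simp add: measure_def set_lebesgue_integral_def integral_nonneg_AE)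
qed

end

section \<open>The thin limit\<close>

text \<open>The segment from \<open>s0\<close> to \<open>s\<close> can be prolonged a little beyond
  \<open>s\<close> inside the open set, so \<open>s\<close> is a convex combination that gives
  positive weight to \<open>s0\<close>, while \<open>h\<close> is nonnegative at the other
  end.\<close>

lemma concave_on_pos:
  fixes A :: "'a::euclidean_space set"
  assumes "open A" "concave_on A h" "\<And>s. s \<in> A \<Longrightarrow> 0 \<le> h s" "s0 \<in> A" "0 < h s0" "s \<in> A"
  shows "0 < h s"
proof -
  have "continuous_on UNIV (\<lambda>r. s + r *\<^sub>R (s - s0))" by (intro continuous_intros)
  then have "open ((\<lambda>r. s + r *\<^sub>R (s - s0)) -` A)" by (rule open_vimage[OF assms(1)])
  moreover have "0 \<in> (\<lambda>r. s + r *\<^sub>R (s - s0)) -` A" using assms(6) by simp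
  ultimately obtain e where e: "e > 0" "cball 0 e \<subseteq> (\<lambda>r. s + r *\<^sub>R (s - s0)) -` A"
    using open_contains_cball by blast
  have "e \<in> cball 0 e" using e(1) by simp
  then have s': "s + e *\<^sub>R (s - s0) \<in> A" using e(2) by blast
  \<comment> \<open>The weight for which the prolonged end and \<open>s0\<close> combine to
    \<open>s\<close>: it satisfies \<open>(1 - u) (1 + e) = 1\<close> and
    \<open>u = (1 - u) e\<close>.\<close>
  define u where "u = e / (1 + e)"
  have u: "0 < u" "u < 1" using e(1) by (auto simp: u_def)
  have u1: "1 - u = 1 / (1 + e)" using e(1) by (simp add: u_def field_simps)
  have "(1 - u) *\<^sub>R (s + e *\<^sub>R (s - s0)) + u *\<^sub>R s0 = (1 - u) *\<^sub>R ((1 + e) *\<^sub>R s) + (u - (1 - u) * e) *\<^sub>R s0"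
    by (simp add: algebra_simps)
  also have "(1 - u) *\<^sub>R ((1 + e) *\<^sub>R s) = s" using e(1) unfolding u1 by simp
  also have "u - (1 - u) * e = 0" unfolding u1 by (simp add: u_def)
  finally have s: "(1 - u) *\<^sub>R (s + e *\<^sub>R (s - s0)) + u *\<^sub>R s0 = s" by simp
  have "(1 - u) * h (s + e *\<^sub>R (s - s0)) + u * h s0 \<le> h s"
    using concave_onD[OF assms(2), of u "s + e *\<^sub>R (s - s0)" s0] u s' assms(4) by (simp add: s)
  moreover have "0 \<le> (1 - u) * h (s + e *\<^sub>R (s - s0))" using u assms(3)[OF s'] by simp
  moreover have "0 < u * h s0" using u assms(5) by simp
  ultimately show ?thesis by linarith
qed

text \<open>Under the roots stand one third of the two sides of the reverse Hoelder inequality,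
  divided by \<open>I1 ^ 3\<close>; the bound and the equality case therefore transfer by
  monotonicity of the root.\<close>

lemma limit_constants_as_sqrt:
  fixes a I1 I3 d :: real
  assumes "0 \<le> a" "0 < I1" "0 < I3" "0 < d"
  shows "2 * a * (I3 / 12) powr (1/2) / I1 powr (3/2) = sqrt (a\<^sup>2 * I3 / (3 * I1 ^ 3))"
    and "d * (2 / ((d + 1) * (d + 2))) powr (1/2) = sqrt (6 * d\<^sup>2 / ((d + 1) * (d + 2)) / 3)"
proof -
  have I: "I1 powr (3/2) = sqrt (I1 ^ 3)"
    using assms(2) powr_powr[of I1 3 "1/2"] by (simp add: powr_half_sqrt)
  have "2 * a * (I3 / 12) powr (1/2) / I1 powr (3/2) = sqrt (4 * a\<^sup>2) * sqrt (I3 / 12) / sqrt (I1 ^ 3)"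
    using assms by (simp add: I powr_half_sqrt real_sqrt_mult)
  also have "\<dots> = sqrt (4 * a\<^sup>2 * (I3 / 12) / I1 ^ 3)" by (simp only: real_sqrt_mult real_sqrt_divide)
  also have "4 * a\<^sup>2 * (I3 / 12) / I1 ^ 3 = a\<^sup>2 * I3 / (3 * I1 ^ 3)" by simp
  finally show "2 * a * (I3 / 12) powr (1/2) / I1 powr (3/2) = sqrt (a\<^sup>2 * I3 / (3 * I1 ^ 3))" .
  have "d * (2 / ((d + 1) * (d + 2))) powr (1/2) = sqrt (d\<^sup>2) * sqrt (2 / ((d + 1) * (d + 2)))"
    using assms by (simp add: powr_half_sqrt)
  also have "\<dots> = sqrt (d\<^sup>2 * (2 / ((d + 1) * (d + 2))))" by (simp only: real_sqrt_mult)
  also have "d\<^sup>2 * (2 / ((d + 1) * (d + 2))) = 6 * d\<^sup>2 / ((d + 1) * (d + 2)) / 3" by simp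
  finally show "d * (2 / ((d + 1) * (d + 2))) powr (1/2) = sqrt (6 * d\<^sup>2 / ((d + 1) * (d + 2)) / 3)" .
qed

theorem theorem4p2:
  fixes A :: "'a::euclidean_space set" and hm hp :: "'a \<Rightarrow> real" and d :: nat
  assumes "d \<ge> 2" and "DIM('a) = d - 1"
    and "A \<noteq> {}" and "bounded A" and "open A" and "convex A"
    and "\<exists>C. C-lipschitz_on A hm" and "\<exists>C. C-lipschitz_on A hp"
    and "convex_on A hm" and "concave_on A hp"
    and "\<forall>s\<in>A. hm s \<le> hp s" and "\<exists>s\<in>A. hp s - hm s \<noteq> 0"
  shows "\<exists>L::real.
    ((\<lambda>\<epsilon>. F_half (thin_domain A hm hp \<epsilon>)) \<longlongrightarrow> ereal L) (at_right 0) \<and>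
    L \<le> real d * (2 / ((real d + 1) * (real d + 2))) powr (1/2) \<and>
    (A = ball 0 1 \<and> (\<forall>s\<in>A. hp s - hm s = 1 - norm s) \<longrightarrow>
       L = real d * (2 / ((real d + 1) * (real d + 2))) powr (1/2))"
proof -
  define h where "h s = hp s - hm s" for s
  have conc: "concave_on A h"
    using convex_on_add[OF assms(9), of "\<lambda>s. - hp s"] assms(10) unfolding concave_on_def h_def by simp
  \<comment> \<open>One point with \<open>h s0 \<noteq> 0\<close> is enough: concavity and
    nonnegativity spread positivity over the open set \<open>A\<close>, which supplies the strict
    order demanded by the locale.\<close>
  obtain s0 where s0: "s0 \<in> A" "0 < h s0" using assms(11,12) unfolding h_def by (metis diff_ge_0_iff_ge less_le)
  have hpos: "0 < h s" if "s \<in> A" for s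
    using concave_on_pos[OF assms(5) conc _ s0 that] assms(11) by (simp add: h_def)
  \<comment> \<open>A convex function on a bounded open set may blow up at the boundary; the
    Lipschitz condition excludes this and provides the common bound \<open>M\<close>.\<close>
  have bdd: "bounded (k ` A)" if "\<exists>C. C-lipschitz_on A k" for k :: "'a \<Rightarrow> real"
  proof -
    from that obtain C where "C-lipschitz_on A k" by blast
    then have "uniformly_continuous_on A k" by (rule lipschitz_on_uniformly_continuous)
    then show ?thesis using assms(4) by (rule bounded_uniformly_continuous_image)
  qed
  obtain M1 M2 where M12: "\<And>s. s \<in> A \<Longrightarrow> \<bar>hm s\<bar> \<le> M1" "\<And>s. s \<in> A \<Longrightarrow> \<bar>hp s\<bar> \<le> M2"
    using bdd[OF assms(7)] bdd[OF assms(8)] by (auto simp: bounded_iff)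
  define M where "M = max M1 M2"
  have M: "- M \<le> hm s" "hp s \<le> M" "h s \<le> 2 * M" if "s \<in> A" for s
    using M12[OF that] by (auto simp: M_def h_def)
  have M0: "0 \<le> M" using M12[OF s0(1)] by (auto simp: M_def)
  have cont: "continuous_on A hm" "continuous_on A hp"
    using assms(7,8) lipschitz_on_continuous_on by blast+
  interpret thin_family A hm hp M
    by unfold_locales (use assms(4,5) cont M hpos in \<open>auto simp: h_def\<close>)
  define a I1 I3 where "a = measure lborel A" and "I1 = (LINT s:A|lborel. h s)" and "I3 = (LINT s:A|lborel. h s ^ 3)"
  have d: "d = DIM('a) + 1" using assms(1,2) by simp
  have I: "a\<^sup>2 * I3 \<le> 6 * (real d)\<^sup>2 / ((real d + 1) * (real d + 2)) * I1 ^ 3" "0 < I1" "0 < I3"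
    and I_cone: "A = ball 0 1 \<Longrightarrow> (\<And>s. s \<in> A \<Longrightarrow> h s = 1 - norm s) \<Longrightarrow>
      a\<^sup>2 * I3 = 6 * (real d)\<^sup>2 / ((real d + 1) * (real d + 2)) * I1 ^ 3"
    using concave_reverse_Hoelder[OF assms(5,4,3) conc hpos M(3)] unfolding a_def I1_def I3_def d by auto
  define L where "L = 2 * a * (I3 / 12) powr (1/2) / I1 powr (3/2)"
  let ?\<Omega> = "thin_domain A hm hp"
  obtain C where C: "\<And>\<epsilon>. \<epsilon> > 0 \<Longrightarrow> perimeter (?\<Omega> \<epsilon>) \<le> ereal (2 * a + C * \<epsilon>)"
    using perimeter_thin_domain_le[OF assms(5,4,9,10) M(1,2) M0] unfolding a_def by blast
  \<comment> \<open>For \<open>\<epsilon> > 0\<close> the perimeter is trapped between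
    \<open>2 * a\<close> and \<open>2 * a + C * \<epsilon>\<close>, so it is finite and
    \<open>real_of_ereal\<close> loses nothing.\<close>
  define P where "P \<epsilon> = real_of_ereal (perimeter (?\<Omega> \<epsilon>))" for \<epsilon>
  define T where "T \<epsilon> = torsional_rigidity (?\<Omega> \<epsilon>) / \<epsilon> ^ 3" for \<epsilon>
  \<comment> \<open>With the torsional rigidity written as
    \<open>\<epsilon> ^ 3 * T \<epsilon>\<close> and the volume as \<open>\<epsilon> * I1\<close>,
    both powers in \<open>F_half\<close> contribute the factor \<open>\<epsilon> powr (3/2)\<close>,
    which cancels.\<close>
  have eps: "perimeter (?\<Omega> \<epsilon>) = ereal (P \<epsilon>) \<and> 2 * a \<le> P \<epsilon> \<and> P \<epsilon> \<le> 2 * a + C * \<epsilon>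
      \<and> F_half (?\<Omega> \<epsilon>) = ereal (P \<epsilon> * T \<epsilon> powr (1/2) / I1 powr (3/2))" if e: "\<epsilon> > 0" for \<epsilon>
  proof -
    interpret e: thin_family A "\<lambda>s. \<epsilon> * hm s" "\<lambda>s. \<epsilon> * hp s" "\<epsilon> * M" by (rule scaled[OF e])
    have dom: "?\<Omega> \<epsilon> = e.U" by (simp add: thin_domain_def)
    have ge: "ereal (2 * a) \<le> perimeter (?\<Omega> \<epsilon>)" unfolding dom a_def by (rule e.perimeter_ge)
    have P: "perimeter (?\<Omega> \<epsilon>) = ereal (P \<epsilon>)"
      using ge C[OF e] unfolding P_def by (cases "perimeter (?\<Omega> \<epsilon>)") auto
    have T0: "0 \<le> T \<epsilon>" using e.torsional_rigidity_nonneg e by (simp add: T_def dom)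
    have TR: "torsional_rigidity (?\<Omega> \<epsilon>) = \<epsilon> ^ 3 * T \<epsilon>" using e by (simp add: T_def)
    have m: "measure lborel (?\<Omega> \<epsilon>) = \<epsilon> * I1"
      unfolding dom e.measure_U I1_def h_def by (simp add: right_diff_distrib[symmetric])
    have p32: "(\<epsilon> ^ 3) powr (1/2) = \<epsilon> powr (3/2)" using e powr_powr[of \<epsilon> 3 "1/2"] by simp
    have "torsional_rigidity (?\<Omega> \<epsilon>) powr (1/2) = \<epsilon> powr (3/2) * T \<epsilon> powr (1/2)"
      unfolding TR using e T0 by (simp add: powr_mult p32)
    moreover have "measure lborel (?\<Omega> \<epsilon>) powr (3/2) = \<epsilon> powr (3/2) * I1 powr (3/2)"
      unfolding m using e I(2) by (simp add: powr_mult)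
    ultimately have "F_half (?\<Omega> \<epsilon>) = ereal (P \<epsilon> * (\<epsilon> powr (3/2) * T \<epsilon> powr (1/2)) / (\<epsilon> powr (3/2) * I1 powr (3/2)))"
      unfolding F_half_def P using e I(2) by simp
    also have "P \<epsilon> * (\<epsilon> powr (3/2) * T \<epsilon> powr (1/2)) / (\<epsilon> powr (3/2) * I1 powr (3/2)) = P \<epsilon> * T \<epsilon> powr (1/2) / I1 powr (3/2)"
      using e by simp
    finally show ?thesis using P ge C[OF e] by simp
  qed
  have pos: "\<forall>\<^sub>F \<epsilon> in at_right 0. (0::real) < \<epsilon>" by (rule eventually_at_right_less)
  have P_lim: "(P \<longlongrightarrow> 2 * a) (at_right 0)"
  proof (rule tendsto_sandwich)
    show "\<forall>\<^sub>F \<epsilon> in at_right 0. 2 * a \<le> P \<epsilon>" using pos by eventually_elim (use eps in blast)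
    show "\<forall>\<^sub>F \<epsilon> in at_right 0. P \<epsilon> \<le> 2 * a + C * \<epsilon>" using pos by eventually_elim (use eps in blast)
    have "((\<lambda>\<epsilon>. 2 * a + C * \<epsilon>) \<longlongrightarrow> 2 * a + C * 0) (at_right 0)" by (intro tendsto_intros)
    then show "((\<lambda>\<epsilon>. 2 * a + C * \<epsilon>) \<longlongrightarrow> 2 * a) (at_right 0)" by simp
  qed (rule tendsto_const)
  have T_lim: "(T \<longlongrightarrow> I3 / 12) (at_right 0)"
    using torsional_rigidity_thin_limit[OF assms(3)] unfolding T_def[abs_def] I3_def h_def .
  \<comment> \<open>Positivity of \<open>I3\<close> keeps the limit of \<open>T\<close> away from
    \<open>0\<close>, so that the square root may be passed to the limit; positivity of
    \<open>I1\<close> gives a nonzero denominator.\<close>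
  have "((\<lambda>\<epsilon>. P \<epsilon> * T \<epsilon> powr (1/2) / I1 powr (3/2)) \<longlongrightarrow> L) (at_right 0)"
    unfolding L_def by (intro tendsto_intros P_lim T_lim) (use I in auto)
  then have "((\<lambda>\<epsilon>. ereal (P \<epsilon> * T \<epsilon> powr (1/2) / I1 powr (3/2))) \<longlongrightarrow> ereal L) (at_right 0)"
    by simp
  moreover have "\<forall>\<^sub>F \<epsilon> in at_right 0. ereal (P \<epsilon> * T \<epsilon> powr (1/2) / I1 powr (3/2)) = F_half (?\<Omega> \<epsilon>)"
    using pos by eventually_elim (use eps in simp)
  ultimately have lim: "((\<lambda>\<epsilon>. F_half (?\<Omega> \<epsilon>)) \<longlongrightarrow> ereal L) (at_right 0)"
    by (rule Lim_transform_eventually)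
  have a0: "0 \<le> a" by (simp add: a_def)
  have d0: "0 < real d" using assms(1) by simp
  note eqs = limit_constants_as_sqrt[OF a0 I(2,3) d0]
  have div: "a\<^sup>2 * I3 / (3 * I1 ^ 3) = (a\<^sup>2 * I3 / I1 ^ 3) / 3" by simp
  have I13: "0 < I1 ^ 3" using I(2) by simp
  show ?thesis
  proof (intro exI[of _ L] conjI impI lim)
    show "L \<le> real d * (2 / ((real d + 1) * (real d + 2))) powr (1/2)"
    proof -
      have "a\<^sup>2 * I3 / I1 ^ 3 \<le> 6 * (real d)\<^sup>2 / ((real d + 1) * (real d + 2))"
        unfolding pos_divide_le_eq[OF I13] by (rule I(1))
      then show ?thesis unfolding L_def eqs div by (intro real_sqrt_le_mono divide_right_mono) auto
    qed
    assume cone: "A = ball 0 1 \<and> (\<forall>s\<in>A. hp s - hm s = 1 - norm s)"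
    then have "a\<^sup>2 * I3 = 6 * (real d)\<^sup>2 / ((real d + 1) * (real d + 2)) * I1 ^ 3"
      by (intro I_cone) (auto simp: h_def)
    then have "a\<^sup>2 * I3 / I1 ^ 3 = 6 * (real d)\<^sup>2 / ((real d + 1) * (real d + 2))"
      using I13 by (subst nonzero_divide_eq_eq) auto
    then show "L = real d * (2 / ((real d + 1) * (real d + 2))) powr (1/2)"
      unfolding L_def eqs div by (simp only:)
  qed
qed

end
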